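(* Let $f,p,n,V,\langle\,,\rangle,A$ be data as in the context, with the associated $\widehat M$, $G$ and $\varPi$. Suppose that a subgroup $\Gamma\subset G$ acts on $\widehat M=\mathbb R^2\times V$ freely and properly discontinuously with a compact quotient $M=\widehat M/\Gamma$, and let $\Sigma=\Gamma\cap\operatorname{Ker}\varPi$. Then: (i) the image $\varPi(\Gamma)$ equals $m\mathbb Z$ for some integer $m>0$; (ii) $M$ is the total space of a $C^\infty$ bundle over the circle $\mathbb R/\varPi(\Gamma)$, and the mapping $\widehat M\ni(t,s,v)\mapsto p^{-1}t\in\mathbb R$ descends to the bundle projection $M\to\mathbb R/\varPi(\Gamma)$; denote by $\mathrm{pr}:\widehat M\to\mathbb R/\varPi(\Gamma)$ the composite of $\widehat M\to M$ with this bundle projection, and write $\mathrm{pr}(t)$ for its value at any point $(t,s,v)$; (iii) for every $t\in\mathbb R$, the submanifold $\widehat M_t=\{t\}\times\mathbb R\times V$ of $\widehat M$ is invariant under the subgroup $\Sigma$ of $\Gamma$, the action of $\Sigma$ on $\widehat M_t$ is properly discontinuous, and the inclusion $\widehat M_t\to\widehat M$ descends to an embedding $\widehat M_t/\Sigma\to M$, the image of which is the fibre $M_{\mathrm{pr}(t)}$ of the bundle $M$ over the point $\mathrm{pr}(t)$ of the base circle; (iv) $\Sigma$ acts on each $\widehat M_t$ by affine transformations whose linear parts preserve the vector $(0,1,0)\in\{0\}\times\mathbb R\times V$; this gives rise to a flat torsionfree connection with a nonzero parallel vector field on the compact fibre $M_{\mathrm{pr}(t)}$.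
   Context: Data: $f:\mathbb R\to\mathbb R$ is a nonconstant $C^\infty$ function, periodic with a period $p>0$; $n\ge4$ is an integer; $V$ is a real vector space of dimension $n-2$; $\langle\,,\rangle$ is a pseudo-Euclidean inner product on $V$ (a nondegenerate symmetric bilinear form, of any signature); $A:V\to V$ is a nonzero, traceless, $\langle\,,\rangle$-self-adjoint linear operator. $\widehat M=\mathbb R^2\times V$, with points written $(t,s,v)$, $t,s\in\mathbb R$, $v\in V$. $\mathcal E$ is the vector space of all $C^\infty$ solutions $u:\mathbb R\to V$ of $\ddot u(t)=f(t)u(t)+Au(t)$. For $u,w\in\mathcal E$, $\varOmega(u,w)=\langle\dot u,w\rangle-\langle u,\dot w\rangle$, which is a constant function and so defines a nondegenerate skew-symmetric bilinear form $\varOmega:\mathcal E\times\mathcal E\to\mathbb R$. $T:\mathcal E\to\mathcal E$ is the linear isomorphism $(Tu)(t)=u(t-p)$; it preserves $\varOmega$. $G=\mathbb Z\times\mathbb R\times\mathcal E$ is the Lie group with multiplication $$(k,q,u)\cdot(l,r,w)=(k+l,\;q+r-\varOmega(u,T^lw),\;T^{-l}u+w),$$ acting on $\widehat M$ by $$(k,q,u)\cdot(t,s,v)=(t+kp,\;s+q-\langle\dot u(t),2v+u(t)\rangle,\;v+u(t)).$$ $\varPi:G\to\mathbb Z$ is the homomorphism $\varPi(k,q,u)=k$. A free action of a group $\Gamma$ by diffeomorphisms on a manifold $\widehat M$ is called properly discontinuous if there exists a locally diffeomorphic surjective mapping $\pi:\widehat M\to M$ onto some manifold $M$ such that the $\pi$-preimages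 of points of $M$ are precisely the orbits of the $\Gamma$-action; then $M=\widehat M/\Gamma$ is called the quotient. *)

theory Defs
  imports "HOL-Analysis.Analysis" "HOL-Algebra.Group_Action" "HOL-Algebra.Elementary_Groups"
begin

section \<open>Smooth maps between open subsets of normed spaces\<close>

text \<open>Class \<open>C\<^sup>k\<close>, by recursion on \<open>k\<close> through all directional derivatives.  It is used only
  for open sets \<open>S\<close> in finite-dimensional spaces, where it is the usual notion.\<close>

primrec Ck_on :: "nat \<Rightarrow> 'a::real_normed_vector set \<Rightarrow> ('a \<Rightarrow> 'b::real_normed_vector) \<Rightarrow> bool" where
  "Ck_on 0 S f \<longleftrightarrow> continuous_on S f"
| "Ck_on (Suc k) S f \<longleftrightarrow>
     (\<forall>x\<in>S. f differentiable (at x)) \<and> (\<forall>v. Ck_on k S (\<lambda>x. frechet_derivative f (at x) v))"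

definition smooth_on :: "'a::real_normed_vector set \<Rightarrow> ('a \<Rightarrow> 'b::real_normed_vector) \<Rightarrow> bool" where
  "smooth_on S f \<longleftrightarrow> (\<forall>k. Ck_on k S f)"


section \<open>Smooth manifolds\<close>

text \<open>A manifold is a topology on a carrier contained in the type \<open>'m\<close>, with an atlas (not
  necessarily maximal) of charts \<open>(U, \<phi>)\<close> onto open subsets of the model space \<open>'e\<close>.  The values of
  \<open>\<phi>\<close> outside \<open>U\<close> are irrelevant.\<close>

type_synonym ('m, 'e) chart = "'m set \<times> ('m \<Rightarrow> 'e)"

record ('m, 'e) mfd =
  mtop :: "'m topology"
  atlas :: "('m, 'e) chart set"

abbreviation pts :: "('m, 'e) mfd \<Rightarrow> 'm set" where
  "pts M \<equiv> topspace (mtop M)"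

definition second_countable_top :: "'m topology \<Rightarrow> bool" where
  "second_countable_top X \<longleftrightarrow>
     (\<exists>B. countable B \<and> (\<forall>V\<in>B. openin X V) \<and> (\<forall>U. openin X U \<longrightarrow> (\<exists>B'\<subseteq>B. U = \<Union>B')))"

definition smooth_manifold :: "('m, 'e::euclidean_space) mfd \<Rightarrow> bool" where
  "smooth_manifold M \<longleftrightarrow>
     Hausdorff_space (mtop M) \<and> second_countable_top (mtop M) \<and>
     \<Union>(fst ` atlas M) = pts M \<and>
     (\<forall>(U, \<phi>)\<in>atlas M. openin (mtop M) U \<and> open (\<phi> ` U) \<and>
        homeomorphic_map (subtopology (mtop M) U) (top_of_set (\<phi> ` U)) \<phi>) \<and>
     (\<forall>(U, \<phi>)\<in>atlas M. \<forall>(W, \<psi>)\<in>atlas M.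
        smooth_on (\<phi> ` (U \<inter> W)) (\<psi> \<circ> inv_into U \<phi>))"

definition local_rep :: "('m \<Rightarrow> 'n) \<Rightarrow> ('m, 'e) chart \<Rightarrow> ('n, 'd) chart \<Rightarrow> 'e \<Rightarrow> 'd" where
  "local_rep h c d = snd d \<circ> h \<circ> inv_into (fst c) (snd c)"

definition local_dom :: "('m \<Rightarrow> 'n) \<Rightarrow> ('m, 'e) chart \<Rightarrow> ('n, 'd) chart \<Rightarrow> 'e set" where
  "local_dom h c d = snd c ` (fst c \<inter> h -` fst d)"

definition smooth_map ::
    "('m, 'e::euclidean_space) mfd \<Rightarrow> ('n, 'd::euclidean_space) mfd \<Rightarrow> ('m \<Rightarrow> 'n) \<Rightarrow> bool" where
  "smooth_map M N h \<longleftrightarrow> continuous_map (mtop M) (mtop N) h \<and>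
     (\<forall>c\<in>atlas M. \<forall>d\<in>atlas N. smooth_on (local_dom h c d) (local_rep h c d))"

definition diffeomorphism ::
    "('m, 'e::euclidean_space) mfd \<Rightarrow> ('n, 'd::euclidean_space) mfd \<Rightarrow> ('m \<Rightarrow> 'n) \<Rightarrow> bool" where
  "diffeomorphism M N h \<longleftrightarrow> bij_betw h (pts M) (pts N) \<and>
     smooth_map M N h \<and> smooth_map N M (inv_into (pts M) h)"

definition open_submfd :: "('m, 'e) mfd \<Rightarrow> 'm set \<Rightarrow> ('m, 'e) mfd" where
  "open_submfd M U = \<lparr>mtop = subtopology (mtop M) U, atlas = {(W \<inter> U, \<phi>) |W \<phi>. (W, \<phi>) \<in> atlas M}\<rparr>"

definition prod_mfd :: "('m, 'e) mfd \<Rightarrow> ('n, 'd) mfd \<Rightarrow> ('m \<times> 'n, 'e \<times> 'd) mfd" where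
  "prod_mfd M N = \<lparr>mtop = prod_topology (mtop M) (mtop N),
     atlas = {(U \<times> W, map_prod \<phi> \<psi>) |U \<phi> W \<psi>. (U, \<phi>) \<in> atlas M \<and> (W, \<psi>) \<in> atlas N}\<rparr>"

definition local_diffeo ::
    "('m, 'e::euclidean_space) mfd \<Rightarrow> ('n, 'd::euclidean_space) mfd \<Rightarrow> ('m \<Rightarrow> 'n) \<Rightarrow> bool" where
  "local_diffeo M N h \<longleftrightarrow> (\<forall>x\<in>pts M. \<exists>U. x \<in> U \<and> openin (mtop M) U \<and> openin (mtop N) (h ` U) \<and>
     diffeomorphism (open_submfd M U) (open_submfd N (h ` U)) h)"

definition smooth_embedding ::
    "('m, 'e::euclidean_space) mfd \<Rightarrow> ('n, 'd::euclidean_space) mfd \<Rightarrow> ('m \<Rightarrow> 'n) \<Rightarrow> bool" where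
  "smooth_embedding M N h \<longleftrightarrow> smooth_map M N h \<and> embedding_map (mtop M) (mtop N) h \<and>
     (\<forall>c\<in>atlas M. \<forall>d\<in>atlas N. \<forall>y\<in>local_dom h c d.
        inj (frechet_derivative (local_rep h c d) (at y)))"

text \<open>A \<open>C\<^sup>\<infinity>\<close> fibre bundle with total space \<open>E\<close>, base \<open>B\<close>, typical fibre \<open>F\<close>, projection \<open>\<beta>\<close>.\<close>

definition smooth_bundle ::
    "('m, 'e::euclidean_space) mfd \<Rightarrow> ('b, 'c::euclidean_space) mfd \<Rightarrow>
     ('k, 'd::euclidean_space) mfd \<Rightarrow> ('m \<Rightarrow> 'b) \<Rightarrow> bool" where
  "smooth_bundle E B F \<beta> \<longleftrightarrow>
     smooth_manifold E \<and> smooth_manifold B \<and> smooth_manifold F \<and>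
     smooth_map E B \<beta> \<and> \<beta> ` pts E = pts B \<and>
     (\<forall>b\<in>pts B. \<exists>U \<Phi>. b \<in> U \<and> openin (mtop B) U \<and>
        diffeomorphism (open_submfd E {x \<in> pts E. \<beta> x \<in> U}) (prod_mfd (open_submfd B U) F) \<Phi> \<and>
        (\<forall>x\<in>pts E. \<beta> x \<in> U \<longrightarrow> fst (\<Phi> x) = \<beta> x))"

definition euclidean_mfd :: "('e::euclidean_space, 'e) mfd" where
  "euclidean_mfd = \<lparr>mtop = euclidean, atlas = {(UNIV, id)}\<rparr>"

text \<open>The quotient \<open>\<real>/D\<close> for a group \<open>D\<close> of integers: its points are cosets, its topology is the
  quotient topology, and its charts invert the projection on open sets where it is injective.\<close>

definition real_coset :: "int set \<Rightarrow> real \<Rightarrow> real set" where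
  "real_coset D x = {x + of_int k |k. k \<in> D}"

definition real_quot :: "int set \<Rightarrow> (real set, real) mfd" where
  "real_quot D =
     \<lparr>mtop = topology (\<lambda>S. S \<subseteq> range (real_coset D) \<and> open (real_coset D -` S)),
      atlas = {(real_coset D ` U, inv_into U (real_coset D)) |U. open U \<and> inj_on (real_coset D) U}\<rparr>"


section \<open>Group actions and their quotients\<close>

definition free_diffeo_action ::
    "('g, 'x) monoid_scheme \<Rightarrow> ('g \<Rightarrow> 'm \<Rightarrow> 'm) \<Rightarrow> ('m, 'e::euclidean_space) mfd \<Rightarrow> bool" where
  "free_diffeo_action G a X \<longleftrightarrow>
     group_action G (pts X) (\<lambda>g. restrict (a g) (pts X)) \<and>
     (\<forall>g\<in>carrier G. diffeomorphism X X (a g)) \<and>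
     (\<forall>g\<in>carrier G. \<forall>x\<in>pts X. a g x = x \<longrightarrow> g = \<one>\<^bsub>G\<^esub>)"

definition quotient_projection ::
    "('g, 'x) monoid_scheme \<Rightarrow> ('g \<Rightarrow> 'm \<Rightarrow> 'm) \<Rightarrow> ('m, 'e::euclidean_space) mfd \<Rightarrow>
     ('n, 'e) mfd \<Rightarrow> ('m \<Rightarrow> 'n) \<Rightarrow> bool" where
  "quotient_projection G a X M q \<longleftrightarrow>
     smooth_manifold M \<and> local_diffeo X M q \<and> q ` pts X = pts M \<and>
     (\<forall>x\<in>pts X. {y \<in> pts X. q y = q x} = orbit G a x)"

text \<open>The carrier type \<open>'m set\<close> of the quotient is no restriction: the points of any quotient
  correspond bijectively to orbits.\<close>

definition properly_discontinuous ::
    "('g, 'x) monoid_scheme \<Rightarrow> ('g \<Rightarrow> 'm \<Rightarrow> 'm) \<Rightarrow> ('m, 'e::euclidean_space) mfd \<Rightarrow> bool" where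
  "properly_discontinuous G a X \<longleftrightarrow> free_diffeo_action G a X \<and>
     (\<exists>(M :: ('m set, 'e) mfd) q. quotient_projection G a X M q)"

definition affine_with_linear_part ::
    "'a::real_vector set \<Rightarrow> ('a \<Rightarrow> 'a) \<Rightarrow> ('a \<Rightarrow> 'a) \<Rightarrow> bool" where
  "affine_with_linear_part S g L \<longleftrightarrow>
     bij_betw g S S \<and> linear L \<and> (\<forall>x\<in>S. \<forall>y\<in>S. g x - g y = L (x - y))"


section \<open>Connections and vector fields in charts\<close>

text \<open>A connection is given by its Christoffel symbols: \<open>C c y a b\<close> is the value at \<open>y\<close>, in the chart
  \<open>c\<close>, of the bilinear Christoffel map on \<open>a, b\<close>, so that the covariant derivative of \<open>X\<close> along \<open>a\<close> is
  \<open>D\<^sub>a X + C c y a X\<close>.  A vector field is given by its components \<open>X c y\<close>.\<close>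

type_synonym ('m, 'e) connection = "('m, 'e) chart \<Rightarrow> 'e \<Rightarrow> 'e \<Rightarrow> 'e \<Rightarrow> 'e"
type_synonym ('m, 'e) vfield = "('m, 'e) chart \<Rightarrow> 'e \<Rightarrow> 'e"

text \<open>\<open>h\<close> maps the connection \<open>C\<close> to the connection \<open>D\<close>: in charts, with \<open>F\<close> representing \<open>h\<close>,
  \<open>D\<^sup>2F(a,b) + D(DF a, DF b) = DF (C(a,b))\<close>.  For \<open>h = id\<close> this is the classical transformation law of
  Christoffel symbols.\<close>

definition connection_related ::
    "('m, 'e::euclidean_space) mfd \<Rightarrow> ('m, 'e) connection \<Rightarrow>
     ('n, 'd::euclidean_space) mfd \<Rightarrow> ('n, 'd) connection \<Rightarrow> ('m \<Rightarrow> 'n) \<Rightarrow> bool" where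
  "connection_related M C N D h \<longleftrightarrow>
     (\<forall>c\<in>atlas M. \<forall>d\<in>atlas N. \<forall>y\<in>local_dom h c d. \<forall>a b.
        let F = local_rep h c d; DF = (\<lambda>z. frechet_derivative F (at z)) in
          frechet_derivative (\<lambda>z. DF z b) (at y) a + D d (F y) (DF y a) (DF y b)
            = DF y (C c y a b))"

definition vfield_related ::
    "('m, 'e::euclidean_space) mfd \<Rightarrow> ('m, 'e) vfield \<Rightarrow>
     ('n, 'd::euclidean_space) mfd \<Rightarrow> ('n, 'd) vfield \<Rightarrow> ('m \<Rightarrow> 'n) \<Rightarrow> bool" where
  "vfield_related M X N Y h \<longleftrightarrow>
     (\<forall>c\<in>atlas M. \<forall>d\<in>atlas N. \<forall>y\<in>local_dom h c d.
        Y d (local_rep h c d y) = frechet_derivative (local_rep h c d) (at y) (X c y))"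

definition affine_connection ::
    "('m, 'e::euclidean_space) mfd \<Rightarrow> ('m, 'e) connection \<Rightarrow> bool" where
  "affine_connection M C \<longleftrightarrow>
     (\<forall>c\<in>atlas M. (\<forall>y\<in>snd c ` fst c. bilinear (C c y)) \<and>
        (\<forall>a b. smooth_on (snd c ` fst c) (\<lambda>y. C c y a b))) \<and>
     connection_related M C M C id"

definition torsionfree :: "('m, 'e::euclidean_space) mfd \<Rightarrow> ('m, 'e) connection \<Rightarrow> bool" where
  "torsionfree M C \<longleftrightarrow> (\<forall>c\<in>atlas M. \<forall>y\<in>snd c ` fst c. \<forall>a b. C c y a b = C c y b a)"

definition curvature :: "('m, 'e::euclidean_space) connection \<Rightarrow> ('m, 'e) chart \<Rightarrow> 'e \<Rightarrow> 'e \<Rightarrow> 'e \<Rightarrow> 'e \<Rightarrow> 'e" where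
  "curvature C c y a b e =
     frechet_derivative (\<lambda>z. C c z b e) (at y) a - frechet_derivative (\<lambda>z. C c z a e) (at y) b
     + C c y a (C c y b e) - C c y b (C c y a e)"

definition flat_connection :: "('m, 'e::euclidean_space) mfd \<Rightarrow> ('m, 'e) connection \<Rightarrow> bool" where
  "flat_connection M C \<longleftrightarrow> (\<forall>c\<in>atlas M. \<forall>y\<in>snd c ` fst c. \<forall>a b e. curvature C c y a b e = 0)"

definition vector_field :: "('m, 'e::euclidean_space) mfd \<Rightarrow> ('m, 'e) vfield \<Rightarrow> bool" where
  "vector_field M X \<longleftrightarrow>
     (\<forall>c\<in>atlas M. smooth_on (snd c ` fst c) (X c)) \<and> vfield_related M X M X id"

definition nowhere_zero :: "('m, 'e::euclidean_space) mfd \<Rightarrow> ('m, 'e) vfield \<Rightarrow> bool" where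
  "nowhere_zero M X \<longleftrightarrow> (\<forall>c\<in>atlas M. \<forall>y\<in>snd c ` fst c. X c y \<noteq> 0)"

definition parallel_vfield ::
    "('m, 'e::euclidean_space) mfd \<Rightarrow> ('m, 'e) connection \<Rightarrow> ('m, 'e) vfield \<Rightarrow> bool" where
  "parallel_vfield M C X \<longleftrightarrow>
     (\<forall>c\<in>atlas M. \<forall>y\<in>snd c ` fst c. \<forall>a. frechet_derivative (X c) (at y) a + C c y a (X c y) = 0)"


section \<open>The group and its action\<close>

definition trace_op :: "('v::euclidean_space \<Rightarrow> 'v) \<Rightarrow> real" where
  "trace_op A = (\<Sum>b\<in>Basis. A b \<bullet> b)"

definition pseudo_euclidean :: "('v::euclidean_space \<Rightarrow> 'v \<Rightarrow> real) \<Rightarrow> bool" where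
  "pseudo_euclidean ip \<longleftrightarrow> bilinear ip \<and> (\<forall>v w. ip v w = ip w v) \<and>
     (\<forall>v. (\<forall>w. ip v w = 0) \<longrightarrow> v = 0)"

abbreviation tderiv :: "(real \<Rightarrow> 'v::real_normed_vector) \<Rightarrow> real \<Rightarrow> 'v" where
  "tderiv u \<equiv> (\<lambda>t. vector_derivative u (at t))"

definition solution_space ::
    "(real \<Rightarrow> real) \<Rightarrow> ('v::euclidean_space \<Rightarrow> 'v) \<Rightarrow> (real \<Rightarrow> 'v) set" where
  "solution_space f A =
     {u. smooth_on UNIV u \<and> (\<forall>t. tderiv (tderiv u) t = f t *\<^sub>R u t + A (u t))}"

text \<open>On solutions the expression is constant in \<open>t\<close> (\<open>Omega_eq\<close> below), so evaluating it at \<open>0\<close> is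
  immaterial.\<close>

definition Omega ::
    "('v::euclidean_space \<Rightarrow> 'v \<Rightarrow> real) \<Rightarrow> (real \<Rightarrow> 'v) \<Rightarrow> (real \<Rightarrow> 'v) \<Rightarrow> real" where
  "Omega ip u w = ip (tderiv u 0) (w 0) - ip (u 0) (tderiv w 0)"

text \<open>The power \<open>T\<^sup>l\<close>, \<open>l \<in> \<int>\<close>, of the translation \<open>(Tu)(t) = u(t - p)\<close>.\<close>

definition Tpow :: "real \<Rightarrow> int \<Rightarrow> (real \<Rightarrow> 'v) \<Rightarrow> real \<Rightarrow> 'v" where
  "Tpow p l u = (\<lambda>t. u (t - of_int l * p))"

type_synonym 'v gelt = "int \<times> real \<times> (real \<Rightarrow> 'v)"

definition G_grp ::
    "(real \<Rightarrow> real) \<Rightarrow> real \<Rightarrow> ('v::euclidean_space \<Rightarrow> 'v \<Rightarrow> real) \<Rightarrow> ('v \<Rightarrow> 'v) \<Rightarrow> 'v gelt monoid" where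
  "G_grp f p ip A =
     \<lparr>carrier = UNIV \<times> UNIV \<times> solution_space f A,
      mult = (\<lambda>(k, q, u) (l, r, w).
        (k + l, q + r - Omega ip u (Tpow p l w), (\<lambda>t. Tpow p (- l) u t + w t))),
      one = (0, 0, \<lambda>t. 0)\<rparr>"

definition G_act ::
    "real \<Rightarrow> ('v::euclidean_space \<Rightarrow> 'v \<Rightarrow> real) \<Rightarrow> 'v gelt \<Rightarrow> real \<times> real \<times> 'v \<Rightarrow> real \<times> real \<times> 'v" where
  "G_act p ip = (\<lambda>(k, q, u) (t, s, v).
     (t + of_int k * p, s + q - ip (tderiv u t) (2 *\<^sub>R v + u t), v + u t))"

definition G_proj :: "'v gelt \<Rightarrow> int" where
  "G_proj = (\<lambda>(k, q, u). k)"

text \<open>The submanifold \<open>{t} \<times> \<real> \<times> V\<close>; its single chart identifies it with \<open>\<real> \<times> V\<close>.\<close>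

definition slice :: "real \<Rightarrow> (real \<times> real \<times> 'v::euclidean_space, real \<times> 'v) mfd" where
  "slice t = \<lparr>mtop = top_of_set ({t} \<times> UNIV), atlas = {({t} \<times> UNIV, snd)}\<rparr>"

section \<open>The data define a group and an action\<close>

lemma Ck_on_shift: "Ck_on k UNIV u \<Longrightarrow> Ck_on k UNIV (\<lambda>t::real. u (t - c))"
proof (induction k arbitrary: u)
  case 0
  then show ?case by (auto intro!: continuous_on_compose2[of UNIV u] continuous_intros)
next
  case (Suc k)
  have fd: "frechet_derivative (\<lambda>t. u (t - c)) (at x) = frechet_derivative u (at (x - c))"
    and df: "(\<lambda>t. u (t - c)) differentiable (at x)" for x
  proof -
    have "u differentiable (at (x - c))" using Suc.prems by auto
    then have "(u has_derivative frechet_derivative u (at (x - c))) (at (x - c))"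
      using frechet_derivative_works by blast
    moreover have "((\<lambda>t. t - c) has_derivative id) (at x)"
      by (auto intro!: derivative_eq_intros)
    ultimately have "((\<lambda>t. u (t - c)) has_derivative (frechet_derivative u (at (x - c)))) (at x)"
      using has_derivative_compose[of "\<lambda>t. t - c" id x UNIV u] by fastforce
    then show "frechet_derivative (\<lambda>t. u (t - c)) (at x) = frechet_derivative u (at (x - c))"
      "(\<lambda>t. u (t - c)) differentiable (at x)"
      using frechet_derivative_at differentiableI by metis+
  qed
  have "Ck_on k UNIV (\<lambda>x. frechet_derivative u (at (x - c)) v)" for v
    using Suc.IH[of "\<lambda>x. frechet_derivative u (at x) v"] Suc.prems by simp
  then show ?case by (simp add: fd df)
qed

lemma Ck_on_add: "Ck_on k UNIV u \<Longrightarrow> Ck_on k UNIV w \<Longrightarrow> Ck_on k UNIV (\<lambda>t. u t + w t)"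
proof (induction k arbitrary: u w)
  case 0
  then show ?case by (auto intro!: continuous_intros)
next
  case (Suc k)
  have "frechet_derivative (\<lambda>t. u t + w t) (at x)
      = (\<lambda>v. frechet_derivative u (at x) v + frechet_derivative w (at x) v)" for x
  proof -
    have "(u has_derivative frechet_derivative u (at x)) (at x)"
      "(w has_derivative frechet_derivative w (at x)) (at x)"
      using Suc.prems by (simp_all add: frechet_derivative_works[symmetric])
    from has_derivative_add[OF this] show ?thesis
      by (simp add: frechet_derivative_at[symmetric])
  qed
  with Suc show ?case by simp
qed

lemma Ck_on_minus: "Ck_on k UNIV u \<Longrightarrow> Ck_on k UNIV (\<lambda>t. - u t)"
proof (induction k arbitrary: u)
  case 0
  then show ?case by (auto intro!: continuous_intros)
next
  case (Suc k)
  have "frechet_derivative (\<lambda>t. - u t) (at x) = (\<lambda>v. - frechet_derivative u (at x) v)"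
    and "(\<lambda>t. - u t) differentiable (at x)" for x
  proof -
    have "(u has_derivative frechet_derivative u (at x)) (at x)"
      using Suc.prems frechet_derivative_works by auto
    from has_derivative_minus[OF this]
    show "frechet_derivative (\<lambda>t. - u t) (at x) = (\<lambda>v. - frechet_derivative u (at x) v)"
      and "(\<lambda>t. - u t) differentiable (at x)"
      by (simp_all add: frechet_derivative_at[symmetric] differentiableI)
  qed
  then show ?case using Suc by simp
qed

lemma Ck_on_const: "Ck_on k UNIV (\<lambda>t. c)"
  by (induction k arbitrary: c) auto

lemma smooth_on_has_vector_derivative:
  assumes "smooth_on UNIV (u :: real \<Rightarrow> 'b::real_normed_vector)"
  shows "(u has_vector_derivative tderiv u t) (at t)"
    "(tderiv u has_vector_derivative tderiv (tderiv u) t) (at t)"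
proof -
  have d: "u differentiable (at x)" for x
    using assms unfolding smooth_on_def by (metis Ck_on.simps(2) UNIV_I)
  have "Ck_on (Suc (Suc 0)) UNIV u" using assms by (simp only: smooth_on_def)
  then have d2: "(\<lambda>x. frechet_derivative u (at x) 1) differentiable (at x)" for x
    by (simp only: Ck_on.simps) blast
  have "(\<lambda>x. frechet_derivative u (at x) 1) = tderiv u"
    using d by (metis frechet_derivative_eq_vector_derivative scaleR_one)
  with d d2 show "(u has_vector_derivative tderiv u t) (at t)"
    "(tderiv u has_vector_derivative tderiv (tderiv u) t) (at t)"
    by (simp_all add: vector_derivative_works[symmetric])
qed

lemma pseudo_euclidean_bounded_bilinear: "pseudo_euclidean ip \<Longrightarrow> bounded_bilinear ip"
  by (simp add: pseudo_euclidean_def bilinear_conv_bounded_bilinear)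

lemma Omega_eq:
  assumes ip: "pseudo_euclidean ip" and A: "\<forall>v w. ip (A v) w = ip v (A w)"
    and u: "u \<in> solution_space f A" and w: "w \<in> solution_space f A"
  shows "ip (tderiv u t) (w t) - ip (u t) (tderiv w t) = Omega ip u w"
proof -
  interpret bounded_bilinear ip using pseudo_euclidean_bounded_bilinear[OF ip] .
  let ?h = "\<lambda>t. ip (tderiv u t) (w t) - ip (u t) (tderiv w t)"
  have su: "smooth_on UNIV u" "smooth_on UNIV w" using u w by (auto simp: solution_space_def)
  have "(?h has_vector_derivative 0) (at t)" for t
  proof -
    have "(?h has_vector_derivative
      (ip (tderiv u t) (tderiv w t) + ip (tderiv (tderiv u) t) (w t))
       - (ip (u t) (tderiv (tderiv w) t) + ip (tderiv u t) (tderiv w t))) (at t)"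
      by (intro has_vector_derivative_diff has_vector_derivative smooth_on_has_vector_derivative su)
    moreover have "ip (tderiv (tderiv u) t) (w t) = ip (u t) (tderiv (tderiv w) t)"
      using u w A by (simp add: solution_space_def add_left add_right scaleR_left scaleR_right)
    ultimately show ?thesis by simp
  qed
  then obtain c where "\<And>t. ?h t = c"
    using has_vector_derivative_zero_constant[of UNIV ?h] by auto
  then show ?thesis unfolding Omega_def by simp
qed

lemma smooth_on_shift: "smooth_on UNIV u \<Longrightarrow> smooth_on UNIV (\<lambda>t::real. u (t - c))"
  by (simp add: smooth_on_def Ck_on_shift)

lemma tderiv_shift:
  assumes "smooth_on UNIV u"  shows "tderiv (\<lambda>t. u (t - c)) = (\<lambda>t. tderiv u (t - c))"
    "tderiv (tderiv (\<lambda>t. u (t - c))) = (\<lambda>t. tderiv (tderiv u) (t - c))"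
proof -
  have g: "tderiv (\<lambda>t. g (t - c)) = (\<lambda>t. tderiv g (t - c))"
    if "\<And>t. (g has_vector_derivative tderiv g t) (at t)" for g :: "real \<Rightarrow> 'a"
  proof
    fix t
    have "((g \<circ> (\<lambda>t. t - c)) has_vector_derivative 1 *\<^sub>R tderiv g (t - c)) (at t)"
      using that by (intro vector_diff_chain_at) (auto intro!: derivative_eq_intros)
    then show "tderiv (\<lambda>t. g (t - c)) t = tderiv g (t - c)"
      by (simp add: o_def vector_derivative_at)
  qed
  show "tderiv (\<lambda>t. u (t - c)) = (\<lambda>t. tderiv u (t - c))" by (rule g) (rule smooth_on_has_vector_derivative(1)[OF assms])
  then show "tderiv (tderiv (\<lambda>t. u (t - c))) = (\<lambda>t. tderiv (tderiv u) (t - c))"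
    using g[of "tderiv u"] smooth_on_has_vector_derivative(2)[OF assms] by simp
qed

lemma tderiv_add:
  assumes "smooth_on UNIV u" "smooth_on UNIV w"
  shows "tderiv (\<lambda>t. u t + w t) = (\<lambda>t. tderiv u t + tderiv w t)"
    "tderiv (tderiv (\<lambda>t. u t + w t)) = (\<lambda>t. tderiv (tderiv u) t + tderiv (tderiv w) t)"
proof -
  show *: "tderiv (\<lambda>t. u t + w t) = (\<lambda>t. tderiv u t + tderiv w t)"
    by (intro ext vector_derivative_at has_vector_derivative_add smooth_on_has_vector_derivative assms)
  show "tderiv (tderiv (\<lambda>t. u t + w t)) = (\<lambda>t. tderiv (tderiv u) t + tderiv (tderiv w) t)"
    unfolding * by (intro ext vector_derivative_at has_vector_derivative_add smooth_on_has_vector_derivative assms)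
qed

lemma tderiv_minus:
  assumes "smooth_on UNIV u"
  shows "tderiv (\<lambda>t. - u t) = (\<lambda>t. - tderiv u t)"
    "tderiv (tderiv (\<lambda>t. - u t)) = (\<lambda>t. - tderiv (tderiv u) t)"
proof -
  show *: "tderiv (\<lambda>t. - u t) = (\<lambda>t. - tderiv u t)"
    by (intro ext vector_derivative_at has_vector_derivative_minus smooth_on_has_vector_derivative assms)
  show "tderiv (tderiv (\<lambda>t. - u t)) = (\<lambda>t. - tderiv (tderiv u) t)"
    unfolding * by (intro ext vector_derivative_at has_vector_derivative_minus smooth_on_has_vector_derivative assms)
qed

lemma sol_add: "linear A \<Longrightarrow> u \<in> solution_space f A \<Longrightarrow> w \<in> solution_space f A \<Longrightarrow> (\<lambda>t. u t + w t) \<in> solution_space f A"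
  using tderiv_add[of u w, THEN fun_cong] by (simp add: solution_space_def smooth_on_def Ck_on_add linear_add algebra_simps)

lemma sol_minus: "linear A \<Longrightarrow> u \<in> solution_space f A \<Longrightarrow> (\<lambda>t. - u t) \<in> solution_space f A"
  using tderiv_minus[of u, THEN fun_cong] by (simp add: solution_space_def smooth_on_def Ck_on_minus linear_neg algebra_simps)

lemma sol_zero: "linear A \<Longrightarrow> (\<lambda>t. 0) \<in> solution_space f A"
  by (auto simp: solution_space_def smooth_on_def Ck_on_const linear_0)

lemma periodic_int: fixes f :: "real \<Rightarrow> real" assumes "\<forall>t. f (t + p) = f t" shows "f (t - of_int l * p) = f t"
proof -
  have n: "f (t + of_nat k * p) = f t" for k t
  proof (induction k)
    case (Suc k)
    have "f (t + of_nat (Suc k) * p) = f ((t + of_nat k * p) + p)" by (simp add: algebra_simps)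
    also have "\<dots> = f t" using assms Suc by simp
    finally show ?case .
  qed simp
  show ?thesis
  proof (cases "l \<ge> 0")
    case True
    then show ?thesis using n[of "t - of_int l * p" "nat l"] by simp
  next
    case False
    then show ?thesis using n[of t "nat (-l)"] by simp
  qed
qed

lemma sol_T: assumes "\<forall>t. f (t + p) = f t" "u \<in> solution_space f A" shows "Tpow p l u \<in> solution_space f A"
  using assms(2) tderiv_shift[of u "of_int l * p", THEN fun_cong] periodic_int[OF assms(1), of _ l]
  by (simp add: solution_space_def Tpow_def smooth_on_shift)

lemma Omega_T:
  assumes "pseudo_euclidean ip" "\<forall>v w. ip (A v) w = ip v (A w)" "\<forall>t. f (t + p) = f t"
    "u \<in> solution_space f A" "w \<in> solution_space f A"
  shows "Omega ip (Tpow p l u) (Tpow p l w) = Omega ip u w"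
proof -
  have "tderiv (Tpow p l u) 0 = tderiv u (0 - of_int l * p)"
    "tderiv (Tpow p l w) 0 = tderiv w (0 - of_int l * p)"
    using tderiv_shift(1)[of u "of_int l * p", THEN fun_cong, of 0]
      tderiv_shift(1)[of w "of_int l * p", THEN fun_cong, of 0] assms(4,5)
    by (simp_all add: Tpow_def solution_space_def)
  then show ?thesis
    using Omega_eq[OF assms(1,2,4,5), of "- of_int l * p"] by (simp add: Omega_def Tpow_def)
qed

lemma Omega_add:
  assumes ip: "pseudo_euclidean ip" and "u \<in> solution_space f A" "w \<in> solution_space f A" 
  shows "Omega ip (\<lambda>t. u t + w t) z = Omega ip u z + Omega ip w z"
    "Omega ip z (\<lambda>t. u t + w t) = Omega ip z u + Omega ip z w"
proof -
  interpret ip: bounded_bilinear ip using pseudo_euclidean_bounded_bilinear[OF ip] .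
  have "tderiv (\<lambda>t. u t + w t) 0 = tderiv u 0 + tderiv w 0"
    using tderiv_add(1)[of u w, THEN fun_cong] assms by (simp add: solution_space_def)
  then show "Omega ip (\<lambda>t. u t + w t) z = Omega ip u z + Omega ip w z"
    "Omega ip z (\<lambda>t. u t + w t) = Omega ip z u + Omega ip z w"
    by (simp_all add: Omega_def ip.add_left ip.add_right)
qed

lemma Tpow_Tpow: "Tpow p k (Tpow p l u) = Tpow p (k + l) u"
  by (simp add: Tpow_def algebra_simps)

lemma Tpow_add: "Tpow p k (\<lambda>t. u t + w t) = (\<lambda>t. Tpow p k u t + Tpow p k w t)"
  by (simp add: Tpow_def)

lemma group_G:
  assumes ip: "pseudo_euclidean ip" and A: "linear A" "\<forall>v w. ip (A v) w = ip v (A w)"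
    and f: "\<forall>t. f (t + p) = f t"
  shows "group (G_grp f p ip A)"
proof (rule groupI)
  note T = sol_T[OF f] 
  interpret ip: bounded_bilinear ip using pseudo_euclidean_bounded_bilinear[OF ip] .
  show "\<one>\<^bsub>G_grp f p ip A\<^esub> \<in> carrier (G_grp f p ip A)"
    by (simp add: G_grp_def sol_zero A)
  show "x \<otimes>\<^bsub>G_grp f p ip A\<^esub> y \<in> carrier (G_grp f p ip A)"
    if "x \<in> carrier (G_grp f p ip A)" "y \<in> carrier (G_grp f p ip A)" for x y
    using that by (auto simp: G_grp_def sol_add A T)
  show "x \<otimes>\<^bsub>G_grp f p ip A\<^esub> y \<otimes>\<^bsub>G_grp f p ip A\<^esub> z = x \<otimes>\<^bsub>G_grp f p ip A\<^esub> (y \<otimes>\<^bsub>G_grp f p ip A\<^esub> z)"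
    if xyz: "x \<in> carrier (G_grp f p ip A)" "y \<in> carrier (G_grp f p ip A)" "z \<in> carrier (G_grp f p ip A)" for x y z
  proof -
    obtain k q u l r w m s v where [simp]: "x = (k,q,u)" "y = (l,r,w)" "z = (m,s,v)"
      by (metis surj_pair)
    have E[simp]: "u \<in> solution_space f A" "w \<in> solution_space f A" "v \<in> solution_space f A"
      using xyz by (auto simp: G_grp_def)
    have 1: "Omega ip (\<lambda>t. Tpow p (-l) u t + w t) (Tpow p m v) = Omega ip (Tpow p (-l) u) (Tpow p m v) + Omega ip w (Tpow p m v)"
      by (rule Omega_add(1)[OF ip T E(2)]) simp
    have 2: "Omega ip (Tpow p (-l) u) (Tpow p m v) = Omega ip u (Tpow p (l+m) v)"
      using Omega_T[OF ip A(2) f T[OF E(1), of "-l"] T[OF E(3), of m], of l] by (simp add: Tpow_Tpow) (simp add: Tpow_def)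
    have 3: "Omega ip u (Tpow p (l+m) (\<lambda>t. Tpow p (-m) w t + v t)) = Omega ip u (Tpow p l w) + Omega ip u (Tpow p (l+m) v)"
      unfolding Tpow_add Tpow_Tpow using Omega_add(2)[OF ip T[OF E(2)] T[OF E(3)]] by simp
    have 4: "- m - l = - l - m" by simp
    show ?thesis using 1 2 3 unfolding 4 by (simp add: 4 G_grp_def Tpow_add Tpow_Tpow add.assoc)
  qed
  show "\<one>\<^bsub>G_grp f p ip A\<^esub> \<otimes>\<^bsub>G_grp f p ip A\<^esub> x = x" if "x \<in> carrier (G_grp f p ip A)" for x
    using that by (auto simp: G_grp_def Omega_def Tpow_def ip.zero_left)
  show "\<exists>y\<in>carrier (G_grp f p ip A). y \<otimes>\<^bsub>G_grp f p ip A\<^esub> x = \<one>\<^bsub>G_grp f p ip A\<^esub>"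
    if "x \<in> carrier (G_grp f p ip A)" for x
  proof -
    obtain k q u where [simp]: "x = (k,q,u)" by (metis surj_pair)
    have u: "u \<in> solution_space f A" using that by (auto simp: G_grp_def)
    let ?w = "Tpow p k (\<lambda>t. - u t)"
    have "?w \<in> solution_space f A" using u A T sol_minus by blast
    then have "(-k, - q + Omega ip ?w (Tpow p k u), ?w) \<in> carrier (G_grp f p ip A)"
      by (simp add: G_grp_def)
    moreover have "(-k, - q + Omega ip ?w (Tpow p k u), ?w) \<otimes>\<^bsub>G_grp f p ip A\<^esub> x = \<one>\<^bsub>G_grp f p ip A\<^esub>"
      by (simp add: G_grp_def Tpow_def)
    ultimately show ?thesis by blast
  qed
qed

lemma act_mult:
  assumes ip: "pseudo_euclidean ip" and A: "linear A" "\<forall>v w. ip (A v) w = ip v (A w)"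
    and f: "\<forall>t. f (t + p) = f t"
    and g: "g \<in> carrier (G_grp f p ip A)" and h: "h \<in> carrier (G_grp f p ip A)"
  shows "G_act p ip (g \<otimes>\<^bsub>G_grp f p ip A\<^esub> h) x = G_act p ip g (G_act p ip h x)"
proof -
  interpret ip: bounded_bilinear ip using pseudo_euclidean_bounded_bilinear[OF ip] .
  obtain k q u l r w t s v where [simp]: "g = (k,q,u)" "h = (l,r,w)" "x = (t,s,v)"
    by (metis surj_pair)
  have E[simp]: "u \<in> solution_space f A" "w \<in> solution_space f A"
    using g h by (auto simp: G_grp_def)
  have s: "smooth_on UNIV u" "smooth_on UNIV w" using E by (simp_all add: solution_space_def)
  have O: "Omega ip u (Tpow p l w) = ip (tderiv u (t + of_int l * p)) (w t) - ip (u (t + of_int l * p)) (tderiv w t)"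
    using Omega_eq[OF ip A(2) E(1) sol_T[OF f E(2)], of "t + of_int l * p" l]
      tderiv_shift(1)[OF s(2), THEN fun_cong]
    by (simp add: Tpow_def)
  have D: "tderiv (\<lambda>t. u (t + of_int l * p) + w t) t = tderiv u (t + of_int l * p) + tderiv w t"
    using tderiv_add(1)[OF smooth_on_shift[OF s(1), of "- of_int l * p"] s(2), THEN fun_cong, of t]
      tderiv_shift(1)[OF s(1), of "- of_int l * p", THEN fun_cong, of t] by simp
  have sym: "ip a b = ip b a" for a b using ip by (simp add: pseudo_euclidean_def)
  show ?thesis using sym[of "tderiv w t" "u (t + of_int l * p)"]
    by (simp add: G_grp_def G_act_def O) (simp add: Tpow_def D, simp add: algebra_simps ip.add_left ip.add_right ip.scaleR_right)
qed

lemma openin_real_quot: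
  "openin (mtop (real_quot D)) S \<longleftrightarrow> S \<subseteq> range (real_coset D) \<and> open (real_coset D -` S)"
proof -
  have "istopology (\<lambda>S. S \<subseteq> range (real_coset D) \<and> open (real_coset D -` S))"
    unfolding istopology_def
  proof (intro conjI allI impI)
    fix S T assume "S \<subseteq> range (real_coset D) \<and> open (real_coset D -` S)"
      and "T \<subseteq> range (real_coset D) \<and> open (real_coset D -` T)"
    then show "S \<inter> T \<subseteq> range (real_coset D)" and "open (real_coset D -` (S \<inter> T))"
      by (auto simp only: vimage_Int intro: open_Int)
  next
    fix K assume K: "\<forall>S\<in>K. S \<subseteq> range (real_coset D) \<and> open (real_coset D -` S)"
    then show "\<Union>K \<subseteq> range (real_coset D)" by blast
    show "open (real_coset D -` \<Union>K)" unfolding vimage_Union using K by blast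
  qed
  then show ?thesis
    by (simp add: real_quot_def topology_inverse')
qed

lemma topspace_real_quot: "pts (real_quot D) = range (real_coset D)"
proof
  show "pts (real_quot D) \<subseteq> range (real_coset D)"
    using openin_topspace[of "mtop (real_quot D)"] unfolding openin_real_quot by (rule conjunct1)
  have "openin (mtop (real_quot D)) (range (real_coset D))"
    unfolding openin_real_quot by (simp add: vimage_def)
  then show "range (real_coset D) \<subseteq> pts (real_quot D)" by (rule openin_subset)
qed

end

theory Submission
  imports Defs
begin

text \<open>
  The group \<open>\<Gamma>\<close> moves \<open>t\<close> by integer multiples of \<open>p\<close>, and \<open>\<Sigma>\<close> is the part that preserves \<open>t\<close>.  Compactness
  of the quotient forces \<open>t\<close> to be moved at all (\<open>D_cyclic\<close>), so \<open>t / p\<close> descends to a map onto a circle.  An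
  element \<open>(0, q, u)\<close> of \<open>\<Sigma>\<close> acts on the slice at \<open>t\<close> by an affine map that fixes the \<open>s\<close> direction; the
  connection with zero Christoffel symbols and the unit field in this direction therefore descend to the
  fibre.

  The substance is local triviality.  One might use a flow or Ehresmann's theorem, but here there is
  an explicit trivialization, even a \<open>\<Sigma>\<close>-equivariant one on the whole of \<open>\<real> \<times> \<real> \<times> V\<close>.  Let \<open>L\<close> be the
  span of the solutions \<open>u\<close> that occur in \<open>\<Sigma>\<close>.  Cocompactness of \<open>\<Sigma>\<close> on the slice at \<open>0\<close> shows that the
  values at \<open>0\<close> of elements of \<open>L\<close> fill \<open>V\<close> (\<open>values_span\<close>).  Discreteness of the action on the slice at
  \<open>t\<close> shows that evaluation at \<open>t\<close> is injective on \<open>L\<close> (\<open>combination_vanishes\<close>): a solution \<open>u\<close> in \<open>L\<close>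
  that vanishes at \<open>t\<close> but not identically would be the direction of infinitely many elements of \<open>\<Sigma>\<close>
  that bring some compact set back to itself.  Counting dimensions, evaluation \<open>L \<rightarrow> V\<close> is an
  isomorphism at every time (\<open>solution_family\<close>).  Hence \<open>\<real> \<times> L\<close>, which contains \<open>\<Sigma>\<close> and is closed under the
  multiplication of the group, acts simply transitively on every slice.  Identifying the
  slices at \<open>t\<close> and at \<open>0\<close> with this group straightens all slices at once, equivariantly
  (\<open>straighten_equivariant\<close>), and the bundle charts descend from it (\<open>smooth_fibre_bundle\<close>).

  The manifolds are handled through parametrizations.  \<open>M\<close>, the circle, the fibres and the orbit
  spaces of the slices are all images of Euclidean spaces under local diffeomorphisms, and a map between
  two of them is smooth, an immersion or a diffeomorphism when it has a suitable lift (\<open>smooth_map_lift\<close>,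
  \<open>immersion_lift\<close>, \<open>diffeomorphism_lift\<close>).
\<close>

section \<open>Smooth maps between open sets\<close>

text \<open>Since \<open>Ck_on\<close> speaks of derivatives at points and not within sets, it depends only on germs; on open
  sets it therefore behaves like a sheaf, and the usual calculus is an induction on the order.\<close>

lemma Ck_on_cong:
  assumes "open S" "\<And>x. x \<in> S \<Longrightarrow> f x = g x" "Ck_on k S f"
  shows "Ck_on k S g"
  using assms(2,3)
proof (induction k arbitrary: f g)
  case 0
  then show ?case using continuous_on_cong[of S S f g] by simp
next
  case (Suc k)
  have d: "(g has_derivative frechet_derivative f (at x)) (at x)" if "x \<in> S" for x
  proof (rule has_derivative_transform_within_open)
    show "(f has_derivative frechet_derivative f (at x)) (at x)"
      using Suc.prems(2) that by (auto simp: frechet_derivative_works[symmetric])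
  qed (use that assms(1) Suc.prems in auto)
  then have "frechet_derivative f (at x) = frechet_derivative g (at x)" if "x \<in> S" for x
    using that by (metis frechet_derivative_at)
  then have "Ck_on k S (\<lambda>x. frechet_derivative g (at x) v)" for v
    using Suc.IH[of "\<lambda>x. frechet_derivative f (at x) v" "\<lambda>x. frechet_derivative g (at x) v"]
      Suc.prems(2) by simp
  then show ?case using d by (auto intro: differentiableI)
qed

lemma Ck_on_subset: "Ck_on k S f \<Longrightarrow> T \<subseteq> S \<Longrightarrow> Ck_on k T f"
  by (induction k arbitrary: f) (auto intro: continuous_on_subset)

lemma Ck_on_Suc_imp: "Ck_on (Suc k) S f \<Longrightarrow> Ck_on k S f"
proof (induction k arbitrary: f)
  case 0
  then show ?case
    by (auto intro!: continuous_at_imp_continuous_on differentiable_imp_continuous_within)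
qed simp

lemma Ck_on_local:
  assumes "\<And>x. x \<in> S \<Longrightarrow> \<exists>T. open T \<and> x \<in> T \<and> Ck_on k T f"
  shows "Ck_on k S f"
  using assms
proof (induction k arbitrary: f)
  case 0
  have "isCont f x" if x: "x \<in> S" for x
  proof -
    obtain T where "open T" "x \<in> T" "continuous_on T f" using 0 x by auto
    then show ?thesis by (simp add: continuous_on_eq_continuous_at)
  qed
  then show ?case by (simp add: continuous_at_imp_continuous_on)
next
  case (Suc k)
  have "f differentiable at x" if "x \<in> S" for x
    using Suc.prems[OF that] by auto
  moreover have "Ck_on k S (\<lambda>x. frechet_derivative f (at x) v)" for v
    by (rule Suc.IH) (use Suc.prems in fastforce)
  ultimately show ?case by simp
qed

lemma Ck_on_constant: "Ck_on k S (\<lambda>x. c)"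
  by (rule Ck_on_subset[OF Ck_on_const]) simp

lemma Ck_on_has_derivative:
  assumes "Ck_on (Suc k) S f" "x \<in> S"
  shows "(f has_derivative frechet_derivative f (at x)) (at x)"
  using assms by (auto simp: frechet_derivative_works[symmetric])

text \<open>The induction steps below all go through this rule: it suffices to exhibit some formula for the
  derivative and to see that the formula is of class \<open>C\<^sup>k\<close>.\<close>

lemma Ck_on_SucI:
  assumes "open S"
    and d: "\<And>x. x \<in> S \<Longrightarrow> (f has_derivative D x) (at x)"
    and "\<And>v. Ck_on k S (\<lambda>x. D x v)"
  shows "Ck_on (Suc k) S f"
proof -
  have "frechet_derivative f (at x) = D x" if "x \<in> S" for x
    using frechet_derivative_at[OF d[OF that]] by simp
  then have "Ck_on k S (\<lambda>x. frechet_derivative f (at x) v)" for v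
    using Ck_on_cong[OF assms(1) _ assms(3)[of v]] by simp
  then show ?thesis using d by (auto intro: differentiableI)
qed

lemma Ck_on_plus:
  assumes "open S" "Ck_on k S f" "Ck_on k S g"
  shows "Ck_on k S (\<lambda>x. f x + g x)"
  using assms(2,3)
proof (induction k arbitrary: f g)
  case 0
  then show ?case by (auto intro!: continuous_intros)
next
  case (Suc k)
  show ?case
  proof (rule Ck_on_SucI[OF assms(1)])
    show "((\<lambda>x. f x + g x) has_derivative
        (\<lambda>v. frechet_derivative f (at x) v + frechet_derivative g (at x) v)) (at x)" if "x \<in> S" for x
      using Ck_on_has_derivative[OF _ that] Suc.prems by (auto intro!: has_derivative_add)
  qed (use Suc in auto)
qed

lemma Ck_on_sum:
  assumes "open S" "\<And>i. i \<in> I \<Longrightarrow> Ck_on k S (f i)"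
  shows "Ck_on k S (\<lambda>x. \<Sum>i\<in>I. f i x)"
  using assms(2)
  by (induction I rule: infinite_finite_induct) (auto simp: Ck_on_constant intro!: Ck_on_plus assms(1))

lemma Ck_on_bounded_linear:
  assumes "open S" "bounded_linear L" "Ck_on k S f"
  shows "Ck_on k S (\<lambda>x. L (f x))"
  using assms(3)
proof (induction k arbitrary: f)
  case 0
  then show ?case using bounded_linear.continuous_on[OF assms(2)] by auto
next
  case (Suc k)
  show ?case
  proof (rule Ck_on_SucI[OF assms(1)])
    show "((\<lambda>x. L (f x)) has_derivative (\<lambda>v. L (frechet_derivative f (at x) v))) (at x)" if "x \<in> S" for x
      using Ck_on_has_derivative[OF _ that] Suc.prems bounded_linear.has_derivative[OF assms(2)] by blast
  qed (use Suc in auto)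
qed

lemma Ck_on_bilinear:
  assumes "open S" "bounded_bilinear B" "Ck_on k S f" "Ck_on k S g"
  shows "Ck_on k S (\<lambda>x. B (f x) (g x))"
  using assms(3,4)
proof (induction k arbitrary: f g)
  case 0
  then show ?case using bounded_bilinear.continuous_on[OF assms(2)] by auto
next
  case (Suc k)
  show ?case
  proof (rule Ck_on_SucI[OF assms(1)])
    show "((\<lambda>x. B (f x) (g x)) has_derivative
        (\<lambda>v. B (f x) (frechet_derivative g (at x) v) + B (frechet_derivative f (at x) v) (g x))) (at x)"
      if "x \<in> S" for x
      by (rule bounded_bilinear.FDERIV[OF assms(2) Ck_on_has_derivative[OF Suc.prems(1) that]
            Ck_on_has_derivative[OF Suc.prems(2) that]])
    show "Ck_on k S (\<lambda>x. B (f x) (frechet_derivative g (at x) v) + B (frechet_derivative f (at x) v) (g x))" for v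
      using Suc.prems Ck_on_Suc_imp[of k S f] Ck_on_Suc_imp[of k S g]
      by (intro Ck_on_plus assms(1) Suc.IH) auto
  qed
qed

text \<open>The chain rule mixes derivatives of \<open>g\<close> at \<open>f x\<close> with those of \<open>f\<close> at \<open>x\<close>.  Expanding the
  inner derivative in the basis separates them into products to which the induction hypothesis applies,
  and for this the middle space has to be Euclidean.\<close>

lemma Ck_on_compose:
  fixes g :: "'b::euclidean_space \<Rightarrow> 'c::real_normed_vector"
  assumes "open S" "open T" "f ` S \<subseteq> T" "Ck_on k S f" "Ck_on k T g"
  shows "Ck_on k S (\<lambda>x. g (f x))"
  using assms(4,5)
proof (induction k arbitrary: g)
  case 0
  then show ?case using assms(3) continuous_on_compose2[of T g S f] by simp
next
  case (Suc k)
  have T: "f x \<in> T" if "x \<in> S" for x using that assms(3) by blast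
  show ?case
  proof (rule Ck_on_SucI[OF assms(1)])
    fix x assume x: "x \<in> S"
    have dg: "(g has_derivative frechet_derivative g (at (f x))) (at (f x))"
      by (rule Ck_on_has_derivative[OF Suc.prems(2) T[OF x]])
    interpret bounded_linear "frechet_derivative g (at (f x))"
      using dg has_derivative_bounded_linear by blast
    have rep: "frechet_derivative g (at (f x)) w
        = (\<Sum>b\<in>Basis. (w \<bullet> b) *\<^sub>R frechet_derivative g (at (f x)) b)" for w
      by (subst (1) euclidean_representation[of w, symmetric]) (simp add: sum scaleR)
    have "((\<lambda>x. g (f x)) has_derivative
        (\<lambda>v. frechet_derivative g (at (f x)) (frechet_derivative f (at x) v))) (at x)"
      by (rule has_derivative_compose[OF Ck_on_has_derivative[OF Suc.prems(1) x] dg])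
    then show "((\<lambda>x. g (f x)) has_derivative
        (\<lambda>v. \<Sum>b\<in>Basis. (frechet_derivative f (at x) v \<bullet> b) *\<^sub>R frechet_derivative g (at (f x)) b)) (at x)"
      by (rule has_derivative_eq_rhs) (rule ext, rule rep)
  next
    show "Ck_on k S (\<lambda>x. \<Sum>b\<in>Basis. (frechet_derivative f (at x) v \<bullet> b) *\<^sub>R frechet_derivative g (at (f x)) b)" for v
    proof (intro Ck_on_sum Ck_on_bilinear[OF _ bounded_bilinear_scaleR] assms(1))
      show "Ck_on k S (\<lambda>x. frechet_derivative f (at x) v \<bullet> b)" for b
        by (rule Ck_on_bounded_linear[OF assms(1) bounded_linear_inner_left]) (use Suc.prems in simp)
      show "Ck_on k S (\<lambda>x. frechet_derivative g (at (f x)) b)" for b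
        using Suc.IH[OF Ck_on_Suc_imp[OF Suc.prems(1)], of "\<lambda>y. frechet_derivative g (at y) b"] Suc.prems(2)
        by simp
    qed
  qed
qed

lemma Ck_on_id: "open S \<Longrightarrow> Ck_on k S (\<lambda>x. x)"
proof (cases k)
  case (Suc n)
  assume "open S"
  then show ?thesis
    unfolding Suc by (rule Ck_on_SucI[OF _ has_derivative_ident Ck_on_constant])
qed simp

lemma smooth_on_cong:
  "open S \<Longrightarrow> (\<And>x. x \<in> S \<Longrightarrow> f x = g x) \<Longrightarrow> smooth_on S f \<Longrightarrow> smooth_on S g"
  unfolding smooth_on_def using Ck_on_cong by blast

lemma smooth_on_subset: "smooth_on S f \<Longrightarrow> T \<subseteq> S \<Longrightarrow> smooth_on T f"
  unfolding smooth_on_def using Ck_on_subset by blast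

lemma smooth_on_local:
  "(\<And>x. x \<in> S \<Longrightarrow> \<exists>T. open T \<and> x \<in> T \<and> smooth_on T f) \<Longrightarrow> smooth_on S f"
  unfolding smooth_on_def using Ck_on_local by metis

lemma smooth_on_const: "smooth_on S (\<lambda>x. c)"
  unfolding smooth_on_def using Ck_on_constant by blast

lemma smooth_on_id: "open S \<Longrightarrow> smooth_on S (\<lambda>x. x)"
  unfolding smooth_on_def using Ck_on_id by blast

lemma smooth_on_plus:
  "open S \<Longrightarrow> smooth_on S f \<Longrightarrow> smooth_on S g \<Longrightarrow> smooth_on S (\<lambda>x. f x + g x)"
  unfolding smooth_on_def using Ck_on_plus by blast

lemma smooth_on_sum:
  "open S \<Longrightarrow> (\<And>i. i \<in> I \<Longrightarrow> smooth_on S (f i)) \<Longrightarrow> smooth_on S (\<lambda>x. \<Sum>i\<in>I. f i x)"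
  by (simp add: smooth_on_def Ck_on_sum)

lemma smooth_on_bounded_linear:
  "open S \<Longrightarrow> bounded_linear L \<Longrightarrow> smooth_on S f \<Longrightarrow> smooth_on S (\<lambda>x. L (f x))"
  unfolding smooth_on_def using Ck_on_bounded_linear by blast

lemma smooth_on_bilinear:
  "open S \<Longrightarrow> bounded_bilinear B \<Longrightarrow> smooth_on S f \<Longrightarrow> smooth_on S g \<Longrightarrow> smooth_on S (\<lambda>x. B (f x) (g x))"
  unfolding smooth_on_def using Ck_on_bilinear by blast

lemma smooth_on_compose:
  fixes g :: "'b::euclidean_space \<Rightarrow> 'c::real_normed_vector"
  shows "open S \<Longrightarrow> open T \<Longrightarrow> f ` S \<subseteq> T \<Longrightarrow> smooth_on S f \<Longrightarrow> smooth_on T g \<Longrightarrow> smooth_on S (\<lambda>x. g (f x))"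
  unfolding smooth_on_def using Ck_on_compose by blast

lemma smooth_on_scaleR:
  "open S \<Longrightarrow> smooth_on S f \<Longrightarrow> smooth_on S g \<Longrightarrow> smooth_on S (\<lambda>x. f x *\<^sub>R g x)"
  by (rule smooth_on_bilinear[OF _ bounded_bilinear_scaleR])

lemma smooth_on_diff:
  assumes "open S" "smooth_on S f" "smooth_on S g" shows "smooth_on S (\<lambda>x. f x - g x)"
  using smooth_on_plus[OF assms(1,2) smooth_on_bounded_linear[OF assms(1) bounded_linear_minus[OF bounded_linear_ident] assms(3)]]
  by simp

lemma smooth_on_Pair:
  assumes "open S" "smooth_on S f" "smooth_on S g" shows "smooth_on S (\<lambda>x. (f x, g x))"
proof -
  have "smooth_on S (\<lambda>x. (f x, 0) + (0, g x))"
    using assms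
    by (intro smooth_on_plus smooth_on_bounded_linear[of S "\<lambda>y. (y, 0)"]
        smooth_on_bounded_linear[of S "\<lambda>y. (0, y)"] bounded_linear_Pair bounded_linear_ident bounded_linear_zero)
  then show ?thesis by simp
qed

lemma smooth_on_fst: "open S \<Longrightarrow> smooth_on S f \<Longrightarrow> smooth_on S (\<lambda>x. fst (f x))"
  by (rule smooth_on_bounded_linear[OF _ bounded_linear_fst])

lemma smooth_on_snd: "open S \<Longrightarrow> smooth_on S f \<Longrightarrow> smooth_on S (\<lambda>x. snd (f x))"
  by (rule smooth_on_bounded_linear[OF _ bounded_linear_snd])

lemma smooth_on_affine:
  fixes g :: "'a::euclidean_space \<Rightarrow> 'b::real_normed_vector"
  assumes "open S" "linear L" "\<And>z. g z = c + L z" shows "smooth_on S g"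
proof -
  have "smooth_on S (\<lambda>z. c + L z)"
    using assms linear_conv_bounded_linear[of L]
    by (intro smooth_on_plus smooth_on_const smooth_on_bounded_linear[of S L] smooth_on_id) auto
  then show ?thesis using assms(3) by (metis (no_types, lifting) ext)
qed

lemma smooth_on_differentiable: "smooth_on S f \<Longrightarrow> x \<in> S \<Longrightarrow> f differentiable (at x)"
  unfolding smooth_on_def using Ck_on.simps(2) by metis

lemma smooth_on_continuous: "smooth_on S f \<Longrightarrow> continuous_on S f"
  unfolding smooth_on_def using Ck_on.simps(1) by metis

lemma smooth_on_vector_derivative:
  assumes "smooth_on UNIV (u :: real \<Rightarrow> 'b::real_normed_vector)"
  shows "smooth_on UNIV (tderiv u)"
proof -
  have "(\<lambda>x. frechet_derivative u (at x) 1) = tderiv u"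
    using smooth_on_differentiable[OF assms] frechet_derivative_eq_vector_derivative[of u]
    by fastforce
  then show ?thesis
    using assms unfolding smooth_on_def by (metis Ck_on.simps(2))
qed

text \<open>Injectivity of the differential of a representative in charts is always obtained from a smooth local
  retraction, without looking at the derivative itself.\<close>

lemma inj_frechet_derivative_left_inverse:
  assumes "F differentiable (at y)" "G differentiable (at (F y))"
    and "open T" "y \<in> T" "\<And>z. z \<in> T \<Longrightarrow> G (F z) = z"
  shows "inj (frechet_derivative F (at y))"
proof -
  have "((\<lambda>z. G (F z)) has_derivative (\<lambda>v. frechet_derivative G (at (F y)) (frechet_derivative F (at y) v))) (at y)"
    by (rule has_derivative_compose[OF assms(1,2)[unfolded frechet_derivative_works]])
  then have "(\<lambda>v. frechet_derivative G (at (F y)) (frechet_derivative F (at y) v)) = (\<lambda>v. v)"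
  proof (rule has_derivative_unique)
    show "((\<lambda>z. G (F z)) has_derivative (\<lambda>v. v)) (at y)"
    by (rule has_derivative_transform_within_open[OF has_derivative_ident assms(3,4)]) (simp add: assms(5))
  qed
  then show ?thesis by (intro inj_on_inverseI) (rule fun_cong)
qed

text \<open>Continuity of the inverse comes from invariance of domain, applied to \<open>(t, v) \<mapsto> (t, L t v)\<close>.
  Then the inverse function theorem gives \<open>(H t v)' = - H t (L' t (H t v))\<close>, an expression in \<open>H\<close> itself,
  so that one more derivative can be gained again and again.\<close>

lemma smooth_inverse_linear_family:
  fixes L H :: "real \<Rightarrow> 'v::euclidean_space \<Rightarrow> 'v"
  assumes lin: "\<And>t. linear (L t)" and HL: "\<And>t v. H t (L t v) = v" and LH: "\<And>t v. L t (H t v) = v"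
    and sm: "\<And>v. smooth_on UNIV (\<lambda>t. L t v)"
  shows "smooth_on UNIV (\<lambda>t. H t v)"
proof -
  define L' where "L' t v = tderiv (\<lambda>t. L t v) t" for t v
  have Hlin: "linear (H t)" for t
  proof (rule linearI)
    show "H t (x + y) = H t x + H t y" for x y
      using HL[of t "H t x + H t y"] by (simp add: linear_add[OF lin] LH)
    show "H t (r *\<^sub>R x) = r *\<^sub>R H t x" for r x
      using HL[of t "r *\<^sub>R H t x"] by (simp add: linear_scale[OF lin] LH)
  qed
  have Lrep: "L t v = (\<Sum>b\<in>Basis. (v \<bullet> b) *\<^sub>R L t b)" for t v
    by (subst (1) euclidean_representation[of v, symmetric]) (simp add: linear_sum[OF lin] linear_scale[OF lin])
  have Hrep: "H t v = (\<Sum>b\<in>Basis. (v \<bullet> b) *\<^sub>R H t b)" for t v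
    by (subst (1) euclidean_representation[of v, symmetric]) (simp add: linear_sum[OF Hlin] linear_scale[OF Hlin])
  have L'rep: "L' t w = (\<Sum>b\<in>Basis. (w \<bullet> b) *\<^sub>R L' t b)" for t w
  proof -
    have "((\<lambda>t. \<Sum>b\<in>Basis. (w \<bullet> b) *\<^sub>R L t b) has_vector_derivative (\<Sum>b\<in>Basis. (w \<bullet> b) *\<^sub>R L' t b)) (at t)"
      unfolding L'_def
      by (intro has_vector_derivative_sum bounded_linear.has_vector_derivative[OF bounded_linear_scaleR_right]
          smooth_on_has_vector_derivative(1) sm)
    then show ?thesis unfolding Lrep[symmetric] unfolding L'_def by (rule vector_derivative_at)
  qed
  define F where "F = (\<lambda>x::real \<times> 'v. (fst x, L (fst x) (snd x)))"
  define G where "G = (\<lambda>x::real \<times> 'v. (fst x, H (fst x) (snd x)))"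
  have FG: "F (G x) = x" "G (F x) = x" for x by (simp_all add: F_def G_def LH HL)
  have dF: "(F has_derivative (\<lambda>z. (fst z, fst z *\<^sub>R L' t w + L t (snd z)))) (at (t, w))" for t w
  proof -
    have dL: "((\<lambda>x. L (fst x) b) has_derivative (\<lambda>z. fst z *\<^sub>R L' t b)) (at (t, w))" for b
      unfolding L'_def
      using has_derivative_compose[OF has_derivative_fst[OF has_derivative_ident], of "\<lambda>t. L t b" _ "(t, w)" UNIV]
        smooth_on_has_vector_derivative(1)[OF sm, unfolded has_vector_derivative_def] by fastforce
    have "((\<lambda>x. \<Sum>b\<in>Basis. (snd x \<bullet> b) *\<^sub>R L (fst x) b) has_derivative
      (\<lambda>z. \<Sum>b\<in>Basis. (snd (t, w) \<bullet> b) *\<^sub>R (fst z *\<^sub>R L' t b) + (snd z \<bullet> b) *\<^sub>R L (fst (t, w)) b)) (at (t, w))"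
      by (intro has_derivative_sum has_derivative_scaleR dL has_derivative_inner_left has_derivative_snd has_derivative_ident)
    moreover have "(\<Sum>b\<in>Basis. (snd (t, w) \<bullet> b) *\<^sub>R (fst z *\<^sub>R L' t b) + (snd z \<bullet> b) *\<^sub>R L (fst (t, w)) b)
        = fst z *\<^sub>R L' t w + L t (snd z)" for z :: "real \<times> 'v"
      by (subst L'rep[of t w], subst Lrep[of t "snd z"])
        (simp add: sum.distrib scaleR_sum_right mult.commute)
    ultimately show ?thesis
      unfolding F_def by (intro has_derivative_Pair has_derivative_fst has_derivative_ident)
        (simp add: Lrep[symmetric])
  qed
  have contF: "continuous_on UNIV F"
    using has_derivative_continuous[OF dF] by (intro continuous_at_imp_continuous_on) auto
  have contG: "continuous_on UNIV G"
  proof -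
    have "inj_on F UNIV" using FG by (metis inj_on_inverseI)
    then obtain g where g: "homeomorphism UNIV (F ` UNIV) F g"
      using invariance_of_domain_homeomorphism[OF open_UNIV contF] by blast
    have s: "F ` UNIV = UNIV" using FG by (metis surj_def)
    have "g = G" using g FG unfolding homeomorphism_def by (intro ext) (metis UNIV_I)
    then show ?thesis using g s by (simp add: homeomorphism_def)
  qed
  have dH: "((\<lambda>t. H t v) has_derivative (\<lambda>h. h *\<^sub>R - H t (L' t (H t v)))) (at t)" for t v
  proof -
    let ?w = "H t v"
    let ?g' = "\<lambda>z. (fst z, H t (snd z - fst z *\<^sub>R L' t ?w))"
    have dG: "(G has_derivative ?g') (at (t, v))"
    proof (rule has_derivative_inverse_basic[where T=UNIV])
      show "(F has_derivative (\<lambda>z. (fst z, fst z *\<^sub>R L' t ?w + L t (snd z)))) (at (G (t, v)))"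
        using dF[of t ?w] by (simp add: G_def)
      have "linear ?g'"
        by (rule linearI) (simp_all add: linear_add[OF Hlin] linear_diff[OF Hlin] linear_scale[OF Hlin] algebra_simps)
      then show "bounded_linear ?g'" by (simp add: linear_conv_bounded_linear)
      show "?g' \<circ> (\<lambda>z. (fst z, fst z *\<^sub>R L' t ?w + L t (snd z))) = id"
        by (auto simp: HL)
      show "continuous (at (t, v)) G" using contG by (simp add: continuous_on_eq_continuous_at)
    qed (simp_all only: FG open_UNIV UNIV_I)
    have "((\<lambda>t. (t, v)) has_derivative (\<lambda>h. (h, 0))) (at t)"
      by (intro has_derivative_Pair has_derivative_ident has_derivative_const)
    from has_derivative_snd[OF has_derivative_compose[OF this dG]] show ?thesis by (simp add: G_def linear_diff[OF Hlin] linear_scale[OF Hlin] linear_neg[OF Hlin] linear_0[OF Hlin])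
  qed
  have "Ck_on k UNIV (\<lambda>t. H t v)" for k v
  proof (induction k arbitrary: v)
    case 0
    have "continuous_on UNIV (\<lambda>t. H t v)"
      using dH by (auto intro!: continuous_at_imp_continuous_on has_derivative_continuous)
    then show ?case by simp
  next
    case (Suc k)
    show ?case
    proof (rule Ck_on_SucI[OF open_UNIV dH])
      fix h :: real
      have sL': "Ck_on k UNIV (\<lambda>t. L' t b)" for b
        using smooth_on_vector_derivative[OF sm] unfolding L'_def smooth_on_def by blast
      have "Ck_on k UNIV (\<lambda>t. \<Sum>c\<in>Basis. ((\<Sum>b\<in>Basis. (H t v \<bullet> b) *\<^sub>R L' t b) \<bullet> c) *\<^sub>R H t c)"
        using Suc sL'
        by (intro Ck_on_sum Ck_on_bilinear[OF _ bounded_bilinear_scaleR]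
            Ck_on_bounded_linear[OF _ bounded_linear_inner_left]) auto
      then have "Ck_on k UNIV (\<lambda>t. H t (L' t (H t v)))"
        by (simp only: Hrep[symmetric] L'rep[symmetric])
      from Ck_on_bounded_linear[OF open_UNIV _ this, of "\<lambda>x. - (h *\<^sub>R x)"]
      show "Ck_on k UNIV (\<lambda>t. h *\<^sub>R - H t (L' t (H t v)))"
        by (simp add: bounded_linear_minus bounded_linear_scaleR_right)
    qed
  qed
  then show ?thesis by (simp add: smooth_on_def)
qed

section \<open>Parametrized manifolds\<close>

text \<open>Every manifold in the proof comes with a surjective local diffeomorphism from an open set \<open>D\<close> of a
  Euclidean space, such as the covering of the quotient by the space upstairs.  The two notions below are
  what such a parametrization \<open>k\<close> amounts to in the charts: on small sets \<open>W\<close> it is injective, and both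
  \<open>k\<close> and its inverse are smooth in every chart.  All statements about maps between manifolds then reduce
  to statements about lifts between open subsets of Euclidean spaces.\<close>

definition param_nbhd :: "('n, 'e::euclidean_space) mfd \<Rightarrow> ('e \<Rightarrow> 'n) \<Rightarrow> 'e set \<Rightarrow> bool" where
  "param_nbhd N k W \<longleftrightarrow> open W \<and> inj_on k W \<and>
     (\<forall>c\<in>atlas N. smooth_on (W \<inter> k -` fst c) (snd c \<circ> k) \<and> open (snd c ` (fst c \<inter> k ` W)) \<and>
        smooth_on (snd c ` (fst c \<inter> k ` W)) (inv_into W k \<circ> inv_into (fst c) (snd c)))"

lemma param_nbhdD:
  assumes "param_nbhd N k W"
  shows "open W" "inj_on k W" "\<And>c. c \<in> atlas N \<Longrightarrow> smooth_on (W \<inter> k -` fst c) (snd c \<circ> k)"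
    "\<And>c. c \<in> atlas N \<Longrightarrow> open (snd c ` (fst c \<inter> k ` W))"
    "\<And>c. c \<in> atlas N \<Longrightarrow> smooth_on (snd c ` (fst c \<inter> k ` W)) (inv_into W k \<circ> inv_into (fst c) (snd c))"
  using assms unfolding param_nbhd_def by blast+

definition param_on :: "'e::euclidean_space set \<Rightarrow> ('n, 'e) mfd \<Rightarrow> ('e \<Rightarrow> 'n) \<Rightarrow> bool" where
  "param_on D N k \<longleftrightarrow> open D \<and> k ` D = pts N \<and>
     (\<forall>V. openin (mtop N) V \<longrightarrow> open (D \<inter> k -` V)) \<and>
     (\<forall>W. open W \<longrightarrow> W \<subseteq> D \<longrightarrow> openin (mtop N) (k ` W)) \<and>
     (\<forall>c\<in>atlas N. openin (mtop N) (fst c) \<and> inj_on (snd c) (fst c)) \<and>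
     (\<forall>x\<in>D. \<exists>W. x \<in> W \<and> W \<subseteq> D \<and> param_nbhd N k W)"

lemma param_onD:
  assumes "param_on D N k"
  shows "open D" "k ` D = pts N" "\<And>V. openin (mtop N) V \<Longrightarrow> open (D \<inter> k -` V)"
    "\<And>W. open W \<Longrightarrow> W \<subseteq> D \<Longrightarrow> openin (mtop N) (k ` W)"
    "\<And>c. c \<in> atlas N \<Longrightarrow> openin (mtop N) (fst c)" "\<And>c. c \<in> atlas N \<Longrightarrow> inj_on (snd c) (fst c)"
    "\<And>x. x \<in> D \<Longrightarrow> \<exists>W. x \<in> W \<and> W \<subseteq> D \<and> param_nbhd N k W"
  using assms unfolding param_on_def by blast+

lemma open_vimage_Int:
  assumes "continuous_on S f" "open S" "open T" shows "open (S \<inter> f -` T)"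
  using continuous_on_open_vimage[OF assms(2)] assms by (metis Int_commute)

lemma param_inverse:
  assumes "inj_on \<phi> U" "inj_on k W" "y \<in> \<phi> ` (U \<inter> k ` W)"
  shows "(inv_into W k \<circ> inv_into U \<phi>) y \<in> W" "k ((inv_into W k \<circ> inv_into U \<phi>) y) = inv_into U \<phi> y"
    "inv_into U \<phi> y \<in> U" "\<phi> (inv_into U \<phi> y) = y"
proof -
  obtain w where "w \<in> W" "k w \<in> U" "y = \<phi> (k w)" using assms(3) by blast
  then show "(inv_into W k \<circ> inv_into U \<phi>) y \<in> W" "k ((inv_into W k \<circ> inv_into U \<phi>) y) = inv_into U \<phi> y"
    "inv_into U \<phi> y \<in> U" "\<phi> (inv_into U \<phi> y) = y" using assms by (simp_all add: inv_into_f_f)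
qed

lemma param_nbhd_shrink:
  assumes W: "param_nbhd N k W" and V: "open V" "V \<subseteq> W" and inj: "\<And>c. c \<in> atlas N \<Longrightarrow> inj_on (snd c) (fst c)"
  shows "param_nbhd N k V"
  unfolding param_nbhd_def
proof (intro conjI ballI)
  have injW: "inj_on k W" using W by (simp add: param_nbhd_def)
  then show "inj_on k V" using V inj_on_subset by blast
  show "open V" by fact
  fix c assume c: "c \<in> atlas N"
  let ?O = "snd c ` (fst c \<inter> k ` W)" and ?r = "inv_into W k \<circ> inv_into (fst c) (snd c)"
  have W': "smooth_on (W \<inter> k -` fst c) (snd c \<circ> k)" "open ?O" "smooth_on ?O ?r"
    using W c by (simp_all add: param_nbhd_def)
  show "smooth_on (V \<inter> k -` fst c) (snd c \<circ> k)"
    by (rule smooth_on_subset[OF W'(1)]) (use V in auto)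
  have eq: "snd c ` (fst c \<inter> k ` V) = ?O \<inter> ?r -` V"
  proof (intro equalityI subsetI)
    fix y assume "y \<in> snd c ` (fst c \<inter> k ` V)"
    then obtain v where v: "v \<in> V" "k v \<in> fst c" "y = snd c (k v)" by blast
    then have "?r y = v" using inj[OF c] injW V by (simp add: inv_into_f_f subsetD)
    then show "y \<in> ?O \<inter> ?r -` V" using v V by blast
  next
    fix y assume "y \<in> ?O \<inter> ?r -` V"
    then show "y \<in> snd c ` (fst c \<inter> k ` V)"
      using param_inverse[OF inj[OF c] injW, of y] by (metis IntE IntI imageI vimageE)
  qed
  show op: "open (snd c ` (fst c \<inter> k ` V))"
    unfolding eq by (rule open_vimage_Int[OF smooth_on_continuous[OF W'(3)] W'(2) V(1)])
  show "smooth_on (snd c ` (fst c \<inter> k ` V)) (inv_into V k \<circ> inv_into (fst c) (snd c))"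
  proof (rule smooth_on_cong[OF op _ smooth_on_subset[OF W'(3)]])
    fix y assume "y \<in> snd c ` (fst c \<inter> k ` V)"
    then obtain v where v: "v \<in> V" "k v \<in> fst c" "y = snd c (k v)" by blast
    then show "?r y = (inv_into V k \<circ> inv_into (fst c) (snd c)) y"
      using inj[OF c] injW V \<open>inj_on k V\<close> by (simp add: inv_into_f_f subsetD)
  qed (use V in auto)
qed

text \<open>In charts, \<open>h\<close> is the lift \<open>\<eta>\<close> between the local inverse \<open>r\<close> of the first parametrization and the
  second parametrization.  Smoothness and immersivity of \<open>h\<close> are read off from this factorization.\<close>

lemma local_factorization:
  assumes N: "param_on D N k" and N': "param_on D' N' k'"
    and sm: "smooth_on D \<eta>" and into: "\<eta> ` D \<subseteq> D'" and lift: "\<And>x. x \<in> D \<Longrightarrow> h (k x) = k' (\<eta> x)"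
    and c: "c \<in> atlas N" and d: "d \<in> atlas N'" and y: "y \<in> local_dom h c d"
  obtains S r W W' where "open S" "y \<in> S" "S \<subseteq> local_dom h c d" "param_nbhd N k W" "param_nbhd N' k' W'"
    "W \<subseteq> D" "W' \<subseteq> D'" "smooth_on S r" "\<And>z. z \<in> S \<Longrightarrow> r z \<in> W \<and> k (r z) \<in> fst c \<and> snd c (k (r z)) = z"
    "\<And>z. z \<in> S \<Longrightarrow> \<eta> (r z) \<in> W' \<and> k' (\<eta> (r z)) \<in> fst d"
    "\<And>z. z \<in> S \<Longrightarrow> local_rep h c d z = (snd d \<circ> k') (\<eta> (r z))"
proof -
  obtain z where z: "z \<in> fst c" "h z \<in> fst d" "y = snd c z" using y by (auto simp: local_dom_def)
  have "z \<in> pts N" using z(1) param_onD(5)[OF N c] openin_subset by blast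
  then obtain x where x: "x \<in> D" "z = k x" using param_onD(2)[OF N] by blast
  obtain W where W: "x \<in> W" "W \<subseteq> D" "param_nbhd N k W" using param_onD(7)[OF N x(1)] by blast
  obtain W' where W': "\<eta> x \<in> W'" "W' \<subseteq> D'" "param_nbhd N' k' W'" using param_onD(7)[OF N', of "\<eta> x"] into x(1) by blast
  define Q where "Q = snd c ` (fst c \<inter> k ` W)"
  define r where "r = inv_into W k \<circ> inv_into (fst c) (snd c)"
  define B where "B = D \<inter> \<eta> -` (W' \<inter> (D' \<inter> k' -` fst d))"
  have Q: "open Q" "smooth_on Q r" using W(3) c by (simp_all add: param_nbhd_def Q_def r_def)
  have injc: "inj_on (snd c) (fst c)" by (rule param_onD(6)[OF N c])
  have injW: "inj_on k W" using W(3) by (simp add: param_nbhd_def)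
  have oB: "open B" unfolding B_def
    by (intro open_vimage_Int smooth_on_continuous sm param_onD(1)[OF N]
        open_Int[OF param_nbhdD(1)[OF W'(3)] param_onD(3)[OF N' param_onD(5)[OF N' d]]])
  note inv = param_inverse[OF injc injW, folded r_def Q_def]
  have ry: "r y = x" using z x W injc injW by (simp add: r_def inv_into_f_f)
  show ?thesis
  proof (rule that[of "Q \<inter> r -` B" W W' r])
    show "open (Q \<inter> r -` B)" by (rule open_vimage_Int[OF smooth_on_continuous[OF Q(2)] Q(1) oB])
    have "h (k x) = k' (\<eta> x)" using lift x by simp
    then show "y \<in> Q \<inter> r -` B" using z x W W' ry into by (auto simp: Q_def B_def)
    show "smooth_on (Q \<inter> r -` B) r" by (rule smooth_on_subset[OF Q(2)]) blast
    show "param_nbhd N k W" "param_nbhd N' k' W'" "W \<subseteq> D" "W' \<subseteq> D'" by fact+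
    show "r z \<in> W \<and> k (r z) \<in> fst c \<and> snd c (k (r z)) = z" if "z \<in> Q \<inter> r -` B" for z
      using inv[of z] that by auto
    show "\<eta> (r z) \<in> W' \<and> k' (\<eta> (r z)) \<in> fst d" if "z \<in> Q \<inter> r -` B" for z using that by (auto simp: B_def)
    show "local_rep h c d z = (snd d \<circ> k') (\<eta> (r z))" if "z \<in> Q \<inter> r -` B" for z
      using inv[of z] that lift[of "r z"] by (auto simp: local_rep_def B_def)
    show "Q \<inter> r -` B \<subseteq> local_dom h c d"
    proof
      fix z assume z: "z \<in> Q \<inter> r -` B"
      then have "h (inv_into (fst c) (snd c) z) \<in> fst d" using inv[of z] lift[of "r z"] by (auto simp: B_def)
      then show "z \<in> local_dom h c d" using inv[of z] z unfolding local_dom_def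
        by (metis IntD1 IntI imageI vimageI)
    qed
  qed
qed

lemma smooth_map_lift:
  assumes N: "param_on D N k" and N': "param_on D' N' k'"
    and sm: "smooth_on D \<eta>" and into: "\<eta> ` D \<subseteq> D'" and lift: "\<And>x. x \<in> D \<Longrightarrow> h (k x) = k' (\<eta> x)"
  shows "smooth_map N N' h"
  unfolding smooth_map_def
proof (intro conjI ballI)
  show "continuous_map (mtop N) (mtop N') h"
    unfolding continuous_map_def
  proof (intro conjI allI impI Pi_I)
    fix z assume "z \<in> pts N"
    then obtain x where "x \<in> D" "z = k x" using param_onD(2)[OF N] by blast
    then show "h z \<in> pts N'" using lift into param_onD(2)[OF N'] by auto
  next
    fix V assume V: "openin (mtop N') V"
    let ?B = "D \<inter> \<eta> -` (D' \<inter> k' -` V)"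
    have "openin (mtop N) (k ` ?B)"
      by (intro param_onD(4)[OF N] open_vimage_Int smooth_on_continuous sm param_onD(1)[OF N] param_onD(3)[OF N' V]) auto
    moreover have "k ` ?B = {x \<in> pts N. h x \<in> V}"
    proof (intro equalityI subsetI)
      fix z assume "z \<in> k ` ?B"
      then obtain x where "x \<in> ?B" "z = k x" by blast
      then show "z \<in> {x \<in> pts N. h x \<in> V}" using lift[of x] unfolding param_onD(2)[OF N, symmetric] by simp
    next
      fix z assume z: "z \<in> {x \<in> pts N. h x \<in> V}"
      then obtain x where x: "x \<in> D" "z = k x" unfolding param_onD(2)[OF N, symmetric] by blast
      then have "x \<in> ?B" using lift[of x] into z by auto
      then show "z \<in> k ` ?B" using x by blast
    qed
    ultimately show "openin (mtop N) {x \<in> pts N. h x \<in> V}" by simp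
  qed
  fix c d assume c: "c \<in> atlas N" and d: "d \<in> atlas N'"
  show "smooth_on (local_dom h c d) (local_rep h c d)"
  proof (rule smooth_on_local)
    fix y assume y: "y \<in> local_dom h c d"
    obtain S r W W' where S: "open S" "y \<in> S" "S \<subseteq> local_dom h c d" "param_nbhd N k W" "param_nbhd N' k' W'"
      "W \<subseteq> D" "W' \<subseteq> D'" "smooth_on S r" "\<And>z. z \<in> S \<Longrightarrow> r z \<in> W \<and> k (r z) \<in> fst c \<and> snd c (k (r z)) = z"
      "\<And>z. z \<in> S \<Longrightarrow> \<eta> (r z) \<in> W' \<and> k' (\<eta> (r z)) \<in> fst d"
      "\<And>z. z \<in> S \<Longrightarrow> local_rep h c d z = (snd d \<circ> k') (\<eta> (r z))"
      using local_factorization[OF N N' sm into lift c d y] by metis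
    have s: "smooth_on S (\<lambda>z. \<eta> (r z))"
      by (rule smooth_on_compose[OF S(1) param_onD(1)[OF N] _ S(8) sm]) (use S in auto)
    have "W' \<inter> k' -` fst d = W' \<inter> (D' \<inter> k' -` fst d)" using S by auto
    then have o: "open (W' \<inter> k' -` fst d)"
      using param_onD(3)[OF N' param_onD(5)[OF N' d]] S(5) by (simp add: param_nbhd_def open_Int)
    have "smooth_on S (\<lambda>z. (snd d \<circ> k') (\<eta> (r z)))"
      by (rule smooth_on_compose[OF S(1) o _ s param_nbhdD(3)[OF S(5) d]]) (use S in auto)
    then show "\<exists>T. open T \<and> y \<in> T \<and> smooth_on T (local_rep h c d)"
      using smooth_on_cong[OF S(1), of "\<lambda>z. (snd d \<circ> k') (\<eta> (r z))" "local_rep h c d"] S by auto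
  qed
qed

text \<open>A smooth left inverse \<open>g\<close> of the lift yields a smooth local left inverse of \<open>h\<close> in charts, although
  \<open>g\<close> itself need not descend.\<close>

lemma immersion_lift:
  assumes N: "param_on D N k" and N': "param_on D' N' k'"
    and sm: "smooth_on D \<eta>" and into: "\<eta> ` D \<subseteq> D'" and lift: "\<And>x. x \<in> D \<Longrightarrow> h (k x) = k' (\<eta> x)"
    and g: "smooth_on D' g" "\<And>x. x \<in> D \<Longrightarrow> g (\<eta> x) = x"
    and c: "c \<in> atlas N" and d: "d \<in> atlas N'" and y: "y \<in> local_dom h c d"
  shows "inj (frechet_derivative (local_rep h c d) (at y))"
proof -
  obtain S r W W' where S: "open S" "y \<in> S" "S \<subseteq> local_dom h c d" "param_nbhd N k W" "param_nbhd N' k' W'"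
    "W \<subseteq> D" "W' \<subseteq> D'" "smooth_on S r" "\<And>z. z \<in> S \<Longrightarrow> r z \<in> W \<and> k (r z) \<in> fst c \<and> snd c (k (r z)) = z"
    "\<And>z. z \<in> S \<Longrightarrow> \<eta> (r z) \<in> W' \<and> k' (\<eta> (r z)) \<in> fst d"
    "\<And>z. z \<in> S \<Longrightarrow> local_rep h c d z = (snd d \<circ> k') (\<eta> (r z))"
    using local_factorization[OF N N' sm into lift c d y] by metis
  define r' where "r' = inv_into W' k' \<circ> inv_into (fst d) (snd d)"
  let ?Q = "snd d ` (fst d \<inter> k' ` W')" and ?F = "local_rep h c d" and ?G = "\<lambda>z. (snd c \<circ> k) (g (r' z))"
  have r'F: "r' (?F z) = \<eta> (r z)" "?F z \<in> ?Q" if "z \<in> S" for z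
    using S(5,10,11) that param_onD(6)[OF N' d] by (auto simp: r'_def param_nbhd_def)
  show ?thesis
  proof (rule inj_frechet_derivative_left_inverse[of _ _ ?G])
    have "smooth_map N N' h" by (rule smooth_map_lift[OF N N' sm into lift])
    then show "?F differentiable at y"
      using smooth_on_differentiable[OF _ y] c d by (auto simp: smooth_map_def)
    show "open S" "y \<in> S" by fact+
    show "?G (?F z) = z" if "z \<in> S" for z
      using r'F(1)[OF that] S(9)[OF that] g(2)[of "r z"] S(6) by auto
    have "smooth_on ?Q r'" using S(5) d by (auto simp: param_nbhd_def r'_def)
    then have "r' differentiable at (?F y)" using r'F(2)[OF S(2)] smooth_on_differentiable by blast
    moreover have "g differentiable at (r' (?F y))"
      unfolding r'F(1)[OF S(2)] using S(10)[OF S(2)] S(7) by (intro smooth_on_differentiable[OF g(1)]) auto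
    moreover have "(snd c \<circ> k) differentiable at (g (r' (?F y)))"
    proof -
      have "g (r' (?F y)) = r y" using r'F(1)[OF S(2)] g(2)[of "r y"] S(6) S(9)[OF S(2)] by auto
      then show ?thesis
        using S(4) S(9)[OF S(2)] c by (auto simp: param_nbhd_def intro: smooth_on_differentiable)
    qed
    ultimately show "?G differentiable at (?F y)"
      using differentiable_chain_at[of r' "?F y" g] differentiable_chain_at[of "g \<circ> r'" "?F y" "snd c \<circ> k"]
      by (simp add: o_def)
  qed
qed

lemma diffeomorphism_lift:
  assumes N: "param_on D N k" and N': "param_on D' N' k'"
    and sm: "smooth_on D \<eta>" "smooth_on D' \<theta>" and into: "\<eta> ` D \<subseteq> D'" "\<theta> ` D' \<subseteq> D"
    and inv: "\<And>y. y \<in> D' \<Longrightarrow> \<eta> (\<theta> y) = y"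
    and lift: "\<And>x. x \<in> D \<Longrightarrow> h (k x) = k' (\<eta> x)"
    and eqv: "\<And>x x'. x \<in> D \<Longrightarrow> x' \<in> D \<Longrightarrow> k' (\<eta> x) = k' (\<eta> x') \<Longrightarrow> k x = k x'"
  shows "diffeomorphism N N' h"
  unfolding diffeomorphism_def
proof (intro conjI)
  have inj: "inj_on h (pts N)"
  proof (rule inj_onI)
    fix a b assume "a \<in> pts N" "b \<in> pts N" and e: "h a = h b"
    then obtain x x' where "x \<in> D" "x' \<in> D" "a = k x" "b = k x'"
      unfolding param_onD(2)[OF N, symmetric] by blast
    then show "a = b" using eqv[of x x'] lift[of x] lift[of x'] e by simp
  qed
  have "h ` pts N = pts N'"
  proof -
    have "h ` pts N = (\<lambda>x. k' (\<eta> x)) ` D" unfolding param_onD(2)[OF N, symmetric] image_image using lift by simp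
    also have "\<dots> = k' ` (\<eta> ` D)" by auto
    also have "\<eta> ` D = D'"
    proof (intro equalityI subsetI)
      show "y \<in> \<eta> ` D" if "y \<in> D'" for y using inv[OF that] into(2) that by (metis image_eqI image_subset_iff)
    qed (use into in auto)
    finally show ?thesis using param_onD(2)[OF N'] by simp
  qed
  with inj show "bij_betw h (pts N) (pts N')" by (simp add: bij_betw_def)
  show "smooth_map N N' h" by (rule smooth_map_lift[OF N N' sm(1) into(1) lift])
  show "smooth_map N' N (inv_into (pts N) h)"
  proof (rule smooth_map_lift[OF N' N sm(2) into(2)])
    fix y assume y: "y \<in> D'"
    then have "\<theta> y \<in> D" using into by blast
    then show "inv_into (pts N) h (k' y) = k (\<theta> y)"
      using lift[of "\<theta> y"] inv[OF y] inj param_onD(2)[OF N] by (metis imageI inv_into_f_f)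
  qed
qed

lemma pts_open_submfd [simp]: "pts (open_submfd N V) = pts N \<inter> V"
  by (simp add: open_submfd_def)

lemma param_open_submfd:
  assumes N: "param_on D N k" and V: "openin (mtop N) V" and D': "open D'" "D' \<subseteq> D" "k ` D' = V"
  shows "param_on D' (open_submfd N V) k"
  unfolding param_on_def
proof (intro conjI allI impI ballI)
  show "open D'" by fact
  show "k ` D' = pts (open_submfd N V)" using D' openin_subset[OF V] by auto
  show "open (D' \<inter> k -` U)" if "openin (mtop (open_submfd N V)) U" for U
  proof -
    have "openin (mtop N) U" using that V by (simp add: open_submfd_def openin_open_subtopology)
    from open_Int[OF D'(1) param_onD(3)[OF N this]] show ?thesis using D' by (simp add: Int_absorb2 inf_assoc[symmetric])
  qed
  show "openin (mtop (open_submfd N V)) (k ` W)" if "open W" "W \<subseteq> D'" for W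
    using that D' V param_onD(4)[OF N, of W] by (auto simp: open_submfd_def openin_open_subtopology)
  have at: "\<exists>U. (U, snd c) \<in> atlas N \<and> fst c = U \<inter> V" if "c \<in> atlas (open_submfd N V)" for c
    using that by (auto simp: open_submfd_def)
  fix c assume "c \<in> atlas (open_submfd N V)"
  then obtain U where U: "(U, snd c) \<in> atlas N" "fst c = U \<inter> V" using at by blast
  show "openin (mtop (open_submfd N V)) (fst c)"
    using param_onD(5)[OF N U(1)] V U(2) by (auto simp: open_submfd_def openin_open_subtopology)
  show "inj_on (snd c) (fst c)"
    using param_onD(6)[OF N U(1)] U(2) by (auto intro: inj_on_subset)
next
  fix x assume x: "x \<in> D'"
  then obtain W where W: "x \<in> W" "W \<subseteq> D" "param_nbhd N k W" using param_onD(7)[OF N, of x] D' by auto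
  have oW: "open (W \<inter> D')" using W D' by (auto simp: param_nbhd_def)
  have P: "param_nbhd N k (W \<inter> D')"
    by (rule param_nbhd_shrink[OF W(3) oW _ param_onD(6)[OF N]]) auto
  have "param_nbhd (open_submfd N V) k (W \<inter> D')"
    unfolding param_nbhd_def
  proof (intro conjI ballI)
    show "open (W \<inter> D')" "inj_on k (W \<inter> D')" using P by (auto simp: param_nbhd_def)
    fix c assume "c \<in> atlas (open_submfd N V)"
    then obtain U where U: "(U, snd c) \<in> atlas N" "fst c = U \<inter> V" by (auto simp: open_submfd_def)
    have e: "fst c \<inter> k ` (W \<inter> D') = U \<inter> k ` (W \<inter> D')" using U D' by auto
    have "smooth_on (W \<inter> D' \<inter> k -` U) (snd c \<circ> k)" using P U(1) unfolding param_nbhd_def by fastforce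
    then show "smooth_on (W \<inter> D' \<inter> k -` fst c) (snd c \<circ> k)" by (rule smooth_on_subset) (use U in auto)
    show o: "open (snd c ` (fst c \<inter> k ` (W \<inter> D')))" unfolding e using P U(1) unfolding param_nbhd_def by fastforce
    have "smooth_on (snd c ` (fst c \<inter> k ` (W \<inter> D'))) (inv_into (W \<inter> D') k \<circ> inv_into U (snd c))"
      unfolding e using P U(1) unfolding param_nbhd_def by fastforce
    moreover have "inv_into U (snd c) y = inv_into (fst c) (snd c) y" if y: "y \<in> snd c ` (fst c \<inter> k ` (W \<inter> D'))" for y
    proof -
      obtain u where u: "u \<in> fst c" "y = snd c u" using y by blast
      have "inj_on (snd c) U" using param_onD(6)[OF N U(1)] by simp
      then show ?thesis using u U(2) by (simp add: inv_into_f_f inj_on_subset)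
    qed
    ultimately show "smooth_on (snd c ` (fst c \<inter> k ` (W \<inter> D'))) (inv_into (W \<inter> D') k \<circ> inv_into (fst c) (snd c))"
      using smooth_on_cong[OF o, of "inv_into (W \<inter> D') k \<circ> inv_into U (snd c)"] by simp
  qed
  then show "\<exists>W. x \<in> W \<and> W \<subseteq> D' \<and> param_nbhd (open_submfd N V) k W" using W x by blast
qed

lemma atlas_prod_mfd:
  assumes "c \<in> atlas (prod_mfd N N')"
  obtains a b where "a \<in> atlas N" "b \<in> atlas N'" "fst c = fst a \<times> fst b" "snd c = map_prod (snd a) (snd b)"
proof -
  obtain U \<phi> W \<psi> where "c = (U \<times> W, map_prod \<phi> \<psi>)" "(U, \<phi>) \<in> atlas N" "(W, \<psi>) \<in> atlas N'"
    using assms by (auto simp: prod_mfd_def)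
  then show thesis using that[of "(U, \<phi>)" "(W, \<psi>)"] by simp
qed

text \<open>Needed for the target \<open>U \<times> F\<close> of a bundle chart.\<close>

lemma param_prod:
  assumes N: "param_on D N k" and N': "param_on D' N' k'"
  shows "param_on (D \<times> D') (prod_mfd N N') (map_prod k k')"
  unfolding param_on_def
proof (intro conjI allI impI ballI)
  show "open (D \<times> D')" using param_onD(1)[OF N] param_onD(1)[OF N'] by (rule open_Times)
  show "map_prod k k' ` (D \<times> D') = pts (prod_mfd N N')"
    by (simp add: prod_mfd_def map_prod_def image_paired_Times param_onD(2)[OF N] param_onD(2)[OF N'])
  show "open (D \<times> D' \<inter> map_prod k k' -` V)" if V: "openin (mtop (prod_mfd N N')) V" for V
  proof (subst open_prod_def, intro ballI)
    fix x assume x: "x \<in> D \<times> D' \<inter> map_prod k k' -` V"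
    then have xV: "(k (fst x), k' (snd x)) \<in> V" by (auto simp: map_prod_def split: prod.splits)
    have "\<exists>A B. openin (mtop N) A \<and> openin (mtop N') B \<and> k (fst x) \<in> A \<and> k' (snd x) \<in> B \<and> A \<times> B \<subseteq> V"
      by (rule V[unfolded prod_mfd_def mfd.simps openin_prod_topology_alt, rule_format, OF xV])
    from this obtain A B where AB: "openin (mtop N) A" "openin (mtop N') B" "k (fst x) \<in> A" "k' (snd x) \<in> B" "A \<times> B \<subseteq> V"
      by (elim exE conjE)
    show "\<exists>A B. open A \<and> open B \<and> x \<in> A \<times> B \<and> A \<times> B \<subseteq> D \<times> D' \<inter> map_prod k k' -` V"
      by (rule exI[of _ "D \<inter> k -` A"], rule exI[of _ "D' \<inter> k' -` B"])
        (use param_onD(3)[OF N AB(1)] param_onD(3)[OF N' AB(2)] AB x in auto)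
  qed
  show "openin (mtop (prod_mfd N N')) (map_prod k k' ` W)" if W: "open W" "W \<subseteq> D \<times> D'" for W
    unfolding prod_mfd_def mfd.simps openin_prod_topology_alt
  proof (intro allI impI)
    fix y y' assume "(y, y') \<in> map_prod k k' ` W"
    then obtain x x' where x: "(x, x') \<in> W" "y = k x" "y' = k' x'" by auto
    then obtain A B where AB: "open A" "open B" "x \<in> A" "x' \<in> B" "A \<times> B \<subseteq> W"
      using W(1) by (metis open_prod_elim mem_Sigma_iff)
    then have "A \<subseteq> D" "B \<subseteq> D'" using W(2) by auto
    moreover have "k ` A \<times> k' ` B \<subseteq> map_prod k k' ` W"
      using image_mono[OF AB(5), of "map_prod k k'"] by (simp add: map_prod_def image_paired_Times)
    ultimately show "\<exists>U V. openin (mtop N) U \<and> openin (mtop N') V \<and> y \<in> U \<and> y' \<in> V \<and> U \<times> V \<subseteq> map_prod k k' ` W"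
      using param_onD(4)[OF N AB(1)] param_onD(4)[OF N' AB(2)] AB(3,4) x(2,3)
      by (intro exI[of _ "k ` A"] exI[of _ "k' ` B"]) simp
  qed
  have injc: "inj_on (map_prod (snd a) (snd b)) (fst a \<times> fst b)" if "a \<in> atlas N" "b \<in> atlas N'" for a b
    using param_onD(6)[OF N that(1)] param_onD(6)[OF N' that(2)] by (rule map_prod_inj_on)
  fix c assume "c \<in> atlas (prod_mfd N N')"
  then obtain a b where ab: "a \<in> atlas N" "b \<in> atlas N'" "fst c = fst a \<times> fst b" "snd c = map_prod (snd a) (snd b)"
    by (rule atlas_prod_mfd)
  show "openin (mtop (prod_mfd N N')) (fst c)"
    using param_onD(5)[OF N ab(1)] param_onD(5)[OF N' ab(2)] ab(3) by (simp add: prod_mfd_def openin_prod_Times_iff)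
  show "inj_on (snd c) (fst c)" using injc ab by simp
next
  fix x assume x: "x \<in> D \<times> D'"
  obtain W where W: "fst x \<in> W" "W \<subseteq> D" "param_nbhd N k W" using param_onD(7)[OF N, of "fst x"] x by auto
  obtain W' where W': "snd x \<in> W'" "W' \<subseteq> D'" "param_nbhd N' k' W'" using param_onD(7)[OF N', of "snd x"] x by auto
  have inj: "inj_on (map_prod k k') (W \<times> W')" using W W' by (simp add: param_nbhd_def map_prod_inj_on)
  have "param_nbhd (prod_mfd N N') (map_prod k k') (W \<times> W')"
    unfolding param_nbhd_def
  proof (intro conjI ballI)
    show "open (W \<times> W')" using W W' by (auto simp: param_nbhd_def intro: open_Times)
    show "inj_on (map_prod k k') (W \<times> W')" by fact
    fix c assume "c \<in> atlas (prod_mfd N N')"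
    then obtain a b where ab: "a \<in> atlas N" "b \<in> atlas N'" "fst c = fst a \<times> fst b" "snd c = map_prod (snd a) (snd b)"
      by (rule atlas_prod_mfd)
    note inja = param_onD(6)[OF N ab(1)] and injb = param_onD(6)[OF N' ab(2)]
    have ea: "W \<inter> k -` fst a = W \<inter> (D \<inter> k -` fst a)" and eb: "W' \<inter> k' -` fst b = W' \<inter> (D' \<inter> k' -` fst b)"
      using W W' by auto
    have oa: "open (W \<inter> k -` fst a)" and ob: "open (W' \<inter> k' -` fst b)" unfolding ea eb
      using param_onD(3)[OF N param_onD(5)[OF N ab(1)]] param_onD(3)[OF N' param_onD(5)[OF N' ab(2)]] W W'
      by (auto simp: param_nbhd_def)
    have e1: "W \<times> W' \<inter> map_prod k k' -` fst c = (W \<inter> k -` fst a) \<times> (W' \<inter> k' -` fst b)" using ab by auto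
    have s1: "smooth_on ((W \<inter> k -` fst a) \<times> (W' \<inter> k' -` fst b)) (\<lambda>z. ((snd a \<circ> k) (fst z), (snd b \<circ> k') (snd z)))"
      by (intro smooth_on_Pair open_Times oa ob
          smooth_on_compose[OF _ oa _ smooth_on_fst[OF _ smooth_on_id] param_nbhdD(3)[OF W(3) ab(1)]]
          smooth_on_compose[OF _ ob _ smooth_on_snd[OF _ smooth_on_id] param_nbhdD(3)[OF W'(3) ab(2)]])
        auto
    have "(\<lambda>z. ((snd a \<circ> k) (fst z), (snd b \<circ> k') (snd z))) = snd c \<circ> map_prod k k'"
      using ab by (auto simp: fun_eq_iff)
    with s1 show "smooth_on (W \<times> W' \<inter> map_prod k k' -` fst c) (snd c \<circ> map_prod k k')"
      unfolding e1 by simp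
    let ?A = "snd a ` (fst a \<inter> k ` W)" and ?B = "snd b ` (fst b \<inter> k' ` W')"
    have oA: "open ?A" and oB: "open ?B" using W W' ab by (auto simp: param_nbhd_def)
    have e2: "snd c ` (fst c \<inter> map_prod k k' ` (W \<times> W')) = ?A \<times> ?B"
    proof -
      have "fst c \<inter> map_prod k k' ` (W \<times> W') = (fst a \<inter> k ` W) \<times> (fst b \<inter> k' ` W')"
        by (simp add: ab(3) map_prod_def image_paired_Times Times_Int_Times)
      then show ?thesis by (simp add: ab(4) map_prod_def image_paired_Times)
    qed
    show o: "open (snd c ` (fst c \<inter> map_prod k k' ` (W \<times> W')))" unfolding e2 using oA oB by (rule open_Times)
    let ?r = "inv_into W k \<circ> inv_into (fst a) (snd a)" and ?r' = "inv_into W' k' \<circ> inv_into (fst b) (snd b)"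
    have "smooth_on (?A \<times> ?B) (\<lambda>z. (?r (fst z), ?r' (snd z)))"
      by (intro smooth_on_Pair open_Times oA oB
          smooth_on_compose[OF _ oA _ smooth_on_fst[OF _ smooth_on_id] param_nbhdD(5)[OF W(3) ab(1)]]
          smooth_on_compose[OF _ oB _ smooth_on_snd[OF _ smooth_on_id] param_nbhdD(5)[OF W'(3) ab(2)]])
        auto
    moreover have "(?r (fst z), ?r' (snd z)) = (inv_into (W \<times> W') (map_prod k k') \<circ> inv_into (fst c) (snd c)) z"
      if z: "z \<in> ?A \<times> ?B" for z
    proof -
      obtain w w' where w: "w \<in> W" "k w \<in> fst a" "w' \<in> W'" "k' w' \<in> fst b" "z = (snd a (k w), snd b (k' w'))"
        using z by auto
      have "inv_into (fst c) (snd c) z = (k w, k' w')"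
        using w ab map_prod_inj_on[OF inja injb] by (intro inv_into_f_eq) auto
      moreover have "inv_into (W \<times> W') (map_prod k k') (k w, k' w') = (w, w')"
        using w inj by (intro inv_into_f_eq) auto
      ultimately show ?thesis
        using w inja injb W(3) W'(3) by (simp add: param_nbhd_def inv_into_f_f)
    qed
    ultimately show "smooth_on (snd c ` (fst c \<inter> map_prod k k' ` (W \<times> W'))) (inv_into (W \<times> W') (map_prod k k') \<circ> inv_into (fst c) (snd c))"
      unfolding e2 by (rule smooth_on_cong[OF open_Times[OF oA oB], rotated])
  qed
  then show "\<exists>Wa. x \<in> Wa \<and> Wa \<subseteq> D \<times> D' \<and> param_nbhd (prod_mfd N N') (map_prod k k') Wa"
    using W W' by (intro exI[of _ "W \<times> W'"]) (auto simp: mem_Times_iff)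
qed

lemma openin_submfd: "openin (mtop N) V \<Longrightarrow> openin (mtop (open_submfd N V)) U \<longleftrightarrow> openin (mtop N) U \<and> U \<subseteq> V"
  by (simp add: open_submfd_def openin_open_subtopology)

text \<open>The link with quotients of group actions, whose projections are local diffeomorphisms.  The source is
  required to have one global chart, with inverse \<open>\<theta>\<close>; this covers both the whole space and its slices.\<close>

lemma param_of_local_diffeo:
  assumes N: "smooth_manifold N" and q: "local_diffeo X N q" "q ` pts X = pts N"
    and X: "atlas X = {(pts X, \<phi>)}" "\<And>y. \<phi> (\<theta> y) = y" "range \<theta> = pts X"
      "\<And>W. openin (mtop X) (\<theta> ` W) \<longleftrightarrow> open W"
  shows "param_on UNIV N (\<lambda>y. q (\<theta> y))"
proof -
  let ?k = "\<lambda>y. q (\<theta> y)"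
  have charts: "openin (mtop N) (fst c)" "inj_on (snd c) (fst c)"
    "homeomorphic_map (subtopology (mtop N) (fst c)) (top_of_set (snd c ` fst c)) (snd c)"
    "open (snd c ` fst c)" if "c \<in> atlas N" for c
  proof -
    have *: "openin (mtop N) (fst c)" "open (snd c ` fst c)"
      "homeomorphic_map (subtopology (mtop N) (fst c)) (top_of_set (snd c ` fst c)) (snd c)"
      using N that unfolding smooth_manifold_def by fastforce+
    then show "openin (mtop N) (fst c)" "open (snd c ` fst c)"
      "homeomorphic_map (subtopology (mtop N) (fst c)) (top_of_set (snd c ` fst c)) (snd c)" by auto
    have "topspace (subtopology (mtop N) (fst c)) = fst c" using openin_subset[OF *(1)] by auto
    with *(3) show "inj_on (snd c) (fst c)"
      using homeomorphic_imp_injective_map by metis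
  qed
  have \<theta>inj: "inj \<theta>" using X(2) by (rule inj_on_inverseI)
  have loc: "\<exists>W. x \<in> W \<and> param_nbhd N ?k W \<and>
      (\<forall>A. openin (mtop N) A \<longrightarrow> open (W \<inter> ?k -` A)) \<and> (\<forall>A. open A \<longrightarrow> A \<subseteq> W \<longrightarrow> openin (mtop N) (?k ` A))" for x
  proof -
    have "\<theta> x \<in> pts X" using X(3) by blast
    then obtain U where U: "\<theta> x \<in> U" "openin (mtop X) U" "openin (mtop N) (q ` U)"
      and df: "diffeomorphism (open_submfd X U) (open_submfd N (q ` U)) q"
      using q(1) unfolding local_diffeo_def by blast
    define W where "W = \<theta> -` U"
    have UX: "U \<subseteq> pts X" by (rule openin_subset[OF U(2)])
    then have \<theta>W: "\<theta> ` W = U" by (simp add: W_def image_vimage_eq X(3) Int_absorb2)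
    have pX: "pts (open_submfd X U) = U" using UX by auto
    have pN: "pts (open_submfd N (q ` U)) = q ` U" using openin_subset[OF U(3)] by auto
    have oW: "open W" using X(4)[of W] \<theta>W U(2) by simp
    have injq: "inj_on q U" using df pX by (simp add: diffeomorphism_def bij_betw_def)
    have injW: "inj_on ?k W"
      using injq \<theta>inj by (simp add: inj_on_def W_def)
    have kW: "?k ` W = q ` U" unfolding \<theta>W[symmetric] by (simp add: image_image)
    define h where "h = inv_into U q"
    have hq: "h (q (\<theta> w)) = \<theta> w" if "w \<in> W" for w
      unfolding h_def using injq that by (simp add: inv_into_f_f W_def)
    have sm: "smooth_map (open_submfd X U) (open_submfd N (q ` U)) q" "smooth_map (open_submfd N (q ` U)) (open_submfd X U) h"
      using df unfolding diffeomorphism_def pX h_def by blast+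
    have atX: "(U, \<phi>) \<in> atlas (open_submfd X U)" using X(1) UX by (auto simp: open_submfd_def)
    have invU: "inv_into U \<phi> w = \<theta> w" if "w \<in> W" for w
    proof (rule inv_into_f_eq)
      show "inj_on \<phi> U" using UX X(2,3) by (metis inj_on_inverseI rangeE subsetD)
    qed (use that X(2) in \<open>auto simp: W_def\<close>)
    have contX: "open (W \<inter> ?k -` A)" if A: "openin (mtop N) A" for A
    proof -
      have "openin (mtop (open_submfd N (q ` U))) (A \<inter> q ` U)" using A U(3) by (auto simp: openin_submfd)
      moreover have "continuous_map (mtop (open_submfd X U)) (mtop (open_submfd N (q ` U))) q" using sm by (simp add: smooth_map_def)
      ultimately have "openin (mtop (open_submfd X U)) {z \<in> U. q z \<in> A \<inter> q ` U}"
        using openin_continuous_map_preimage pX by fastforce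
      moreover have "{z \<in> U. q z \<in> A \<inter> q ` U} = \<theta> ` (W \<inter> ?k -` A)" using \<theta>W by auto
      ultimately show ?thesis using openin_submfd[OF U(2)] X(4) by metis
    qed
    have opN: "openin (mtop N) (?k ` A)" if A: "open A" "A \<subseteq> W" for A
    proof -
      have "openin (mtop (open_submfd X U)) (\<theta> ` A)" using A X(4)[of A] \<theta>W openin_submfd[OF U(2)] by blast
      moreover have "continuous_map (mtop (open_submfd N (q ` U))) (mtop (open_submfd X U)) h" using sm by (simp add: smooth_map_def)
      ultimately have "openin (mtop (open_submfd N (q ` U))) {z \<in> q ` U. h z \<in> \<theta> ` A}"
        using openin_continuous_map_preimage pN by fastforce
      moreover have "{z \<in> q ` U. h z \<in> \<theta> ` A} = ?k ` A"
      proof (intro equalityI subsetI)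
        fix z assume z: "z \<in> {z \<in> q ` U. h z \<in> \<theta> ` A}"
        then obtain w where "w \<in> W" "z = ?k w" using kW by blast
        then show "z \<in> ?k ` A" using z hq[of w] \<theta>inj by (auto dest: injD)
      next
        fix z assume "z \<in> ?k ` A"
        then obtain w where "w \<in> A" "z = ?k w" by blast
        then show "z \<in> {z \<in> q ` U. h z \<in> \<theta> ` A}" using hq[of w] A kW by auto
      qed
      ultimately show ?thesis using openin_submfd[OF U(3)] by simp
    qed
    have "param_nbhd N ?k W"
      unfolding param_nbhd_def
    proof (intro conjI ballI)
      fix c assume c: "c \<in> atlas N"
      have atN: "(fst c \<inter> q ` U, snd c) \<in> atlas (open_submfd N (q ` U))" using c by (force simp: open_submfd_def)
      have inv: "inv_into (fst c \<inter> q ` U) (snd c) y = inv_into (fst c) (snd c) y" if y: "y \<in> snd c ` (fst c \<inter> q ` U)" for y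
      proof -
        obtain u where "u \<in> fst c \<inter> q ` U" "y = snd c u" using y by blast
        then show ?thesis using charts(2)[OF c] by (simp add: inv_into_f_f inj_on_subset)
      qed
      have o1: "open (W \<inter> ?k -` fst c)" by (rule contX[OF charts(1)[OF c]])
      have "local_dom q (U, \<phi>) (fst c \<inter> q ` U, snd c) = W \<inter> ?k -` fst c"
      proof -
        have "U \<inter> q -` (fst c \<inter> q ` U) = \<theta> ` (W \<inter> ?k -` fst c)" using \<theta>W by auto
        then show ?thesis unfolding local_dom_def fst_conv snd_conv by (simp add: image_image X(2))
      qed
      then have "smooth_on (W \<inter> ?k -` fst c) (local_rep q (U, \<phi>) (fst c \<inter> q ` U, snd c))"
        using sm(1) atX atN unfolding smooth_map_def by metis
      then show "smooth_on (W \<inter> ?k -` fst c) (snd c \<circ> ?k)"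
        by (rule smooth_on_cong[OF o1, rotated]) (simp add: local_rep_def invU)
      show o2: "open (snd c ` (fst c \<inter> ?k ` W))"
      proof -
        have "openin (subtopology (mtop N) (fst c)) (fst c \<inter> ?k ` W)"
          using charts(1)[OF c] opN[OF oW] by (auto simp: openin_open_subtopology)
        then have "openin (top_of_set (snd c ` fst c)) (snd c ` (fst c \<inter> ?k ` W))"
          using homeomorphic_map_openness_eq[OF charts(3)[OF c]] by blast
        then show ?thesis using charts(4)[OF c] openin_open_trans by blast
      qed
      have "local_dom h (fst c \<inter> q ` U, snd c) (U, \<phi>) = snd c ` (fst c \<inter> ?k ` W)"
        unfolding local_dom_def kW[symmetric] using hq by (auto simp: W_def)
      then have "smooth_on (snd c ` (fst c \<inter> ?k ` W)) (local_rep h (fst c \<inter> q ` U, snd c) (U, \<phi>))"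
        using sm(2) atX atN unfolding smooth_map_def by metis
      then show "smooth_on (snd c ` (fst c \<inter> ?k ` W)) (inv_into W ?k \<circ> inv_into (fst c) (snd c))"
      proof (rule smooth_on_cong[OF o2, rotated])
        fix y assume "y \<in> snd c ` (fst c \<inter> ?k ` W)"
        then obtain w where w: "w \<in> W" "?k w \<in> fst c" "y = snd c (?k w)" by blast
        then have "inv_into (fst c) (snd c) y = ?k w" using charts(2)[OF c] by (simp add: inv_into_f_f)
        moreover have "inv_into (fst c \<inter> q ` U) (snd c) y = inv_into (fst c) (snd c) y"
          using inv[of y] w kW by blast
        moreover have "inv_into W ?k (?k w) = w" using injW w by (rule_tac inv_into_f_f) auto
        ultimately show "local_rep h (fst c \<inter> q ` U, snd c) (U, \<phi>) y = (inv_into W ?k \<circ> inv_into (fst c) (snd c)) y"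
          using hq w X(2) by (simp add: local_rep_def)
      qed
    qed (use oW injW in auto)
    moreover have "x \<in> W" using U(1) by (simp add: W_def)
    ultimately show ?thesis using contX opN by (intro exI[of _ W]) simp
  qed
  show ?thesis
    unfolding param_on_def
  proof (intro conjI allI impI ballI)
    show "range ?k = pts N" unfolding q(2)[symmetric] X(3)[symmetric] by (simp add: image_image)
    show "open (UNIV \<inter> ?k -` V)" if "openin (mtop N) V" for V
    proof (subst open_subopen, intro ballI)
      fix x assume x: "x \<in> UNIV \<inter> ?k -` V"
      obtain W where "x \<in> W" "\<forall>A. openin (mtop N) A \<longrightarrow> open (W \<inter> ?k -` A)"
        using loc[of x] by (elim exE conjE)
      with that have "x \<in> W" "open (W \<inter> ?k -` V)" by simp_all
      then show "\<exists>T. open T \<and> x \<in> T \<and> T \<subseteq> UNIV \<inter> ?k -` V"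
        using x by (intro exI[of _ "W \<inter> ?k -` V"]) simp
    qed
    show "openin (mtop N) (?k ` A)" if "open A" for A
    proof (subst openin_subopen, intro ballI)
      fix z assume "z \<in> ?k ` A"
      then obtain x where x: "x \<in> A" "z = ?k x" by blast
      obtain W where W: "x \<in> W" "param_nbhd N ?k W" "\<forall>A. open A \<longrightarrow> A \<subseteq> W \<longrightarrow> openin (mtop N) (?k ` A)"
        using loc[of x] by (elim exE conjE)
      have "openin (mtop N) (?k ` (A \<inter> W))" using W(3) that param_nbhdD(1)[OF W(2)] by blast
      then show "\<exists>T. openin (mtop N) T \<and> z \<in> T \<and> T \<subseteq> ?k ` A" using x W(1) by blast
    qed
    show "\<exists>W. x \<in> W \<and> W \<subseteq> UNIV \<and> param_nbhd N ?k W" for x using loc[of x] by blast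
  qed (use charts in auto)
qed

section \<open>Quotients of Euclidean spaces by deck transformations\<close>

text \<open>The circle, the fibres of the bundle and the orbit spaces of the slices are all of this form.  The
  charts are the local inverses of the projection, as for \<open>real_quot\<close>.\<close>

definition quot_mfd :: "('e::euclidean_space \<Rightarrow> 'y) \<Rightarrow> ('y, 'e) mfd" where
  "quot_mfd k = \<lparr>mtop = topology (\<lambda>S. S \<subseteq> range k \<and> open (k -` S)),
     atlas = {(k ` U, inv_into U k) |U. open U \<and> inj_on k U}\<rparr>"

lemma real_quot_eq: "real_quot D = quot_mfd (real_coset D)"
  by (simp add: real_quot_def quot_mfd_def)

lemma openin_quot_mfd: "openin (mtop (quot_mfd k)) S \<longleftrightarrow> S \<subseteq> range k \<and> open (k -` S)"
proof -
  have "istopology (\<lambda>S. S \<subseteq> range k \<and> open (k -` S))"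
    unfolding istopology_def
  proof (intro conjI allI impI)
    fix K assume K: "\<forall>S\<in>K. S \<subseteq> range k \<and> open (k -` S)"
    then show "\<Union>K \<subseteq> range k" by blast
    show "open (k -` \<Union>K)" unfolding vimage_Union using K by blast
  qed (auto simp only: vimage_Int intro: open_Int)
  then show ?thesis by (simp add: quot_mfd_def topology_inverse')
qed

lemma pts_quot_mfd [simp]: "pts (quot_mfd k) = range k"
proof
  show "pts (quot_mfd k) \<subseteq> range k"
    using openin_topspace[of "mtop (quot_mfd k)"] unfolding openin_quot_mfd by (rule conjunct1)
  have "openin (mtop (quot_mfd k)) (range k)"
    unfolding openin_quot_mfd by (simp add: vimage_def)
  then show "range k \<subseteq> pts (quot_mfd k)" by (rule openin_subset)
qed

text \<open>Points with the same image are required to differ by a smooth map \<open>g\<close> under which \<open>k\<close> is invariant,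
  not merely by some germ.  This makes the projection open and identifies the transition maps with the maps
  \<open>g\<close>; so the definition depends on \<open>k\<close> only through the relation \<open>k x = k y\<close>.\<close>

definition deck_quotient :: "('e::euclidean_space \<Rightarrow> 'y) \<Rightarrow> bool" where
  "deck_quotient k \<longleftrightarrow>
     (\<forall>x. \<exists>W. open W \<and> x \<in> W \<and> inj_on k W) \<and>
     (\<forall>x y. k x = k y \<longrightarrow> (\<exists>g. smooth_on UNIV g \<and> g x = y \<and> (\<forall>z. k (g z) = k z))) \<and>
     (\<forall>x y. k x \<noteq> k y \<longrightarrow> (\<exists>A B. open A \<and> open B \<and> x \<in> A \<and> y \<in> B \<and> k ` A \<inter> k ` B = {}))"

lemma deck_quotient_cong:
  assumes "deck_quotient k" "\<And>x y. k x = k y \<longleftrightarrow> k' x = k' y"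
  shows "deck_quotient k'"
proof -
  have "inj_on k W \<longleftrightarrow> inj_on k' W" for W using assms(2) by (simp add: inj_on_def)
  moreover have "k ` A \<inter> k ` B = {} \<longleftrightarrow> k' ` A \<inter> k' ` B = {}" for A B
    using assms(2) by (auto simp: disjoint_iff image_iff)
  ultimately show ?thesis using assms unfolding deck_quotient_def by simp
qed

lemma inv_deck:
  assumes "inj_on k U" "g z \<in> U" "k (g z) = k z" shows "inv_into U k (k z) = g z"
  using assms by (metis inv_into_f_f)

context
  fixes k :: "'e::euclidean_space \<Rightarrow> 'y" assumes k: "deck_quotient k"
begin

lemma deck_ex: "k x = k y \<Longrightarrow> \<exists>g. smooth_on UNIV g \<and> g x = y \<and> (\<forall>z. k (g z) = k z)"
  using k unfolding deck_quotient_def by blast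

lemma open_saturation: assumes "open W" shows "open (k -` (k ` W))"
proof (subst open_subopen, intro ballI)
  fix x assume "x \<in> k -` (k ` W)"
  then obtain w where w: "w \<in> W" "k x = k w" by auto
  obtain g where g: "smooth_on UNIV g" "g x = w" "\<forall>z. k (g z) = k z" using deck_ex[OF w(2)] by blast
  have "open (UNIV \<inter> g -` W)" by (rule open_vimage_Int[OF smooth_on_continuous[OF g(1)] open_UNIV assms])
  moreover have "g -` W \<subseteq> k -` (k ` W)" using g(3) by (metis image_eqI subsetI vimage_eq)
  ultimately show "\<exists>T. open T \<and> x \<in> T \<and> T \<subseteq> k -` (k ` W)" using g(2) w(1) by (intro exI[of _ "g -` W"]) auto
qed

lemma openin_quot_image: "open W \<Longrightarrow> openin (mtop (quot_mfd k)) (k ` W)"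
  using open_saturation by (auto simp: openin_quot_mfd)

text \<open>Changing charts means following a deck transformation.\<close>

lemma smooth_transition:
  assumes U: "open U" "inj_on k U"
  shows "smooth_on (k -` (k ` U)) (inv_into U k \<circ> k)"
proof (rule smooth_on_local)
  fix x assume "x \<in> k -` (k ` U)"
  then obtain u where u: "u \<in> U" "k x = k u" by auto
  obtain g where g: "smooth_on UNIV g" "g x = u" "\<forall>z. k (g z) = k z" using deck_ex[OF u(2)] by blast
  have o: "open (UNIV \<inter> g -` U)" by (rule open_vimage_Int[OF smooth_on_continuous[OF g(1)] open_UNIV U(1)])
  have "smooth_on (UNIV \<inter> g -` U) (inv_into U k \<circ> k)"
    by (rule smooth_on_cong[OF o _ smooth_on_subset[OF g(1)]]) (use g(3) U(2) inv_deck[of k U g] in auto)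
  then show "\<exists>T. open T \<and> x \<in> T \<and> smooth_on T (inv_into U k \<circ> k)" using o u g(2) by blast
qed

lemma quot_chart_image:
  assumes "inj_on k U" shows "inv_into U k ` (k ` U \<inter> B) = U \<inter> k -` B"
  using assms by (force simp: inv_into_f_f)

lemma inj_on_quot_chart: "inj_on (inv_into U k) (k ` U)"
  by (rule inj_on_inv_into) simp

lemma inv_quot_chart: "inj_on k U \<Longrightarrow> u \<in> U \<Longrightarrow> inv_into (k ` U) (inv_into U k) u = k u"
  by (rule inv_into_f_eq[OF inj_on_quot_chart]) auto

lemma param_quot: "param_on UNIV (quot_mfd k) k"
  unfolding param_on_def
proof (intro conjI allI impI ballI)
  show "open (UNIV \<inter> k -` V)" if "openin (mtop (quot_mfd k)) V" for V using that by (simp add: openin_quot_mfd)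
  show "openin (mtop (quot_mfd k)) (k ` W)" if "open W" for W using that by (rule openin_quot_image)
  fix c assume "c \<in> atlas (quot_mfd k)"
  then obtain U where "open U" "inj_on k U" "c = (k ` U, inv_into U k)" by (auto simp: quot_mfd_def)
  then show "openin (mtop (quot_mfd k)) (fst c)" "inj_on (snd c) (fst c)"
    using openin_quot_image inj_on_quot_chart by auto
next
  fix x
  obtain W where W: "open W" "x \<in> W" "inj_on k W" using k unfolding deck_quotient_def by blast
  have "param_nbhd (quot_mfd k) k W"
    unfolding param_nbhd_def
  proof (intro conjI ballI)
    fix c assume "c \<in> atlas (quot_mfd k)"
    then obtain U where U: "open U" "inj_on k U" "c = (k ` U, inv_into U k)" by (auto simp: quot_mfd_def)
    show "smooth_on (W \<inter> k -` fst c) (snd c \<circ> k)"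
      using smooth_on_subset[OF smooth_transition[OF U(1,2)]] U(3) by simp
    show o: "open (snd c ` (fst c \<inter> k ` W))"
      using open_Int[OF U(1) open_saturation[OF W(1)]] by (simp add: U(3) quot_chart_image[OF U(2)])
    have "smooth_on (snd c ` (fst c \<inter> k ` W)) (inv_into W k \<circ> k)"
      by (rule smooth_on_subset[OF smooth_transition[OF W(1,3)]]) (simp add: U(3) quot_chart_image[OF U(2)])
    then show "smooth_on (snd c ` (fst c \<inter> k ` W)) (inv_into W k \<circ> inv_into (fst c) (snd c))"
      by (rule smooth_on_cong[OF o, rotated]) (simp add: U(3) quot_chart_image[OF U(2)] inv_quot_chart[OF U(2)])
  qed (use W in auto)
  then show "\<exists>W. x \<in> W \<and> W \<subseteq> UNIV \<and> param_nbhd (quot_mfd k) k W" using W by blast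
qed auto

lemma manifold_quot: "smooth_manifold (quot_mfd k)"
  unfolding smooth_manifold_def
proof (intro conjI)
  show "Hausdorff_space (mtop (quot_mfd k))"
    unfolding Hausdorff_space_def
  proof (intro allI impI)
    fix a b assume "a \<in> pts (quot_mfd k) \<and> b \<in> pts (quot_mfd k) \<and> a \<noteq> b"
    then obtain x y where xy: "a = k x" "b = k y" "k x \<noteq> k y" by auto
    obtain A B where "open A" "open B" "x \<in> A" "y \<in> B" "k ` A \<inter> k ` B = {}"
      using k xy(3) unfolding deck_quotient_def by metis
    then show "\<exists>U V. openin (mtop (quot_mfd k)) U \<and> openin (mtop (quot_mfd k)) V \<and> a \<in> U \<and> b \<in> V \<and> disjnt U V"
      using openin_quot_image xy by (intro exI[of _ "k ` A"] exI[of _ "k ` B"]) (auto simp: disjnt_def)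
  qed
  show "second_countable_top (mtop (quot_mfd k))"
  proof -
    obtain B :: "'e set set" where B: "countable B" "topological_basis B" using ex_countable_basis by blast
    show ?thesis unfolding second_countable_top_def
    proof (rule exI[of _ "(`) k ` B"], intro conjI allI impI ballI)
      show "countable ((`) k ` B)" using B by simp
      show "openin (mtop (quot_mfd k)) V" if "V \<in> (`) k ` B" for V
        using that B(2) openin_quot_image topological_basis_open by blast
      fix U assume U: "openin (mtop (quot_mfd k)) U"
      then obtain B' where B': "B' \<subseteq> B" "\<Union>B' = k -` U"
        using B(2) unfolding topological_basis_def openin_quot_mfd by metis
      have "U = k ` (k -` U)" using U by (auto simp: openin_quot_mfd)
      also have "\<dots> = \<Union>((`) k ` B')" unfolding B'(2)[symmetric] by blast
      finally show "\<exists>B''\<subseteq>(`) k ` B. U = \<Union>B''" using B'(1) by (intro exI[of _ "(`) k ` B'"]) auto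
    qed
  qed
  show "\<Union> (fst ` atlas (quot_mfd k)) = pts (quot_mfd k)"
  proof -
    have at: "fst ` atlas (quot_mfd k) = {k ` U |U. open U \<and> inj_on k U}"
    proof -
      have "atlas (quot_mfd k) = (\<lambda>U. (k ` U, inv_into U k)) ` {U. open U \<and> inj_on k U}"
        by (simp add: quot_mfd_def image_Collect)
      then show ?thesis by (simp add: image_image image_Collect)
    qed
    show ?thesis unfolding at pts_quot_mfd
    proof (intro equalityI subsetI)
      fix z assume "z \<in> range k"
      then obtain x where x: "z = k x" by blast
      obtain W where W: "open W" "x \<in> W" "inj_on k W" using k unfolding deck_quotient_def by blast
      then have "k ` W \<in> {k ` U |U. open U \<and> inj_on k U}" by (intro CollectI exI[of _ W]) simp
      moreover have "z \<in> k ` W" using W x by simp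
      ultimately show "z \<in> \<Union>{k ` U |U. open U \<and> inj_on k U}" by (rule UnionI)
    next
      fix z assume "z \<in> \<Union>{k ` U |U. open U \<and> inj_on k U}"
      then show "z \<in> range k" by (elim UnionE CollectE exE conjE) (simp, erule imageE, simp)
    qed
  qed
  show "\<forall>(U, \<phi>)\<in>atlas (quot_mfd k). openin (mtop (quot_mfd k)) U \<and> open (\<phi> ` U) \<and>
      homeomorphic_map (subtopology (mtop (quot_mfd k)) U) (top_of_set (\<phi> ` U)) \<phi>"
  proof (clarify)
    fix V \<phi> assume "(V, \<phi>) \<in> atlas (quot_mfd k)"
    then obtain U where U: "open U" "inj_on k U" "V = k ` U" "\<phi> = inv_into U k" by (auto simp: quot_mfd_def)
    have im: "\<phi> ` V = U" using U by (force simp: inv_into_f_f)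
    have oV: "openin (mtop (quot_mfd k)) V" using openin_quot_image U by simp
    have tV: "topspace (subtopology (mtop (quot_mfd k)) V) = V" using U by auto
    have "homeomorphic_maps (subtopology (mtop (quot_mfd k)) V) (top_of_set U) \<phi> k"
      unfolding homeomorphic_maps_def
    proof (intro conjI ballI)
      show "continuous_map (subtopology (mtop (quot_mfd k)) V) (top_of_set U) \<phi>"
        unfolding continuous_map_def tV
      proof (intro conjI allI impI Pi_I)
        fix A assume "openin (top_of_set U) A"
        then have A: "open A" "A \<subseteq> U" using U(1) openin_open_eq by auto
        have "{x \<in> V. \<phi> x \<in> A} = k ` A" using A U by (auto simp: inv_into_f_f subsetD)
        then show "openin (subtopology (mtop (quot_mfd k)) V) {x \<in> V. \<phi> x \<in> A}"
          using openin_quot_image[OF A(1)] oV A U by (auto simp: openin_open_subtopology)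
      qed (use im in auto)
      show "continuous_map (top_of_set U) (subtopology (mtop (quot_mfd k)) V) k"
        unfolding continuous_map_def tV
      proof (intro conjI allI impI Pi_I)
        fix A assume "openin (subtopology (mtop (quot_mfd k)) V) A"
        then have "open (k -` A)" using oV by (simp add: openin_open_subtopology openin_quot_mfd)
        moreover have "{x \<in> topspace (top_of_set U). k x \<in> A} = U \<inter> k -` A" by auto
        ultimately show "openin (top_of_set U) {x \<in> topspace (top_of_set U). k x \<in> A}" by (simp add: openin_open_Int)
      qed (use U in auto)
    qed (use U tV in \<open>auto simp: inv_into_f_f f_inv_into_f\<close>)
    then have "homeomorphic_map (subtopology (mtop (quot_mfd k)) V) (top_of_set (\<phi> ` V)) \<phi>"
      unfolding im by (rule homeomorphic_maps_imp_map)
    then show "openin (mtop (quot_mfd k)) V \<and> open (\<phi> ` V) \<and>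
      homeomorphic_map (subtopology (mtop (quot_mfd k)) V) (top_of_set (\<phi> ` V)) \<phi>" using oV im U(1) by simp
  qed
  show "\<forall>(U, \<phi>)\<in>atlas (quot_mfd k). \<forall>(W, \<psi>)\<in>atlas (quot_mfd k). smooth_on (\<phi> ` (U \<inter> W)) (\<psi> \<circ> inv_into U \<phi>)"
  proof (clarify)
    fix V \<phi> V' \<psi> assume "(V, \<phi>) \<in> atlas (quot_mfd k)" "(V', \<psi>) \<in> atlas (quot_mfd k)"
    then obtain U U' where U: "open U" "inj_on k U" "V = k ` U" "\<phi> = inv_into U k"
      "open U'" "inj_on k U'" "V' = k ` U'" "\<psi> = inv_into U' k" by (auto simp: quot_mfd_def)
    have e: "\<phi> ` (V \<inter> V') = U \<inter> k -` V'" using quot_chart_image[OF U(2)] U by simp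
    have o: "open (U \<inter> k -` V')" using open_Int[OF U(1) open_saturation[OF U(5)]] U by simp
    have "smooth_on (U \<inter> k -` V') (\<psi> \<circ> k)" using smooth_on_subset[OF smooth_transition[OF U(5,6)]] U by simp
    then show "smooth_on (\<phi> ` (V \<inter> V')) (\<psi> \<circ> inv_into V \<phi>)" unfolding e
      by (rule smooth_on_cong[OF o, rotated]) (simp add: U(3,4) inv_quot_chart[OF U(2)])
  qed
qed

end

lemma compact_space_quot:
  assumes "compact C" "k ` C = range k" shows "compact_space (mtop (quot_mfd k))"
proof -
  have "continuous_map euclidean (mtop (quot_mfd k)) k"
    by (auto simp: continuous_map_def openin_quot_mfd vimage_def)
  from image_compactin[OF _ this, of C] show ?thesis
    using assms by (simp add: compact_space_def)
qed

section \<open>Solutions of the differential equation\<close>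

lemma tderiv_scale:
  assumes "smooth_on UNIV u"
  shows "tderiv (\<lambda>t. c *\<^sub>R u t) = (\<lambda>t. c *\<^sub>R tderiv u t)"
    "tderiv (tderiv (\<lambda>t. c *\<^sub>R u t)) = (\<lambda>t. c *\<^sub>R tderiv (tderiv u) t)"
proof -
  show *: "tderiv (\<lambda>t. c *\<^sub>R u t) = (\<lambda>t. c *\<^sub>R tderiv u t)"
    by (intro ext vector_derivative_at bounded_linear.has_vector_derivative[OF bounded_linear_scaleR_right]
        smooth_on_has_vector_derivative assms)
  show "tderiv (tderiv (\<lambda>t. c *\<^sub>R u t)) = (\<lambda>t. c *\<^sub>R tderiv (tderiv u) t)"
    unfolding * by (intro ext vector_derivative_at bounded_linear.has_vector_derivative[OF bounded_linear_scaleR_right]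
        smooth_on_has_vector_derivative assms)
qed

lemma sol_scale: "linear A \<Longrightarrow> u \<in> solution_space f A \<Longrightarrow> (\<lambda>t. c *\<^sub>R u t) \<in> solution_space f A"
  using tderiv_scale[of u c, THEN fun_cong]
  by (simp add: solution_space_def smooth_on_scaleR smooth_on_const linear_scale algebra_simps)

lemma sol_sum:
  assumes "linear A" "\<And>i. i \<in> I \<Longrightarrow> u i \<in> solution_space f A"
  shows "(\<lambda>t. \<Sum>i\<in>I. c i *\<^sub>R u i t) \<in> solution_space f A"
  using assms(2)
  by (induction I rule: infinite_finite_induct) (auto simp: sol_zero assms(1) intro!: sol_add sol_scale assms(1))

lemma tderiv_sum:
  assumes "\<And>i. i \<in> I \<Longrightarrow> smooth_on UNIV (u i)"
  shows "tderiv (\<lambda>t. \<Sum>i\<in>I. c i *\<^sub>R u i t) t = (\<Sum>i\<in>I. c i *\<^sub>R tderiv (u i) t)"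
  by (intro vector_derivative_at has_vector_derivative_sum smooth_on_has_vector_derivative assms
      bounded_linear.has_vector_derivative[OF bounded_linear_scaleR_right])

text \<open>A Gronwall estimate: \<open>E = u \<bullet> u + u' \<bullet> u'\<close> satisfies \<open>\<bar>E'\<bar> \<le> C * E\<close> on the interval between \<open>t0\<close>
  and \<open>t\<close>, hence \<open>E\<close>, damped by a suitable exponential, is monotone on either side of \<open>t0\<close>.\<close>

lemma solution_unique:
  assumes f: "smooth_on UNIV f" and A: "linear A" and u: "u \<in> solution_space f A"
    and init: "u t0 = 0" "tderiv u t0 = 0"
  shows "u t = 0"
proof -
  have su: "smooth_on UNIV u" using u by (simp add: solution_space_def)
  obtain K where K: "\<And>v. norm (A v) \<le> norm v * K" "K > 0"
    using linear_conv_bounded_linear[of A] A bounded_linear.pos_bounded by metis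
  define r where "r = \<bar>t - t0\<bar>"
  have "compact (f ` cball t0 r)"
    by (intro compact_continuous_image continuous_on_subset[OF smooth_on_continuous[OF f]]) auto
  then obtain F where F: "\<And>x. x \<in> cball t0 r \<Longrightarrow> \<bar>f x\<bar> \<le> F"
    using compact_imp_bounded bounded_iff by (metis image_eqI real_norm_def)
  define C where "C = 1 + F + K"
  define E where "E x = u x \<bullet> u x + tderiv u x \<bullet> tderiv u x" for x
  define E' where "E' x = 2 * (u x \<bullet> tderiv u x + tderiv u x \<bullet> (f x *\<^sub>R u x + A (u x)))" for x
  have dE: "(E has_real_derivative E' x) (at x)" for x
  proof -
    have d1: "(u has_vector_derivative tderiv u x) (at x)"
      and d2: "(tderiv u has_vector_derivative (f x *\<^sub>R u x + A (u x))) (at x)"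
      using smooth_on_has_vector_derivative[OF su, of x] u by (simp_all add: solution_space_def)
    have "(E has_vector_derivative (u x \<bullet> tderiv u x + tderiv u x \<bullet> u x) +
        (tderiv u x \<bullet> (f x *\<^sub>R u x + A (u x)) + (f x *\<^sub>R u x + A (u x)) \<bullet> tderiv u x)) (at x)"
      unfolding E_def
      by (intro has_vector_derivative_add bounded_bilinear.has_vector_derivative[OF bounded_bilinear_inner] d1 d2)
    then show ?thesis
      unfolding has_real_derivative_iff_has_vector_derivative E'_def by (simp add: inner_commute)
  qed
  have bd: "\<bar>E' x\<bar> \<le> C * E x" if x: "x \<in> cball t0 r" for x
  proof -
    let ?a = "norm (u x)" and ?b = "norm (tderiv u x)"
    have "\<bar>u x \<bullet> tderiv u x + tderiv u x \<bullet> (f x *\<^sub>R u x + A (u x))\<bar>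
        \<le> \<bar>u x \<bullet> tderiv u x\<bar> + \<bar>tderiv u x \<bullet> (f x *\<^sub>R u x + A (u x))\<bar>" by linarith
    also have "\<dots> \<le> ?a * ?b + ?b * norm (f x *\<^sub>R u x + A (u x))"
      by (intro add_mono Cauchy_Schwarz_ineq2)
    also have "norm (f x *\<^sub>R u x + A (u x)) \<le> F * ?a + ?a * K"
    proof (rule order_trans[OF norm_triangle_ineq], rule add_mono)
      show "norm (f x *\<^sub>R u x) \<le> F * ?a" using F[OF x] by (simp add: mult_right_mono)
    qed (rule K)
    finally have "\<bar>u x \<bullet> tderiv u x + tderiv u x \<bullet> (f x *\<^sub>R u x + A (u x))\<bar> \<le> ?a * ?b + ?b * (F * ?a + ?a * K)"
      by (simp add: mult_left_mono)
    then have "\<bar>E' x\<bar> \<le> C * (2 * ?a * ?b)" by (simp add: E'_def C_def algebra_simps abs_mult)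
    also have "\<dots> \<le> C * E x"
    proof (rule mult_left_mono)
      show "2 * ?a * ?b \<le> E x" using sum_squares_bound[of ?a ?b] by (simp add: E_def dot_square_norm)
      show "0 \<le> C" using K(2) F[OF x] by (simp add: C_def)
    qed
    finally show ?thesis .
  qed
  have E0: "E t0 = 0" by (simp add: E_def init)
  have "E t \<le> 0"
  proof (cases "t0 \<le> t")
    case True
    have "exp (- C * t) * E t \<le> exp (- C * t0) * E t0"
    proof (rule DERIV_nonpos_imp_nonincreasing[OF True])
      fix x assume x: "t0 \<le> x" "x \<le> t"
      then have "x \<in> cball t0 r" by (simp add: r_def dist_real_def)
      then have "E' x - C * E x \<le> 0" using bd[of x] by linarith
      moreover have "((\<lambda>x. exp (- C * x) * E x) has_real_derivative exp (- C * x) * (E' x - C * E x)) (at x)"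
        by (auto intro!: derivative_eq_intros dE simp: algebra_simps)
      ultimately show "\<exists>y. ((\<lambda>x. exp (- C * x) * E x) has_real_derivative y) (at x) \<and> y \<le> 0"
        by (meson exp_ge_zero mult_nonneg_nonpos)
    qed
    then show ?thesis using E0 by (simp add: mult_le_0_iff)
  next
    case False
    then have le: "t \<le> t0" by simp
    have "exp (C * t) * E t \<le> exp (C * t0) * E t0"
    proof (rule DERIV_nonneg_imp_nondecreasing[OF le])
      fix x assume x: "t \<le> x" "x \<le> t0"
      then have "x \<in> cball t0 r" by (simp add: r_def dist_real_def)
      then have "0 \<le> E' x + C * E x" using bd[of x] by linarith
      moreover have "((\<lambda>x. exp (C * x) * E x) has_real_derivative exp (C * x) * (E' x + C * E x)) (at x)"
        by (auto intro!: derivative_eq_intros dE simp: algebra_simps)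
      ultimately show "\<exists>y. ((\<lambda>x. exp (C * x) * E x) has_real_derivative y) (at x) \<and> 0 \<le> y"
        by (meson exp_ge_zero mult_nonneg_nonneg)
    qed
    then show ?thesis using E0 by (simp add: mult_le_0_iff)
  qed
  moreover have "0 \<le> u t \<bullet> u t" "0 \<le> tderiv u t \<bullet> tderiv u t" by simp_all
  ultimately have "u t \<bullet> u t = 0" unfolding E_def by linarith
  then show ?thesis by simp
qed

section \<open>Discrete groups acting on the slices\<close>

text \<open>The action of \<open>(0, q, u)\<close> on the slice at \<open>t\<close>, in the coordinates \<open>(s, v)\<close>.\<close>

definition slice_act :: "('v::euclidean_space \<Rightarrow> 'v \<Rightarrow> real) \<Rightarrow> real \<Rightarrow> real \<times> (real \<Rightarrow> 'v) \<Rightarrow> real \<times> 'v \<Rightarrow> real \<times> 'v" where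
  "slice_act ip t \<sigma> y = (fst y + fst \<sigma> - ip (tderiv (snd \<sigma>) t) (2 *\<^sub>R snd y + snd \<sigma> t), snd y + snd \<sigma> t)"

text \<open>\<open>Sg\<close> stands for the group \<open>\<Sigma>\<close>, without the zero component.  Of the geometry only two facts are kept:
  on every slice only finitely many elements move a given compact set so that it meets itself, and the
  slice at \<open>0\<close> is covered by the translates of a compact set.\<close>

locale slice_group =
  fixes f :: "real \<Rightarrow> real" and ip :: "'v::euclidean_space \<Rightarrow> 'v \<Rightarrow> real" and A :: "'v \<Rightarrow> 'v"
    and Sg :: "(real \<times> (real \<Rightarrow> 'v)) set"
  assumes f: "smooth_on UNIV f" and ip: "pseudo_euclidean ip"
    and A: "linear A" "\<forall>v w. ip (A v) w = ip v (A w)"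
    and sol: "\<sigma> \<in> Sg \<Longrightarrow> snd \<sigma> \<in> solution_space f A"
    and one: "(0, \<lambda>t. 0) \<in> Sg"
    and mul: "\<sigma> \<in> Sg \<Longrightarrow> \<sigma>' \<in> Sg \<Longrightarrow>
      (fst \<sigma> + fst \<sigma>' - Omega ip (snd \<sigma>) (snd \<sigma>'), \<lambda>t. snd \<sigma> t + snd \<sigma>' t) \<in> Sg"
    and inv: "\<sigma> \<in> Sg \<Longrightarrow> (- fst \<sigma>, \<lambda>t. - snd \<sigma> t) \<in> Sg"
    and proper: "compact C \<Longrightarrow> finite {\<sigma> \<in> Sg. \<exists>y\<in>C. slice_act ip t \<sigma> y \<in> C}"
    and cocompact: "\<exists>C. compact C \<and> (\<forall>y. \<exists>\<sigma>\<in>Sg. \<exists>y'\<in>C. y = slice_act ip 0 \<sigma> y')"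
begin

sublocale ip: bounded_bilinear ip using pseudo_euclidean_bounded_bilinear[OF ip] .

lemma ip_sym: "ip v w = ip w v" using ip by (simp add: pseudo_euclidean_def)

lemma smooth_sol: "u \<in> solution_space f A \<Longrightarrow> smooth_on UNIV u" by (simp add: solution_space_def)

lemma Omega_skew: "Omega ip u w = - Omega ip w u" by (simp add: Omega_def ip_sym[of "u 0"] ip_sym[of "w 0"])

lemma Omega_self: "Omega ip u u = 0" by (simp add: Omega_def ip_sym[of "u 0"])

lemma Omega_zero: "Omega ip u (\<lambda>t. 0) = 0" by (simp add: Omega_def ip.zero_right)

lemma Omega_scale: "u \<in> solution_space f A \<Longrightarrow> Omega ip w (\<lambda>t. c *\<^sub>R u t) = c * Omega ip w u"
  using tderiv_scale(1)[OF smooth_sol, THEN fun_cong, of u c 0]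
  by (simp add: Omega_def ip.scaleR_right algebra_simps)

lemma int_power:
  assumes "\<sigma> \<in> Sg" shows "(of_int n * fst \<sigma>, \<lambda>t. of_int n *\<^sub>R snd \<sigma> t) \<in> Sg"
proof -
  have nat: "(of_nat k * fst \<sigma>, \<lambda>t. of_nat k *\<^sub>R snd \<sigma> t) \<in> Sg" for k
  proof (induction k)
    case 0
    then show ?case using one by simp
  next
    case (Suc k)
    have "(\<lambda>t. snd \<sigma> t + real k *\<^sub>R snd \<sigma> t) = (\<lambda>t. real (Suc k) *\<^sub>R snd \<sigma> t)"
      by (simp add: algebra_simps)
    moreover have "fst \<sigma> + real k * fst \<sigma> = real (Suc k) * fst \<sigma>" by (simp add: algebra_simps)
    ultimately show ?case
      using mul[OF assms Suc] by (simp only: fst_conv snd_conv Omega_scale[OF sol[OF assms]] Omega_self) simp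
  qed
  show ?thesis
  proof (cases "n \<ge> 0")
    case True
    then show ?thesis using nat[of "nat n"] by simp
  next
    case False
    then show ?thesis using inv[OF nat[of "nat (- n)"]] by simp
  qed
qed

text \<open>The first component of the product of powers is in general spoiled by quadratic terms in the
  exponents \<open>n i\<close>; they vanish when \<open>\<Omega>\<close> does.\<close>

lemma int_combination:
  assumes "finite I" "\<And>i. i \<in> I \<Longrightarrow> \<sigma> i \<in> Sg"
  shows "\<exists>q. (q, \<lambda>t. \<Sum>i\<in>I. of_int (n i) *\<^sub>R snd (\<sigma> i) t) \<in> Sg \<and>
    ((\<forall>\<sigma>\<in>Sg. \<forall>\<sigma>'\<in>Sg. Omega ip (snd \<sigma>) (snd \<sigma>') = 0) \<longrightarrow> q = (\<Sum>i\<in>I. of_int (n i) * fst (\<sigma> i)))"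
  using assms
proof (induction I)
  case empty
  then show ?case using one by (intro exI[of _ 0]) simp
next
  case (insert i I)
  then obtain q where q: "(q, \<lambda>t. \<Sum>i\<in>I. of_int (n i) *\<^sub>R snd (\<sigma> i) t) \<in> Sg"
    "(\<forall>\<sigma>\<in>Sg. \<forall>\<sigma>'\<in>Sg. Omega ip (snd \<sigma>) (snd \<sigma>') = 0) \<longrightarrow> q = (\<Sum>i\<in>I. of_int (n i) * fst (\<sigma> i))"
    by auto
  have i: "\<sigma> i \<in> Sg" using insert by simp
  show ?case
    using mul[OF int_power[OF i, of "n i"] q(1)] q int_power[OF i, of "n i"] insert(1,2)
    by (intro exI conjI impI, simp) fastforce
qed

text \<open>Commutators are central, so a nonzero value of \<open>\<Omega>\<close> puts a translation in the \<open>s\<close> direction into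
  the group.\<close>

lemma commutator:
  assumes "\<sigma> \<in> Sg" "\<sigma>' \<in> Sg" shows "(- 2 * Omega ip (snd \<sigma>) (snd \<sigma>'), \<lambda>t. 0) \<in> Sg"
proof -
  let ?z = "\<lambda>t. snd \<sigma> t + snd \<sigma>' t" and ?z' = "\<lambda>t. snd \<sigma>' t + snd \<sigma> t"
  have z: "?z \<in> solution_space f A" using mul[OF assms] sol by fastforce
  have zz: "?z' = ?z" by (simp add: add.commute)
  have "Omega ip ?z (\<lambda>t. - ?z' t) = 0"
    using Omega_scale[OF z, of ?z "-1"] Omega_self[of ?z] unfolding fun_cong[OF zz] by simp
  then show ?thesis
    using mul[OF mul[OF assms] inv[OF mul[OF assms(2,1)]]] Omega_skew[of "snd \<sigma>'" "snd \<sigma>"] by simp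
qed

text \<open>Rounding the coefficients of \<open>N\<close> times a real combination gives a group element.  Its first component
  stays within a bounded distance of a multiple \<open>N * q0\<close>: if \<open>\<Omega>\<close> vanishes on the group, this component is
  additive; otherwise a central translation by \<open>k\<close> is available, and the component can be reduced modulo
  \<open>k\<close>, with \<open>q0 = 0\<close>.\<close>

lemma bounded_error:
  assumes I: "finite I" "\<And>i. i \<in> I \<Longrightarrow> \<sigma> i \<in> Sg"
  shows "\<exists>q0 R. \<forall>N. \<exists>q. (q, \<lambda>t. \<Sum>i\<in>I. of_int \<lfloor>real N * c i\<rfloor> *\<^sub>R snd (\<sigma> i) t) \<in> Sg \<and> \<bar>q - real N * q0\<bar> \<le> R"
proof (cases "\<forall>\<sigma>\<in>Sg. \<forall>\<sigma>'\<in>Sg. Omega ip (snd \<sigma>) (snd \<sigma>') = 0")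
  case True
  show ?thesis
  proof (rule exI[of _ "\<Sum>i\<in>I. c i * fst (\<sigma> i)"], rule exI[of _ "\<Sum>i\<in>I. \<bar>fst (\<sigma> i)\<bar>"], rule allI)
    fix N
    let ?q = "\<Sum>i\<in>I. of_int \<lfloor>real N * c i\<rfloor> * fst (\<sigma> i)"
    have "(?q, \<lambda>t. \<Sum>i\<in>I. of_int \<lfloor>real N * c i\<rfloor> *\<^sub>R snd (\<sigma> i) t) \<in> Sg"
      using int_combination[of I \<sigma> "\<lambda>i. \<lfloor>real N * c i\<rfloor>", OF I] True by auto
    moreover have "\<bar>?q - real N * (\<Sum>i\<in>I. c i * fst (\<sigma> i))\<bar> \<le> (\<Sum>i\<in>I. \<bar>fst (\<sigma> i)\<bar>)"
    proof -
      have "?q - real N * (\<Sum>i\<in>I. c i * fst (\<sigma> i)) = (\<Sum>i\<in>I. (of_int \<lfloor>real N * c i\<rfloor> - real N * c i) * fst (\<sigma> i))"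
        by (simp add: sum_distrib_left sum_subtractf algebra_simps)
      also have "\<bar>\<dots>\<bar> \<le> (\<Sum>i\<in>I. \<bar>(of_int \<lfloor>real N * c i\<rfloor> - real N * c i) * fst (\<sigma> i)\<bar>)" by (rule sum_abs)
      also have "\<dots> \<le> (\<Sum>i\<in>I. \<bar>fst (\<sigma> i)\<bar>)"
      proof (rule sum_mono)
        fix i
        have "\<bar>of_int \<lfloor>real N * c i\<rfloor> - real N * c i\<bar> \<le> 1" by linarith
        then show "\<bar>(of_int \<lfloor>real N * c i\<rfloor> - real N * c i) * fst (\<sigma> i)\<bar> \<le> \<bar>fst (\<sigma> i)\<bar>"
          by (simp add: abs_mult mult_left_le_one_le)
      qed
      finally show ?thesis .
    qed
    ultimately show "\<exists>q. (q, \<lambda>t. \<Sum>i\<in>I. of_int \<lfloor>real N * c i\<rfloor> *\<^sub>R snd (\<sigma> i) t) \<in> Sg \<and>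
      \<bar>q - real N * (\<Sum>i\<in>I. c i * fst (\<sigma> i))\<bar> \<le> (\<Sum>i\<in>I. \<bar>fst (\<sigma> i)\<bar>)" by blast
  qed
next
  case False
  then obtain \<sigma>1 \<sigma>2 where "\<sigma>1 \<in> Sg" "\<sigma>2 \<in> Sg" and ne: "Omega ip (snd \<sigma>1) (snd \<sigma>2) \<noteq> 0" by blast
  define k where "k = - 2 * Omega ip (snd \<sigma>1) (snd \<sigma>2)"
  have k: "(k, \<lambda>t. 0) \<in> Sg" "k \<noteq> 0"
    using commutator[OF \<open>\<sigma>1 \<in> Sg\<close> \<open>\<sigma>2 \<in> Sg\<close>] ne by (simp_all add: k_def)
  show ?thesis
  proof (rule exI[of _ 0], rule exI[of _ "\<bar>k\<bar>"], rule allI)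
    fix N
    let ?u = "\<lambda>t. \<Sum>i\<in>I. of_int \<lfloor>real N * c i\<rfloor> *\<^sub>R snd (\<sigma> i) t"
    obtain q where q: "(q, ?u) \<in> Sg"
      using int_combination[of I \<sigma> "\<lambda>i. \<lfloor>real N * c i\<rfloor>", OF I] by auto
    have "(q + of_int (- \<lfloor>q / k\<rfloor>) * k, ?u) \<in> Sg"
      using mul[OF q int_power[OF k(1), of "- \<lfloor>q / k\<rfloor>"]] Omega_zero[of ?u] by simp
    moreover have "\<bar>q + of_int (- \<lfloor>q / k\<rfloor>) * k\<bar> \<le> \<bar>k\<bar>"
    proof -
      have "q + of_int (- \<lfloor>q / k\<rfloor>) * k = (q / k - of_int \<lfloor>q / k\<rfloor>) * k" using k(2) by (simp add: field_simps)
      moreover have "\<bar>q / k - of_int \<lfloor>q / k\<rfloor>\<bar> \<le> 1" by linarith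
      ultimately show ?thesis by (simp add: abs_mult mult_left_le_one_le)
    qed
    ultimately show "\<exists>q. (q, ?u) \<in> Sg \<and> \<bar>q - real N * 0\<bar> \<le> \<bar>k\<bar>" by auto
  qed
qed

text \<open>The heart of the proof: evaluation at any time \<open>t\<close> is injective on the span of the solutions that
  occur in the group.  Suppose that \<open>u\<close> in the span is nonzero but \<open>u t = 0\<close>; then \<open>u' t \<noteq> 0\<close> by uniqueness.
  The group elements close to \<open>N * u\<close> act on the slice at \<open>t\<close> by \<open>v \<mapsto> v + l\<close> with \<open>l\<close> bounded, while the
  shift of \<open>s\<close> is \<open>N * q0\<close> minus \<open>ip (N u' t) (2 v + l)\<close>, up to bounded terms.  At the points with
  \<open>v = v0 - l / 2\<close>, where \<open>2 * ip (u' t) v0 = q0\<close>, the large terms cancel.  So infinitely many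
  group elements bring a compact set back to itself, which discreteness forbids.\<close>

lemma combination_vanishes:
  assumes I: "finite I" "\<And>i. i \<in> I \<Longrightarrow> \<sigma> i \<in> Sg"
    and z: "(\<Sum>i\<in>I. c i *\<^sub>R snd (\<sigma> i) t) = 0"
  shows "(\<Sum>i\<in>I. c i *\<^sub>R snd (\<sigma> i) \<tau>) = 0"
proof (rule ccontr)
  assume ne: "(\<Sum>i\<in>I. c i *\<^sub>R snd (\<sigma> i) \<tau>) \<noteq> 0"
  define u where "u = (\<lambda>t. \<Sum>i\<in>I. c i *\<^sub>R snd (\<sigma> i) t)"
  have solI: "snd (\<sigma> i) \<in> solution_space f A" if "i \<in> I" for i using sol I(2)[OF that] by blast
  have u: "u \<in> solution_space f A" unfolding u_def by (rule sol_sum[OF A(1) solI])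
  have du: "tderiv u t = (\<Sum>i\<in>I. c i *\<^sub>R tderiv (snd (\<sigma> i)) t)"
    unfolding u_def by (rule tderiv_sum) (rule smooth_sol[OF solI])
  have ut: "u t = 0" "u \<tau> \<noteq> 0" using z ne by (simp_all add: u_def)
  then have w: "tderiv u t \<noteq> 0" using solution_unique[OF f A(1) u, of t \<tau>] by blast
  obtain q0 R where qR: "\<And>N. \<exists>q. (q, \<lambda>t. \<Sum>i\<in>I. of_int \<lfloor>real N * c i\<rfloor> *\<^sub>R snd (\<sigma> i) t) \<in> Sg \<and> \<bar>q - real N * q0\<bar> \<le> R"
    using bounded_error[where c=c and \<sigma>=\<sigma>, OF I] by blast
  obtain v0 where v0: "2 * ip (tderiv u t) v0 = q0"
  proof -
    obtain v1 where "ip (tderiv u t) v1 \<noteq> 0" using w ip unfolding pseudo_euclidean_def by blast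
    then show ?thesis using that[of "(q0 / (2 * ip (tderiv u t) v1)) *\<^sub>R v1"] by (simp add: ip.scaleR_right)
  qed
  obtain K where K: "\<And>x y. norm (ip x y) \<le> norm x * norm y * K" "0 \<le> K" using ip.nonneg_bounded by blast
  let ?n = "\<lambda>N i. of_int \<lfloor>real N * c i\<rfloor> :: real"
  let ?l = "\<lambda>N t. \<Sum>i\<in>I. ?n N i *\<^sub>R snd (\<sigma> i) t"
  have err: "norm ((\<Sum>i\<in>I. ?n N i *\<^sub>R x i) - real N *\<^sub>R (\<Sum>i\<in>I. c i *\<^sub>R x i)) \<le> (\<Sum>i\<in>I. norm (x i))" for N and x :: "'a \<Rightarrow> 'v"
  proof -
    have "(\<Sum>i\<in>I. ?n N i *\<^sub>R x i) - real N *\<^sub>R (\<Sum>i\<in>I. c i *\<^sub>R x i) = (\<Sum>i\<in>I. (?n N i - real N * c i) *\<^sub>R x i)"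
      by (simp add: scaleR_sum_right sum_subtractf algebra_simps)
    also have "norm \<dots> \<le> (\<Sum>i\<in>I. norm (x i))"
    proof (rule order_trans[OF norm_sum], rule sum_mono)
      fix i
      have "\<bar>?n N i - real N * c i\<bar> \<le> 1" by linarith
      then show "norm ((?n N i - real N * c i) *\<^sub>R x i) \<le> norm (x i)" by (simp add: mult_left_le_one_le)
    qed
    finally show ?thesis .
  qed
  define B1 where "B1 = (\<Sum>i\<in>I. norm (snd (\<sigma> i) t))"
  define B2 where "B2 = (\<Sum>i\<in>I. norm (tderiv (snd (\<sigma> i)) t))"
  define C where "C = cball (0::real) (R + B2 * norm (2 *\<^sub>R v0) * K) \<times> (cball 0 (norm v0 + B1) :: 'v set)"
  define Fin where "Fin = {\<sigma> \<in> Sg. \<exists>y\<in>C. slice_act ip t \<sigma> y \<in> C}"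
  have "finite Fin" unfolding Fin_def by (rule proper) (simp add: C_def compact_Times)
  have inFin: "\<exists>q. (q, ?l N) \<in> Fin" for N
  proof -
    obtain q where q: "(q, ?l N) \<in> Sg" "\<bar>q - real N * q0\<bar> \<le> R" using qR by blast
    have lt: "norm (?l N t) \<le> B1" using err[of N "\<lambda>i. snd (\<sigma> i) t"] z by (simp add: B1_def)
    have dl: "tderiv (?l N) t = (\<Sum>i\<in>I. ?n N i *\<^sub>R tderiv (snd (\<sigma> i)) t)"
      by (rule tderiv_sum) (rule smooth_sol[OF solI])
    define e where "e = tderiv (?l N) t - real N *\<^sub>R tderiv u t"
    have e: "norm e \<le> B2" unfolding e_def dl du B2_def by (rule err)
    have B: "0 \<le> B1" "0 \<le> B2" by (simp_all add: B1_def B2_def sum_nonneg)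
    have R: "0 \<le> R" using q(2) by linarith
    define y where "y = (0::real, v0 - (1/2) *\<^sub>R ?l N t)"
    have half: "norm ((1/2) *\<^sub>R ?l N t) \<le> B1" using lt B by simp
    have "ip (tderiv (?l N) t) (2 *\<^sub>R v0) = real N * q0 + ip e (2 *\<^sub>R v0)"
      using v0 by (simp add: e_def ip.diff_left ip.scaleR_left ip.scaleR_right algebra_simps)
    moreover have "2 *\<^sub>R snd y + ?l N t = 2 *\<^sub>R v0" by (simp add: y_def scaleR_diff_right)
    moreover have "v0 - (1/2) *\<^sub>R x + x = v0 + (1/2) *\<^sub>R x" for x :: 'v
    proof -
      have "(1/2) *\<^sub>R x + (1/2) *\<^sub>R x = x" by (simp add: scaleR_left_distrib[symmetric])
      moreover have "v0 - h + (h + h) = v0 + h" for h :: 'v by simp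
      ultimately show ?thesis by metis
    qed
    ultimately have act: "slice_act ip t (q, ?l N) y = (q - real N * q0 - ip e (2 *\<^sub>R v0), v0 + (1/2) *\<^sub>R ?l N t)"
      unfolding slice_act_def prod.sel by (simp add: y_def)
    have "\<bar>ip e (2 *\<^sub>R v0)\<bar> \<le> B2 * norm (2 *\<^sub>R v0) * K"
      using K(1)[of e "2 *\<^sub>R v0"] e K(2) by (simp only: real_norm_def) (meson mult_right_mono norm_ge_zero order_trans)
    then have "\<bar>q - real N * q0 - ip e (2 *\<^sub>R v0)\<bar> \<le> R + B2 * norm (2 *\<^sub>R v0) * K" using q(2) by linarith
    moreover have "norm (v0 + (1/2) *\<^sub>R ?l N t) \<le> norm v0 + B1" "norm (v0 - (1/2) *\<^sub>R ?l N t) \<le> norm v0 + B1"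
      using norm_triangle_ineq[of v0 "(1/2) *\<^sub>R ?l N t"] norm_triangle_ineq4[of v0 "(1/2) *\<^sub>R ?l N t"] half by linarith+
    ultimately have "slice_act ip t (q, ?l N) y \<in> C" "y \<in> C"
      unfolding act using R B K(2) by (simp_all add: C_def y_def)
    then show ?thesis using q(1) unfolding Fin_def by blast
  qed
  have "bounded ((\<lambda>\<sigma>. snd \<sigma> \<tau>) ` Fin)" using \<open>finite Fin\<close> by (simp add: finite_imp_bounded)
  then obtain B where B: "\<And>\<sigma>. \<sigma> \<in> Fin \<Longrightarrow> norm (snd \<sigma> \<tau>) \<le> B" by (auto simp: bounded_iff)
  have "real N * norm (u \<tau>) \<le> B + (\<Sum>i\<in>I. norm (snd (\<sigma> i) \<tau>))" for N
  proof -
    have "norm (?l N \<tau>) \<le> B" using inFin[of N] B by fastforce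
    moreover have "norm (?l N \<tau> - real N *\<^sub>R u \<tau>) \<le> (\<Sum>i\<in>I. norm (snd (\<sigma> i) \<tau>))" unfolding u_def by (rule err)
    moreover have "norm (real N *\<^sub>R u \<tau>) \<le> norm (?l N \<tau>) + norm (?l N \<tau> - real N *\<^sub>R u \<tau>)"
      using norm_triangle_ineq4[of "?l N \<tau>" "?l N \<tau> - real N *\<^sub>R u \<tau>"] by simp
    ultimately show ?thesis by simp
  qed
  then show False
    using ut(2) reals_Archimedean3[of "norm (u \<tau>)"] by (metis not_less zero_less_norm_iff)
qed

text \<open>Otherwise some nonzero linear functional of \<open>v\<close> would be invariant on the slice at \<open>0\<close>, and unbounded
  although the quotient is compact.\<close>

lemma values_span: "span ((\<lambda>\<sigma>. snd \<sigma> 0) ` Sg) = UNIV"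
proof (rule ccontr)
  assume "span ((\<lambda>\<sigma>. snd \<sigma> 0) ` Sg) \<noteq> UNIV"
  then obtain a where a: "a \<noteq> 0" "\<And>x. x \<in> span ((\<lambda>\<sigma>. snd \<sigma> 0) ` Sg) \<Longrightarrow> orthogonal a x"
    using orthogonal_to_subspace_exists_gen[of "(\<lambda>\<sigma>. snd \<sigma> 0) ` Sg" UNIV] by (metis span_UNIV psubsetI subset_UNIV)
  obtain C where C: "compact C" "\<And>y. \<exists>\<sigma>\<in>Sg. \<exists>y'\<in>C. y = slice_act ip 0 \<sigma> y'" using cocompact by blast
  have "bounded ((\<lambda>y. a \<bullet> snd y) ` C)"
    by (intro compact_imp_bounded compact_continuous_image C continuous_intros)
  then obtain B where B: "\<And>y. y \<in> C \<Longrightarrow> \<bar>a \<bullet> snd y\<bar> \<le> B" by (auto simp: bounded_iff)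
  have "real N * (a \<bullet> a) \<le> B" for N
  proof -
    obtain \<sigma> y where \<sigma>: "\<sigma> \<in> Sg" "y \<in> C" "(0, real N *\<^sub>R a) = slice_act ip 0 \<sigma> y" using C(2) by blast
    then have "real N *\<^sub>R a = snd y + snd \<sigma> 0" by (simp add: slice_act_def)
    then have "real N * (a \<bullet> a) = a \<bullet> snd y + a \<bullet> snd \<sigma> 0" by (metis inner_add_right inner_scaleR_right)
    also have "a \<bullet> snd \<sigma> 0 = 0" using a(2)[of "snd \<sigma> 0"] \<sigma>(1) by (simp add: orthogonal_def span_base)
    finally show ?thesis using B[OF \<sigma>(2)] by linarith
  qed
  then show False using reals_Archimedean3[of "a \<bullet> a"] a(1) by (metis inner_gt_zero_iff not_less)
qed

text \<open>By the last two lemmas, \<open>w \<mapsto> U w t\<close> is an isomorphism for every \<open>t\<close>: choosing group elements whose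
  values at \<open>0\<close> form a basis, \<open>U w\<close> is the combination of their solutions that takes the value \<open>w\<close> at \<open>0\<close>.\<close>

lemma solution_family:
  obtains U :: "'v \<Rightarrow> real \<Rightarrow> 'v"
  where "\<And>w. U w \<in> solution_space f A" "\<And>t. linear (\<lambda>w. U w t)" "\<And>w. U w 0 = w" "\<And>t. bij (\<lambda>w. U w t)"
    "\<And>\<sigma> t. \<sigma> \<in> Sg \<Longrightarrow> U (snd \<sigma> 0) t = snd \<sigma> t"
proof -
  obtain B where B: "B \<subseteq> (\<lambda>\<sigma>. snd \<sigma> 0) ` Sg" "independent B" "(\<lambda>\<sigma>. snd \<sigma> 0) ` Sg \<subseteq> span B"
    using maximal_independent_subset by blast
  have spB: "span B = UNIV" using B(3) values_span by (metis span_minimal subspace_span top.extremum_uniqueI)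
  have finB: "finite B" using B(2) by (rule independent_imp_finite)
  have "\<forall>b\<in>B. \<exists>\<sigma>\<in>Sg. snd \<sigma> 0 = b" using B(1) by auto
  then obtain \<sigma> where \<sigma>: "\<And>b. b \<in> B \<Longrightarrow> \<sigma> b \<in> Sg" "\<And>b. b \<in> B \<Longrightarrow> snd (\<sigma> b) 0 = b" by metis
  define U where "U w t = (\<Sum>b\<in>B. representation B w b *\<^sub>R snd (\<sigma> b) t)" for w t
  have U0: "U w 0 = w" for w
    unfolding U_def using sum_representation_eq[OF B(2), of w B] spB finB \<sigma>(2) by simp
  have lin: "linear (\<lambda>w. U w t)" for t
    by (rule linearI) (simp_all add: U_def representation_add[OF B(2)] representation_scale[OF B(2)] spB
        scaleR_left_distrib sum.distrib scaleR_sum_right)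
  show ?thesis
  proof (rule that[of U])
    show "U w \<in> solution_space f A" for w
      unfolding U_def[abs_def] by (rule sol_sum[OF A(1)]) (use sol \<sigma>(1) in blast)
    show "linear (\<lambda>w. U w t)" for t by (rule lin)
    show "U w 0 = w" for w by (rule U0)
    show "bij (\<lambda>w. U w t)" for t
    proof -
      have "inj (\<lambda>w. U w t)"
        unfolding linear_injective_0[OF lin]
      proof (intro allI impI)
        fix w assume "U w t = 0"
        then show "w = 0" using combination_vanishes[where c="representation B w" and t=t and \<tau>=0 and \<sigma>=\<sigma>, OF finB \<sigma>(1)] U0[of w] by (simp add: U_def)
      qed
      then show ?thesis using linear_injective_imp_surjective[OF lin] by (simp add: bij_def)
    qed
    show "U (snd \<rho> 0) t = snd \<rho> t" if \<rho>: "\<rho> \<in> Sg" for \<rho> t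
    proof -
      \<comment> \<open>Index the basis elements and \<open>\<rho>\<close> together, in case \<open>\<rho>\<close> is one of them.\<close>
      define s where "s i = (case i of None \<Rightarrow> \<rho> | Some b \<Rightarrow> \<sigma> b)" for i
      define c where "c i = (case i of None \<Rightarrow> -1 | Some b \<Rightarrow> representation B (snd \<rho> 0) b)" for i
      have sum: "(\<Sum>i\<in>insert None (Some ` B). c i *\<^sub>R snd (s i) \<tau>) = U (snd \<rho> 0) \<tau> - snd \<rho> \<tau>" for \<tau>
        using finB by (simp add: s_def c_def U_def sum.reindex)
      have "(\<Sum>i\<in>insert None (Some ` B). c i *\<^sub>R snd (s i) t) = 0"
      proof (rule combination_vanishes)
        show "(\<Sum>i\<in>insert None (Some ` B). c i *\<^sub>R snd (s i) 0) = 0" unfolding sum by (simp add: U0)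
      qed (use finB \<rho> \<sigma>(1) in \<open>auto simp: s_def\<close>)
      then show ?thesis unfolding sum by simp
    qed
  qed
qed

end

section \<open>Straightening the slices\<close>

lemma smooth_on_linear_family:
  fixes L :: "real \<Rightarrow> 'v::euclidean_space \<Rightarrow> 'w::real_normed_vector"
  assumes S: "open S" and lin: "\<And>t. linear (L t)" and L: "\<And>v. smooth_on UNIV (\<lambda>t. L t v)"
    and g: "smooth_on S g" and h: "smooth_on S h"
  shows "smooth_on S (\<lambda>x. L (g x) (h x))"
proof -
  have sm: "smooth_on S (\<lambda>x. \<Sum>b\<in>Basis. (h x \<bullet> b) *\<^sub>R L (g x) b)"
    by (intro smooth_on_sum smooth_on_scaleR S smooth_on_bounded_linear[OF S bounded_linear_inner_left h]
        smooth_on_compose[OF S open_UNIV _ g L]) simp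
  have rep: "L t v = (\<Sum>b\<in>Basis. (v \<bullet> b) *\<^sub>R L t b)" for t v
    by (subst (1) euclidean_representation[of v, symmetric]) (simp add: linear_sum[OF lin] linear_scale[OF lin])
  show ?thesis by (rule smooth_on_cong[OF S rep[symmetric] sm])
qed

text \<open>The family \<open>U\<close> allows the action on the slice at \<open>t\<close> to be conjugated into the action on the slice at
  \<open>0\<close>, smoothly in \<open>t\<close>.  The conjugation sends the image of \<open>(t, 0, 0)\<close> under \<open>(0, q, U w)\<close> to the image
  of \<open>(0, 0, 0)\<close> under the same element; all these \<open>(0, q, U w)\<close>, whether in the group or not, form a
  simply transitive group on each slice, and this explains the correction terms in the \<open>s\<close> coordinate.\<close>

locale slice_family = slice_group f ip A Sg
  for f and ip :: "'v::euclidean_space \<Rightarrow> 'v \<Rightarrow> real" and A and Sg +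
  fixes U :: "'v \<Rightarrow> real \<Rightarrow> 'v"
  assumes U_sol: "U w \<in> solution_space f A" and U_lin: "linear (\<lambda>w. U w t)" and U_0: "U w 0 = w"
    and U_bij: "bij (\<lambda>w. U w t)" and U_Sg: "\<sigma> \<in> Sg \<Longrightarrow> U (snd \<sigma> 0) t = snd \<sigma> t"
begin

definition U_inv :: "real \<Rightarrow> 'v \<Rightarrow> 'v" where
  "U_inv t = inv_into UNIV (\<lambda>w. U w t)"

definition straighten :: "real \<Rightarrow> real \<times> 'v \<Rightarrow> real \<times> 'v" where
  "straighten t y = (let w = U_inv t (snd y) in
     (fst y + ip (tderiv (U w) t) (snd y) - ip (tderiv (U w) 0) w, w))"

definition unstraighten :: "real \<Rightarrow> real \<times> 'v \<Rightarrow> real \<times> 'v" where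
  "unstraighten t y = (let w = snd y in
     (fst y - ip (tderiv (U w) t) (U w t) + ip (tderiv (U w) 0) w, U w t))"

lemma U_inverse [simp]: "U_inv t (U w t) = w" "U (U_inv t v) t = v"
proof -
  have "inj (\<lambda>w. U w t)" "v \<in> range (\<lambda>w. U w t)" using U_bij[of t] by (simp_all add: bij_def)
  then show "U_inv t (U w t) = w" "U (U_inv t v) t = v"
    unfolding U_inv_def using inv_into_f_f[of "\<lambda>w. U w t" UNIV w] f_inv_into_f[of v "\<lambda>w. U w t" UNIV] by simp_all
qed

lemma straighten_unstraighten: "straighten t (unstraighten t y) = y" "unstraighten t (straighten t y) = y"
  by (simp_all add: straighten_def unstraighten_def Let_def)

lemma U_add: "U (v + w) = (\<lambda>t. U v t + U w t)" using linear_add[OF U_lin] by fast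

lemma U_scale: "U (c *\<^sub>R w) = (\<lambda>t. c *\<^sub>R U w t)" using linear_scale[OF U_lin] by fast

lemma dU_lin: "linear (\<lambda>w. tderiv (U w) t)"
proof (rule linearI)
  show "tderiv (U (v + w)) t = tderiv (U v) t + tderiv (U w) t" for v w
    unfolding U_add by (rule fun_cong[OF tderiv_add(1)[OF smooth_sol[OF U_sol] smooth_sol[OF U_sol]]])
  show "tderiv (U (c *\<^sub>R w)) t = c *\<^sub>R tderiv (U w) t" for c w
    unfolding U_scale by (rule fun_cong[OF tderiv_scale(1)[OF smooth_sol[OF U_sol]]])
qed

text \<open>The terms left over on the two sides are the values of \<open>\<Omega>\<close> on \<open>U w\<close> and \<open>u\<close>, computed at \<open>t\<close> and
  at \<open>0\<close>.\<close>

lemma unstraighten_equivariant: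
  assumes \<sigma>: "\<sigma> \<in> Sg"
  shows "unstraighten t (slice_act ip 0 \<sigma> y) = slice_act ip t \<sigma> (unstraighten t y)"
proof -
  obtain q u s w where [simp]: "\<sigma> = (q, u)" "y = (s, w)" by (metis surj_pair)
  have u: "u \<in> solution_space f A" using sol[OF \<sigma>] by simp
  have Uwu: "U (w + u 0) = (\<lambda>t. U w t + u t)" using U_Sg[OF \<sigma>] by (simp add: U_add)
  have d: "tderiv (U (w + u 0)) \<tau> = tderiv (U w) \<tau> + tderiv u \<tau>" for \<tau>
    unfolding Uwu using tderiv_add(1)[OF smooth_sol[OF U_sol] smooth_sol[OF u], THEN fun_cong] .
  have "ip (tderiv (U w) t) (u t) - ip (U w t) (tderiv u t) = ip (tderiv (U w) 0) (u 0) - ip w (tderiv u 0)"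
    using Omega_eq[OF ip A(2) U_sol[of w] u, of t] by (simp add: Omega_def U_0)
  then show ?thesis
    using ip_sym[of "U w t" "tderiv u t"] ip_sym[of w "tderiv u 0"]
    by (simp add: unstraighten_def slice_act_def Let_def d ip.add_left ip.add_right ip.scaleR_right)
      (simp add: Uwu ip.add_left ip.add_right)
qed

lemma straighten_equivariant:
  assumes "\<sigma> \<in> Sg"
  shows "straighten t (slice_act ip t \<sigma> y) = slice_act ip 0 \<sigma> (straighten t y)"
  using unstraighten_equivariant[OF assms, of t "straighten t y"] straighten_unstraighten by metis

lemma smooth_U: "smooth_on UNIV (U w)" by (rule smooth_sol[OF U_sol])

lemma smooth_U_inv: "smooth_on UNIV (\<lambda>t. U_inv t v)"
  by (rule smooth_inverse_linear_family[of "\<lambda>t w. U w t"]) (use U_lin smooth_U in simp_all)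

lemma U_inv_lin: "linear (U_inv t)"
proof (rule linearI)
  show "U_inv t (x + y) = U_inv t x + U_inv t y" for x y
    using U_inverse(1)[of t "U_inv t x + U_inv t y"] by (simp add: U_add)
  show "U_inv t (r *\<^sub>R x) = r *\<^sub>R U_inv t x" for r x
    using U_inverse(1)[of t "r *\<^sub>R U_inv t x"] by (simp add: U_scale)
qed

lemma smooth_projections:
  "smooth_on UNIV (\<lambda>x::real \<times> real \<times> 'v. fst x)" "smooth_on UNIV (\<lambda>x::real \<times> real \<times> 'v. fst (snd x))"
  "smooth_on UNIV (\<lambda>x::real \<times> real \<times> 'v. snd (snd x))"
  by (rule smooth_on_bounded_linear[OF _ _ smooth_on_id]; intro open_UNIV bounded_linear_fst bounded_linear_snd
      bounded_linear_compose[OF bounded_linear_fst bounded_linear_snd]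
      bounded_linear_compose[OF bounded_linear_snd bounded_linear_snd])+

lemma smooth_dU: "smooth_on UNIV (tderiv (U w))"
  by (rule smooth_on_vector_derivative[OF smooth_U])

lemma smooth_straighten: "smooth_on UNIV (\<lambda>x. straighten (fst x) (snd x))"
proof -
  have w: "smooth_on UNIV (\<lambda>x::real \<times> real \<times> 'v. U_inv (fst x) (snd (snd x)))"
    by (rule smooth_on_linear_family[OF open_UNIV U_inv_lin smooth_U_inv smooth_projections(1,3)])
  have dU: "smooth_on UNIV (\<lambda>x::real \<times> real \<times> 'v. tderiv (U (U_inv (fst x) (snd (snd x)))) (fst x))"
    by (rule smooth_on_linear_family[OF open_UNIV dU_lin smooth_dU smooth_projections(1) w])
  have dU0: "smooth_on UNIV (\<lambda>x::real \<times> real \<times> 'v. tderiv (U (U_inv (fst x) (snd (snd x)))) 0)"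
    by (rule smooth_on_linear_family[OF open_UNIV dU_lin smooth_dU smooth_on_const w])
  show ?thesis
    unfolding straighten_def Let_def
    by (rule smooth_on_Pair[OF open_UNIV smooth_on_diff[OF open_UNIV smooth_on_plus[OF open_UNIV smooth_projections(2)
      smooth_on_bilinear[OF open_UNIV ip.bounded_bilinear_axioms dU smooth_projections(3)]]
      smooth_on_bilinear[OF open_UNIV ip.bounded_bilinear_axioms dU0 w]] w])
qed

lemma smooth_unstraighten: "smooth_on UNIV (\<lambda>x. unstraighten (fst x) (snd x))"
proof -
  have U: "smooth_on UNIV (\<lambda>x::real \<times> real \<times> 'v. U (snd (snd x)) (fst x))"
    by (rule smooth_on_linear_family[OF open_UNIV U_lin smooth_U smooth_projections(1,3)])
  have dU: "smooth_on UNIV (\<lambda>x::real \<times> real \<times> 'v. tderiv (U (snd (snd x))) (fst x))"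
    by (rule smooth_on_linear_family[OF open_UNIV dU_lin smooth_dU smooth_projections(1,3)])
  have dU0: "smooth_on UNIV (\<lambda>x::real \<times> real \<times> 'v. tderiv (U (snd (snd x))) 0)"
    by (rule smooth_on_linear_family[OF open_UNIV dU_lin smooth_dU smooth_on_const smooth_projections(3)])
  show ?thesis
    unfolding unstraighten_def Let_def
    by (rule smooth_on_Pair[OF open_UNIV smooth_on_plus[OF open_UNIV smooth_on_diff[OF open_UNIV smooth_projections(2)
      smooth_on_bilinear[OF open_UNIV ip.bounded_bilinear_axioms dU U]]
      smooth_on_bilinear[OF open_UNIV ip.bounded_bilinear_axioms dU0 smooth_projections(3)]] U])
qed

end

section \<open>Topological preliminaries\<close>

text \<open>The pairs \<open>(x, y)\<close> in \<open>C \<times> C\<close> in the same orbit form a compact set, because the quotient is Hausdorff.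
  Near each such pair only one group element can carry a first component to a second one, because \<open>\<pi>\<close> is
  locally injective.\<close>

lemma finite_returns:
  fixes \<pi> :: "'e::euclidean_space \<Rightarrow> 'm" and a :: "'g \<Rightarrow> 'e \<Rightarrow> 'e"
  assumes par: "param_on UNIV M \<pi>" and H: "Hausdorff_space (mtop M)"
    and cont: "\<And>g. g \<in> \<Gamma> \<Longrightarrow> continuous_on UNIV (a g)"
    and free: "\<And>g h x. g \<in> \<Gamma> \<Longrightarrow> h \<in> \<Gamma> \<Longrightarrow> a g x = a h x \<Longrightarrow> g = h"
    and orb: "\<And>x y. \<pi> y = \<pi> x \<longleftrightarrow> (\<exists>g\<in>\<Gamma>. y = a g x)"
    and C: "compact C"
  shows "finite {g \<in> \<Gamma>. \<exists>x\<in>C. a g x \<in> C}"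
proof -
  define P where "P = (C \<times> C) \<inter> {z. \<pi> (fst z) = \<pi> (snd z)}"
  have "open {z. \<pi> (fst z) \<noteq> \<pi> (snd z)}"
  proof (subst open_prod_def, intro ballI)
    fix z assume "z \<in> {z. \<pi> (fst z) \<noteq> \<pi> (snd z)}"
    then have "\<pi> (fst z) \<noteq> \<pi> (snd z)" by simp
    moreover have "\<pi> x \<in> pts M" for x using param_onD(2)[OF par] by blast
    ultimately obtain A B where AB: "openin (mtop M) A" "openin (mtop M) B" "\<pi> (fst z) \<in> A" "\<pi> (snd z) \<in> B" "disjnt A B"
      using H unfolding Hausdorff_space_def by meson
    show "\<exists>A B. open A \<and> open B \<and> z \<in> A \<times> B \<and> A \<times> B \<subseteq> {z. \<pi> (fst z) \<noteq> \<pi> (snd z)}"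
      using param_onD(3)[OF par AB(1)] param_onD(3)[OF par AB(2)] AB(3-5)
      by (intro exI[of _ "\<pi> -` A"] exI[of _ "\<pi> -` B"]) (auto simp: disjnt_def mem_Times_iff)
  qed
  then have "closed {z. \<pi> (fst z) = \<pi> (snd z)}" by (simp add: closed_def Collect_neg_eq[symmetric])
  then have "compact P" unfolding P_def using compact_Times[OF C C] by (rule compact_Int_closed[rotated])
  have "\<exists>N g. open N \<and> z \<in> N \<and> (\<forall>h\<in>\<Gamma>. \<forall>x. (x, a h x) \<in> N \<longrightarrow> h = g)" if z: "z \<in> P" for z
  proof -
    obtain g where g: "g \<in> \<Gamma>" "snd z = a g (fst z)" using z orb[of "snd z" "fst z"] by (auto simp: P_def)
    obtain W where W: "snd z \<in> W" "param_nbhd M \<pi> W" using param_onD(7)[OF par, of "snd z"] by blast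
    have "open (UNIV \<inter> a g -` W)"
      by (rule open_vimage_Int[OF cont[OF g(1)] open_UNIV param_nbhdD(1)[OF W(2)]])
    then have "open ((a g -` W) \<times> W)" using param_nbhdD(1)[OF W(2)] by (simp add: open_Times)
    moreover have "h = g" if h: "h \<in> \<Gamma>" "(x, a h x) \<in> (a g -` W) \<times> W" for h x
    proof -
      have "\<pi> (a g x) = \<pi> (a h x)" using orb g(1) h(1) by metis
      then have "a g x = a h x" using param_nbhdD(2)[OF W(2)] h(2) by (auto dest: inj_onD)
      then show "h = g" using free[OF g(1) h(1)] by blast
    qed
    ultimately show ?thesis using g(2) W(1) by (intro exI[of _ "(a g -` W) \<times> W"] exI[of _ g]) (auto simp: mem_Times_iff)
  qed
  then obtain N g where N: "\<And>z. z \<in> P \<Longrightarrow> open (N z)" "\<And>z. z \<in> P \<Longrightarrow> z \<in> N z"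
    "\<And>z h x. z \<in> P \<Longrightarrow> h \<in> \<Gamma> \<Longrightarrow> (x, a h x) \<in> N z \<Longrightarrow> h = g z" by metis
  obtain P' where P': "P' \<subseteq> P" "finite P'" "P \<subseteq> (\<Union>z\<in>P'. N z)"
    by (rule compactE_image[OF \<open>compact P\<close>, of P N]) (use N(1,2) in auto)
  have "{g \<in> \<Gamma>. \<exists>x\<in>C. a g x \<in> C} \<subseteq> g ` P'"
  proof
    fix h assume "h \<in> {g \<in> \<Gamma>. \<exists>x\<in>C. a g x \<in> C}"
    then obtain x where x: "h \<in> \<Gamma>" "x \<in> C" "a h x \<in> C" by blast
    then have "\<pi> (a h x) = \<pi> x" using orb by blast
    then have "(x, a h x) \<in> P" using x by (simp add: P_def)
    then obtain z where "z \<in> P'" "(x, a h x) \<in> N z" using P'(3) by blast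
    then show "h \<in> g ` P'" using N(3)[of z h x] P'(1) x(1) by blast
  qed
  then show ?thesis using P'(2) finite_surj by blast
qed

lemma compact_cover:
  fixes \<pi> :: "'e::euclidean_space \<Rightarrow> 'm"
  assumes par: "param_on UNIV M \<pi>" and M: "compact_space (mtop M)"
  obtains K where "compact K" "\<pi> ` K = pts M"
proof -
  let ?V = "range (\<lambda>x. \<pi> ` ball x 1)"
  have "\<forall>U\<in>?V. openin (mtop M) U" using param_onD(4)[OF par] by auto
  moreover have "pts M \<subseteq> \<Union>?V"
  proof
    fix z assume "z \<in> pts M"
    then obtain x where "z = \<pi> x" using param_onD(2)[OF par] by blast
    then have "z \<in> \<pi> ` ball x 1" by simp
    then show "z \<in> \<Union>?V" by blast
  qed
  ultimately obtain F where F: "finite F" "F \<subseteq> ?V" "pts M \<subseteq> \<Union>F" using M unfolding compact_space_alt by meson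
  obtain X where X: "finite X" "F = (\<lambda>x. \<pi> ` ball x 1) ` X" using finite_subset_image[OF F(1,2)] by blast
  show ?thesis
  proof (rule that[of "\<Union>x\<in>X. cball x 1"])
    show "compact (\<Union>x\<in>X. cball x 1)" using X(1) by (intro compact_UN) auto
    show "\<pi> ` (\<Union>x\<in>X. cball x 1) = pts M"
    proof
      show "\<pi> ` (\<Union>x\<in>X. cball x 1) \<subseteq> pts M" using param_onD(2)[OF par] by blast
      have "\<Union>F \<subseteq> \<pi> ` (\<Union>x\<in>X. cball x 1)" unfolding X(2) using ball_subset_cball by blast
      with F(3) show "pts M \<subseteq> \<pi> ` (\<Union>x\<in>X. cball x 1)" by simp
    qed
  qed
qed

lemma int_subgroup_cyclic:
  assumes z: "(0::int) \<in> D" and add: "\<And>a b. a \<in> D \<Longrightarrow> b \<in> D \<Longrightarrow> a + b \<in> D" and neg: "\<And>a. a \<in> D \<Longrightarrow> - a \<in> D"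
    and nz: "\<exists>a\<in>D. a \<noteq> 0"
  shows "\<exists>m>0. D = range ((*) m)"
proof -
  have ex: "\<exists>n::nat. n > 0 \<and> int n \<in> D"
  proof -
    obtain a where a: "a \<in> D" "a \<noteq> 0" using nz by blast
    then have "int (nat \<bar>a\<bar>) \<in> D" "nat \<bar>a\<bar> > 0" using neg[of a] by (auto simp: abs_if)
    then show ?thesis by blast
  qed
  define m where "m = (LEAST n::nat. n > 0 \<and> int n \<in> D)"
  have m: "m > 0" "int m \<in> D" using LeastI_ex[OF ex] by (auto simp: m_def)
  have natmul: "int m * int k \<in> D" for k
    by (induction k) (use z add m(2) in \<open>auto simp: distrib_left\<close>)
  have mul: "int m * k \<in> D" for k
  proof (cases "k \<ge> 0")
    case True then show ?thesis using natmul[of "nat k"] by simp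
  next
    case False then show ?thesis using neg[OF natmul[of "nat (- k)"]] by simp
  qed
  have "a \<in> range ((*) (int m))" if a: "a \<in> D" for a
  proof -
    let ?r = "a mod int m"
    have "?r = a + int m * (- (a div int m))" by (simp add: minus_mult_div_eq_mod[symmetric])
    then have "?r \<in> D" using add[OF a mul] by metis
    moreover have r: "0 \<le> ?r" "?r < int m" using m(1) by auto
    ultimately have "\<not> ?r > 0" using not_less_Least[of "nat ?r" "\<lambda>n. n > 0 \<and> int n \<in> D"] by (auto simp: m_def[symmetric])
    then have "a = int m * (a div int m)" using r mult_div_mod_eq[of "int m" a] by simp
    then show ?thesis by blast
  qed
  then show ?thesis using mul m(1) by (intro exI[of _ "int m"]) auto
qed

lemma smooth_Pair_const: "smooth_on UNIV (Pair t :: 'e::euclidean_space \<Rightarrow> 'd::euclidean_space \<times> 'e)"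
  using smooth_on_Pair[OF open_UNIV smooth_on_const smooth_on_id[OF open_UNIV], of t] by simp

lemma pts_slice [simp]: "pts (slice t) = {t} \<times> UNIV"
  by (simp add: slice_def)

lemma openin_slice: "openin (mtop (slice t)) (Pair t ` W) \<longleftrightarrow> open W"
proof
  assume "openin (mtop (slice t)) (Pair t ` W)"
  then obtain T where T: "open T" "Pair t ` W = ({t} \<times> UNIV) \<inter> T" by (auto simp: slice_def openin_open)
  have "W = UNIV \<inter> Pair t -` T"
  proof (intro equalityI subsetI)
    show "y \<in> W" if "y \<in> UNIV \<inter> Pair t -` T" for y
    proof -
      have "(t, y) \<in> Pair t ` W" unfolding T(2) using that by simp
      then show ?thesis by blast
    qed
  qed (use T(2) in auto)
  then show "open W"
    using open_vimage_Int[OF smooth_on_continuous[OF smooth_Pair_const] open_UNIV T(1)] by metis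
next
  assume "open W"
  then have "open (UNIV \<times> W)" by (simp add: open_Times)
  moreover have "Pair t ` W = ({t} \<times> UNIV) \<inter> (UNIV \<times> W)" by auto
  ultimately show "openin (mtop (slice t)) (Pair t ` W)" by (auto simp: slice_def openin_open)
qed

lemma param_slice: "param_on UNIV (slice t) (Pair t)"
  unfolding param_on_def
proof (intro conjI allI impI ballI)
  show "range (Pair t) = pts (slice t)" by auto
  show "open (UNIV \<inter> Pair t -` V)" if V: "openin (mtop (slice t)) V" for V
  proof -
    have "V \<subseteq> {t} \<times> UNIV" using openin_subset[OF V] by simp
    then have "Pair t ` (UNIV \<inter> Pair t -` V) = V" by auto
    then show ?thesis using V openin_slice by metis
  qed
  show "openin (mtop (slice t)) (Pair t ` W)" if "open W" for W using that by (simp add: openin_slice)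
  fix c assume c: "c \<in> atlas (slice t)"
  have "openin (mtop (slice t)) (pts (slice t))" by (rule openin_topspace)
  then show "openin (mtop (slice t)) (fst c)" using c by (simp add: slice_def)
  show "inj_on (snd c) (fst c)" using c by (auto simp: slice_def inj_on_def)
next
  fix x :: "real \<times> 'a"
  have "param_nbhd (slice t) (Pair t) (UNIV :: (real \<times> 'a) set)"
    unfolding param_nbhd_def
  proof (intro conjI ballI)
    show "inj (Pair t)" by (auto simp: inj_on_def)
    fix c :: "(real \<times> real \<times> 'a) set \<times> (real \<times> real \<times> 'a \<Rightarrow> real \<times> 'a)" assume "c \<in> atlas (slice t)"
    then have c: "c = ({t} \<times> UNIV, snd)" by (simp add: slice_def)
    have im: "snd c ` (fst c \<inter> range (Pair t)) = UNIV" by (force simp: c)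
    have id: "inv_into UNIV (Pair t) \<circ> inv_into (fst c) (snd c) = (\<lambda>y. y)"
    proof
      fix y :: "real \<times> 'a"
      have "inv_into ({t} \<times> UNIV) snd y = (t, y)" by (rule inv_into_f_eq) (auto simp: inj_on_def)
      moreover have "inv_into UNIV (Pair t) (t, y) = y" by (rule inv_into_f_eq) (auto simp: inj_on_def)
      ultimately show "(inv_into UNIV (Pair t) \<circ> inv_into (fst c) (snd c)) y = y" by (simp add: c)
    qed
    show "smooth_on (UNIV \<inter> Pair t -` fst c) (snd c \<circ> Pair t)"
      using smooth_on_subset[OF smooth_on_id[OF open_UNIV]] by (simp add: c o_def)
    show "open (snd c ` (fst c \<inter> range (Pair t)))" unfolding im by simp
    show "smooth_on (snd c ` (fst c \<inter> range (Pair t))) (inv_into UNIV (Pair t) \<circ> inv_into (fst c) (snd c))"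
      unfolding im using smooth_on_id[OF open_UNIV] id by simp
  qed simp
  then show "\<exists>W. x \<in> W \<and> W \<subseteq> UNIV \<and> param_nbhd (slice t) (Pair t) W" by blast
qed simp

lemma param_of_slice_quotient:
  assumes "quotient_projection H a (slice t) N \<rho>"
  shows "param_on UNIV N (\<lambda>y. \<rho> (t, y))"
  by (rule param_of_local_diffeo[where X="slice t" and \<phi>=snd and \<theta>="Pair t"])
    (use assms in \<open>auto simp: quotient_projection_def openin_slice slice_def[THEN arg_cong[of _ _ atlas]]\<close>)

lemma param_of_euclidean_quotient:
  assumes "quotient_projection H a euclidean_mfd N \<rho>"
  shows "param_on UNIV N \<rho>"
  using param_of_local_diffeo[where X=euclidean_mfd and \<phi>=id and \<theta>=id and N=N and q=\<rho>] assms
  by (simp add: quotient_projection_def euclidean_mfd_def)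

lemma real_coset_eq_iff:
  assumes z: "(0::int) \<in> D" and add: "\<And>a b. a \<in> D \<Longrightarrow> b \<in> D \<Longrightarrow> a + b \<in> D" and neg: "\<And>a. a \<in> D \<Longrightarrow> - a \<in> D"
  shows "real_coset D x = real_coset D y \<longleftrightarrow> (\<exists>k\<in>D. y = x + of_int k)"
proof
  assume "real_coset D x = real_coset D y"
  moreover have "y \<in> real_coset D y" unfolding real_coset_def using z by (intro CollectI exI[of _ 0]) simp
  ultimately show "\<exists>k\<in>D. y = x + of_int k" by (auto simp: real_coset_def)
next
  have sub: "real_coset D (x + of_int k) \<subseteq> real_coset D x" if "k \<in> D" for k x
  proof
    fix w assume "w \<in> real_coset D (x + of_int k)"
    then obtain j where "j \<in> D" "w = x + of_int (k + j)" by (auto simp: real_coset_def)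
    then show "w \<in> real_coset D x" using add[OF that] unfolding real_coset_def by blast
  qed
  assume "\<exists>k\<in>D. y = x + of_int k"
  then obtain k where k: "k \<in> D" "y = x + of_int k" by blast
  then show "real_coset D x = real_coset D y" using sub[OF k(1), of x] sub[OF neg[OF k(1)], of y] by simp
qed

text \<open>The linear part depends on \<open>\<sigma>\<close> only through the derivative of the solution, and it fixes \<open>(1, 0)\<close>.\<close>

lemma slice_act_affine:
  assumes ip: "pseudo_euclidean ip"
  shows "linear (\<lambda>z. (fst z - 2 * ip w (snd z), snd z) :: real \<times> 'v::euclidean_space)"
    "slice_act ip t \<sigma> z = slice_act ip t \<sigma> 0 + (fst z - 2 * ip (tderiv (snd \<sigma>) t) (snd z), snd z)"
proof -
  interpret ip: bounded_bilinear ip using pseudo_euclidean_bounded_bilinear[OF ip] .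
  show "linear (\<lambda>z. (fst z - 2 * ip w (snd z), snd z))"
    by (rule linearI) (simp_all add: ip.add_right ip.scaleR_right algebra_simps)
  show "slice_act ip t \<sigma> z = slice_act ip t \<sigma> 0 + (fst z - 2 * ip (tderiv (snd \<sigma>) t) (snd z), snd z)"
    by (simp add: slice_act_def ip.add_right ip.scaleR_right)
qed

lemma smooth_slice_act: "pseudo_euclidean ip \<Longrightarrow> smooth_on UNIV (slice_act ip t \<sigma>)"
  by (rule smooth_on_affine[OF open_UNIV slice_act_affine])

section \<open>Compact quotients\<close>

locale compact_quotient =
  fixes f :: "real \<Rightarrow> real" and p :: real
    and ip :: "'v::euclidean_space \<Rightarrow> 'v \<Rightarrow> real" and A :: "'v \<Rightarrow> 'v"
    and \<Gamma> :: "'v gelt set"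
    and M :: "('m, real \<times> real \<times> 'v) mfd" and \<pi> :: "real \<times> real \<times> 'v \<Rightarrow> 'm"
  assumes f: "smooth_on UNIV f" "p > 0" "\<forall>t. f (t + p) = f t"
    and ip: "pseudo_euclidean ip"
    and A: "linear A" "\<forall>v w. ip (A v) w = ip v (A w)"
    and \<Gamma>: "subgroup \<Gamma> (G_grp f p ip A)"
      "free_diffeo_action ((G_grp f p ip A)\<lparr>carrier := \<Gamma>\<rparr>) (G_act p ip) euclidean_mfd"
    and M: "quotient_projection ((G_grp f p ip A)\<lparr>carrier := \<Gamma>\<rparr>) (G_act p ip) euclidean_mfd M \<pi>"
      "compact_space (mtop M)"
begin

abbreviation "G \<equiv> G_grp f p ip A"
abbreviation "act \<equiv> G_act p ip"
abbreviation "D \<equiv> G_proj ` \<Gamma>"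

sublocale G: group G by (rule group_G[OF ip A f(3)])

sublocale bil: bounded_bilinear ip using pseudo_euclidean_bounded_bilinear[OF ip] .

lemma \<Gamma>_carrier: "g \<in> \<Gamma> \<Longrightarrow> g \<in> carrier G" using \<Gamma>(1) subgroup.subset by blast

lemma act_mul: "g \<in> \<Gamma> \<Longrightarrow> h \<in> \<Gamma> \<Longrightarrow> act (g \<otimes>\<^bsub>G\<^esub> h) x = act g (act h x)"
  by (rule act_mult[OF ip A f(3) \<Gamma>_carrier \<Gamma>_carrier])

lemma \<Gamma>_one: "(0, 0, \<lambda>t. 0) \<in> \<Gamma>"
  using subgroup.one_closed[OF \<Gamma>(1)] by (simp add: G_grp_def)

lemma act_one: "act (0, 0, \<lambda>t. 0) x = x"
  by (cases x) (simp add: G_act_def bil.zero_left)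

lemma act_inv: "g \<in> \<Gamma> \<Longrightarrow> act (inv\<^bsub>G\<^esub> g) (act g x) = x" "g \<in> \<Gamma> \<Longrightarrow> act g (act (inv\<^bsub>G\<^esub> g) x) = x"
proof -
  assume g: "g \<in> \<Gamma>"
  have one: "\<one>\<^bsub>G\<^esub> = (0, 0, \<lambda>t. 0)" by (simp add: G_grp_def)
  have i: "inv\<^bsub>G\<^esub> g \<in> \<Gamma>" using subgroup.m_inv_closed[OF \<Gamma>(1) g] .
  show "act (inv\<^bsub>G\<^esub> g) (act g x) = x"
    using act_mul[OF i g, of x] G.l_inv[OF \<Gamma>_carrier[OF g]] by (simp add: one act_one)
  show "act g (act (inv\<^bsub>G\<^esub> g) x) = x"
    using act_mul[OF g i, of x] G.r_inv[OF \<Gamma>_carrier[OF g]] by (simp add: one act_one)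
qed

lemma fixed_point_free: "g \<in> \<Gamma> \<Longrightarrow> act g x = x \<Longrightarrow> g = \<one>\<^bsub>G\<^esub>"
proof -
  have "\<forall>g\<in>\<Gamma>. \<forall>x\<in>UNIV. act g x = x \<longrightarrow> g = \<one>\<^bsub>G\<^esub>"
    using \<Gamma>(2) by (simp add: free_diffeo_action_def euclidean_mfd_def del: split_paired_All split_paired_Ex)
  then show "g \<in> \<Gamma> \<Longrightarrow> act g x = x \<Longrightarrow> g = \<one>\<^bsub>G\<^esub>" by blast
qed

lemma free: assumes "g \<in> \<Gamma>" "h \<in> \<Gamma>" "act g x = act h x" shows "g = h"
proof -
  have i: "inv\<^bsub>G\<^esub> h \<in> \<Gamma>" using subgroup.m_inv_closed[OF \<Gamma>(1) assms(2)] .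
  have "act (inv\<^bsub>G\<^esub> h \<otimes>\<^bsub>G\<^esub> g) x = x" using act_mul[OF i assms(1)] assms act_inv by simp
  moreover have "inv\<^bsub>G\<^esub> h \<otimes>\<^bsub>G\<^esub> g \<in> \<Gamma>" using subgroup.m_closed[OF \<Gamma>(1) i assms(1)] .
  ultimately have "inv\<^bsub>G\<^esub> h \<otimes>\<^bsub>G\<^esub> g = \<one>\<^bsub>G\<^esub>"
    using fixed_point_free by simp
  then show ?thesis
    using G.inv_equality[of "inv\<^bsub>G\<^esub> h" g] G.inv_closed G.inv_inv \<Gamma>_carrier assms by (metis G.inv_solve_left' G.r_one G.one_closed)
qed

lemma orbit_iff: "\<pi> y = \<pi> x \<longleftrightarrow> (\<exists>g\<in>\<Gamma>. y = act g x)"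
proof -
  have "{y \<in> pts euclidean_mfd. \<pi> y = \<pi> x} = orbit (G\<lparr>carrier := \<Gamma>\<rparr>) act x"
    using M(1) unfolding quotient_projection_def by (simp only: euclidean_mfd_def mfd.simps topspace_euclidean UNIV_I simp_thms)
  then have "{y. \<pi> y = \<pi> x} = orbit (G\<lparr>carrier := \<Gamma>\<rparr>) act x" by (simp add: euclidean_mfd_def)
  then show ?thesis by (auto simp: orbit_def)
qed

lemma param_M: "param_on UNIV M \<pi>" using M(1) by (rule param_of_euclidean_quotient)

lemma Hausdorff_M: "Hausdorff_space (mtop M)"
  using M(1) by (simp add: quotient_projection_def smooth_manifold_def)

lemma continuous_act: "g \<in> \<Gamma> \<Longrightarrow> continuous_on UNIV (act g)"
  using \<Gamma>(2) by (simp add: free_diffeo_action_def diffeomorphism_def smooth_map_def euclidean_mfd_def)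

lemma fst_act: "fst (act g x) = fst x + of_int (G_proj g) * p"
  by (cases g; cases x) (simp add: G_act_def G_proj_def)

lemma G_proj_mult: "G_proj (g \<otimes>\<^bsub>G\<^esub> h) = G_proj g + G_proj h"
  by (cases g; cases h) (simp add: G_proj_def G_grp_def)

lemma D_group: "0 \<in> D" "a \<in> D \<Longrightarrow> b \<in> D \<Longrightarrow> a + b \<in> D" "a \<in> D \<Longrightarrow> - a \<in> D"
proof -
  show "0 \<in> D" using \<Gamma>_one by (force simp: G_proj_def)
  show "a + b \<in> D" if ab: "a \<in> D" "b \<in> D"
  proof -
    obtain g h where "g \<in> \<Gamma>" "h \<in> \<Gamma>" "a = G_proj g" "b = G_proj h" using ab by blast
    then show ?thesis using subgroup.m_closed[OF \<Gamma>(1), of g h] G_proj_mult[of g h] by (metis imageI)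
  qed
  show "- a \<in> D" if a: "a \<in> D"
  proof -
    obtain g where g: "g \<in> \<Gamma>" "a = G_proj g" using a by blast
    have "G_proj (inv\<^bsub>G\<^esub> g) + G_proj g = 0"
      unfolding G_proj_mult[symmetric] using G.l_inv[OF \<Gamma>_carrier[OF g(1)]] by (simp add: G_grp_def G_proj_def)
    then have "- a = G_proj (inv\<^bsub>G\<^esub> g)" using g by linarith
    then show ?thesis using subgroup.m_inv_closed[OF \<Gamma>(1) g(1)] by blast
  qed
qed

lemmas coset_eq_iff = real_coset_eq_iff[OF D_group]

text \<open>If every element of \<open>\<Gamma>\<close> preserved \<open>t\<close>, then \<open>t\<close> would be bounded on the translates of a compact set,
  and these cover everything.\<close>

lemma D_cyclic: "\<exists>m>0. D = range ((*) m)"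
proof (rule int_subgroup_cyclic[OF D_group])
  show "\<exists>a\<in>D. a \<noteq> 0"
  proof (rule ccontr)
    assume no: "\<not> (\<exists>a\<in>D. a \<noteq> 0)"
    obtain K where K: "compact K" "\<pi> ` K = pts M" using compact_cover[OF param_M M(2)] .
    have "bounded (fst ` K)" by (intro compact_imp_bounded compact_continuous_image K continuous_intros)
    then obtain B where B: "\<And>x. x \<in> K \<Longrightarrow> \<bar>fst x\<bar> \<le> B" by (auto simp: bounded_iff)
    have "\<pi> (\<bar>B\<bar> + 1, 0) \<in> \<pi> ` K" unfolding K(2) param_onD(2)[OF param_M, symmetric] by (rule rangeI)
    then obtain k where k: "\<pi> (\<bar>B\<bar> + 1, 0) = \<pi> k" "k \<in> K" by (rule imageE)
    obtain g where g: "g \<in> \<Gamma>" "(\<bar>B\<bar> + 1, 0) = act g k" using orbit_iff k(1) by blast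
    have "\<bar>B\<bar> + 1 = fst k" using fst_act[of g k] no g by (metis fst_conv imageI add_0_right mult_zero_left of_int_0)
    then show False using B[OF k(2)] by linarith
  qed
qed

definition Sg :: "(real \<times> (real \<Rightarrow> 'v)) set" where "Sg = {\<sigma>. (0, \<sigma>) \<in> \<Gamma>}"

lemma act_slice: "act (0, \<sigma>) (t, y) = (t, slice_act ip t \<sigma> y)"
  by (cases \<sigma>; cases y) (simp add: G_act_def slice_act_def)

lemma proj0_Sg: assumes "g \<in> \<Gamma>" "G_proj g = 0" obtains \<sigma> where "\<sigma> \<in> Sg" "g = (0, \<sigma>)"
  using assms by (cases g) (auto simp: G_proj_def Sg_def)

lemma same_slice_iff: "\<pi> (t, y') = \<pi> (t, y) \<longleftrightarrow> (\<exists>\<sigma>\<in>Sg. y' = slice_act ip t \<sigma> y)"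
proof
  assume "\<pi> (t, y') = \<pi> (t, y)"
  then obtain g where g: "g \<in> \<Gamma>" "(t, y') = act g (t, y)" using orbit_iff by blast
  then have "G_proj g = 0" using fst_act[of g "(t, y)"] f(2) by (metis add_cancel_right_right fst_conv mult_eq_0_iff less_irrefl of_int_eq_0_iff)
  then obtain \<sigma> where "\<sigma> \<in> Sg" "g = (0, \<sigma>)" using proj0_Sg g(1) by blast
  then show "\<exists>\<sigma>\<in>Sg. y' = slice_act ip t \<sigma> y" using g(2) by (auto simp: act_slice)
next
  assume "\<exists>\<sigma>\<in>Sg. y' = slice_act ip t \<sigma> y"
  then show "\<pi> (t, y') = \<pi> (t, y)" using orbit_iff by (auto simp: Sg_def act_slice[symmetric])
qed

text \<open>Compactness of the quotient of a single slice: let \<open>K\<close> be compact with translates that cover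
  everything.  Only finitely many shifts \<open>j * p\<close> can carry a point of \<open>K\<close> into the slice at \<open>t\<close>; for
  each of them one element \<open>\<gamma> j\<close> suffices, since any other one differs from it by an element of \<open>\<Sigma>\<close>.\<close>

lemma slice_cocompact: "\<exists>C. compact C \<and> (\<forall>y. \<exists>\<sigma>\<in>Sg. \<exists>y'\<in>C. y = slice_act ip t \<sigma> y')"
proof -
  obtain K where K: "compact K" "\<pi> ` K = pts M" using compact_cover[OF param_M M(2)] .
  have "bounded (fst ` K)" by (intro compact_imp_bounded compact_continuous_image K continuous_intros)
  then obtain B where B: "\<And>x. x \<in> K \<Longrightarrow> \<bar>fst x\<bar> \<le> B" by (auto simp: bounded_iff)
  define J where "J = D \<inter> {j. \<bar>of_int j * p\<bar> \<le> \<bar>t\<bar> + B}"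
  have "J \<subseteq> {- \<lceil>(\<bar>t\<bar> + B) / p\<rceil> .. \<lceil>(\<bar>t\<bar> + B) / p\<rceil>}"
  proof
    fix j assume "j \<in> J"
    then have "\<bar>of_int j\<bar> \<le> (\<bar>t\<bar> + B) / p" using f(2) by (simp add: J_def abs_mult pos_le_divide_eq)
    then show "j \<in> {- \<lceil>(\<bar>t\<bar> + B) / p\<rceil> .. \<lceil>(\<bar>t\<bar> + B) / p\<rceil>}" by (simp, linarith)
  qed
  then have finJ: "finite J" using finite_subset finite_atLeastAtMost_int by blast
  obtain \<gamma> where \<gamma>: "\<And>j. j \<in> D \<Longrightarrow> \<gamma> j \<in> \<Gamma>" "\<And>j. j \<in> D \<Longrightarrow> G_proj (\<gamma> j) = j"
    by (metis (mono_tags, lifting) f_inv_into_f inv_into_into)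
  define C where "C = (\<Union>j\<in>J. (\<lambda>x. snd (act (\<gamma> j) x)) ` K)"
  have "compact C" unfolding C_def
  proof (rule compact_UN[OF finJ])
    fix j assume "j \<in> J"
    then have "\<gamma> j \<in> \<Gamma>" using \<gamma>(1)[of j] by (simp add: J_def)
    then have "continuous_on K (act (\<gamma> j))" by (rule continuous_on_subset[OF continuous_act subset_UNIV])
    then show "compact ((\<lambda>x. snd (act (\<gamma> j) x)) ` K)" by (intro compact_continuous_image K(1) continuous_on_snd)
  qed
  moreover have "\<exists>\<sigma>\<in>Sg. \<exists>y'\<in>C. y = slice_act ip t \<sigma> y'" for y
  proof -
    have "\<pi> (t, y) \<in> \<pi> ` K" unfolding K(2) param_onD(2)[OF param_M, symmetric] by (rule rangeI)
    then obtain k where k: "\<pi> (t, y) = \<pi> k" "k \<in> K" by (rule imageE)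
    obtain g where g: "g \<in> \<Gamma>" "(t, y) = act g k" using orbit_iff k(1) by blast
    define j where "j = G_proj g"
    have t: "t = fst k + of_int j * p" using fst_act[of g k] g(2) by (metis fst_conv j_def)
    have j: "j \<in> D" "j \<in> J" using g(1) B[OF k(2)] t by (auto simp: J_def j_def)
    let ?y' = "snd (act (\<gamma> j) k)"
    have a: "act (\<gamma> j) k = (t, ?y')" using fst_act[of "\<gamma> j" k] \<gamma>(2)[OF j(1)] t by (simp add: prod_eq_iff)
    have "\<pi> (t, y) = \<pi> (t, ?y')"
      unfolding a[symmetric] g(2) using orbit_iff g(1) \<gamma>(1)[OF j(1)] by metis
    then obtain \<sigma> where "\<sigma> \<in> Sg" "y = slice_act ip t \<sigma> ?y'" using same_slice_iff by blast
    moreover have "?y' \<in> C" unfolding C_def using j(2) k(2) by blast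
    ultimately show ?thesis by blast
  qed
  ultimately show ?thesis by blast
qed

lemma slice_group: "slice_group f ip A Sg"
proof (rule slice_group.intro)
  show "smooth_on UNIV f" "pseudo_euclidean ip" "linear A" "\<forall>v w. ip (A v) w = ip v (A w)" by (fact f ip A)+
  show "snd \<sigma> \<in> solution_space f A" if "\<sigma> \<in> Sg" for \<sigma>
    using that \<Gamma>_carrier by (fastforce simp: Sg_def G_grp_def)
  show "(0, \<lambda>t. 0) \<in> Sg" using \<Gamma>_one by (simp add: Sg_def)
  have T0: "Tpow p 0 u = u" for u :: "real \<Rightarrow> 'v" by (simp add: Tpow_def)
  have mul0: "(0, \<sigma>) \<otimes>\<^bsub>G\<^esub> (0, \<sigma>') = (0, fst \<sigma> + fst \<sigma>' - Omega ip (snd \<sigma>) (snd \<sigma>'), \<lambda>t. snd \<sigma> t + snd \<sigma>' t)" for \<sigma> \<sigma>'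
    by (cases \<sigma>; cases \<sigma>') (simp add: G_grp_def T0)
  show "(fst \<sigma> + fst \<sigma>' - Omega ip (snd \<sigma>) (snd \<sigma>'), \<lambda>t. snd \<sigma> t + snd \<sigma>' t) \<in> Sg" if "\<sigma> \<in> Sg" "\<sigma>' \<in> Sg" for \<sigma> \<sigma>'
    using that subgroup.m_closed[OF \<Gamma>(1), of "(0, \<sigma>)" "(0, \<sigma>')"] by (simp add: Sg_def mul0)
  show "(- fst \<sigma>, \<lambda>t. - snd \<sigma> t) \<in> Sg" if s: "\<sigma> \<in> Sg" for \<sigma>
  proof -
    have u: "snd \<sigma> \<in> solution_space f A" using s \<Gamma>_carrier by (fastforce simp: Sg_def G_grp_def)
    have "tderiv (\<lambda>t. - snd \<sigma> t) 0 = - tderiv (snd \<sigma>) 0"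
      using tderiv_minus(1)[of "snd \<sigma>"] u by (simp add: solution_space_def fun_eq_iff)
    moreover have "ip v w = ip w v" for v w using ip by (simp add: pseudo_euclidean_def)
    ultimately have "Omega ip (\<lambda>t. - snd \<sigma> t) (snd \<sigma>) = 0"
      by (simp add: Omega_def bil.minus_left bil.minus_right)
    then have "(0, - fst \<sigma>, \<lambda>t. - snd \<sigma> t) \<otimes>\<^bsub>G\<^esub> (0, \<sigma>) = \<one>\<^bsub>G\<^esub>"
      using mul0[of "(- fst \<sigma>, \<lambda>t. - snd \<sigma> t)" \<sigma>] by (simp add: G_grp_def)
    moreover have "(0, - fst \<sigma>, \<lambda>t. - snd \<sigma> t) \<in> carrier G" using sol_minus[OF A(1) u] by (simp add: G_grp_def)
    ultimately have "inv\<^bsub>G\<^esub> (0, \<sigma>) = (0, - fst \<sigma>, \<lambda>t. - snd \<sigma> t)"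
      using G.inv_equality s \<Gamma>_carrier by (auto simp: Sg_def)
    then show ?thesis using subgroup.m_inv_closed[OF \<Gamma>(1), of "(0, \<sigma>)"] s by (simp add: Sg_def)
  qed
  show "finite {\<sigma> \<in> Sg. \<exists>y\<in>C. slice_act ip t \<sigma> y \<in> C}" if C: "compact C" for C t
  proof -
    have "finite {g \<in> \<Gamma>. \<exists>x\<in>{t} \<times> C. act g x \<in> {t} \<times> C}"
      by (rule finite_returns[OF param_M Hausdorff_M continuous_act free orbit_iff]) (use C in \<open>auto intro: compact_Times\<close>)
    then have "finite (Pair (0::int) ` {\<sigma> \<in> Sg. \<exists>y\<in>C. slice_act ip t \<sigma> y \<in> C})"
      by (rule rev_finite_subset) (auto simp: Sg_def act_slice)
    then show ?thesis by (rule finite_imageD) (simp add: inj_on_def)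
  qed
  show "\<exists>C. compact C \<and> (\<forall>y. \<exists>\<sigma>\<in>Sg. \<exists>y'\<in>C. y = slice_act ip 0 \<sigma> y')" by (rule slice_cocompact)
qed

end

text \<open>A map that is affine near \<open>y\<close> pulls the zero Christoffel symbols back to zero.\<close>

lemma affine_representative:
  assumes L: "linear L" and T: "open T" "y \<in> T" "\<And>z. z \<in> T \<Longrightarrow> F z = c + L z"
  shows "frechet_derivative F (at y) = (L :: 'a::euclidean_space \<Rightarrow> 'b::euclidean_space)"
    "frechet_derivative (\<lambda>z. frechet_derivative F (at z) b) (at y) a = 0"
proof -
  have D: "frechet_derivative F (at z) = L" if z: "z \<in> T" for z
  proof -
    have "((\<lambda>z. c + L z) has_derivative (\<lambda>v. 0 + L v)) (at z)"
      using L by (intro has_derivative_add has_derivative_const bounded_linear_imp_has_derivative)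
        (simp add: linear_conv_bounded_linear)
    then have "(F has_derivative (\<lambda>v. 0 + L v)) (at z)"
      by (rule has_derivative_transform_within_open[OF _ T(1) z]) (simp add: T(3))
    then show ?thesis using frechet_derivative_at by fastforce
  qed
  show "frechet_derivative F (at y) = L" by (rule D[OF T(2)])
  have "((\<lambda>z. frechet_derivative F (at z) b) has_derivative (\<lambda>_. 0)) (at y)"
    by (rule has_derivative_transform_within_open[OF has_derivative_const T(1,2)]) (simp add: D)
  from frechet_derivative_at[OF this]
  show "frechet_derivative (\<lambda>z. frechet_derivative F (at z) b) (at y) a = 0" by (metis (no_types))
qed

section \<open>The fibres\<close>

context compact_quotient
begin

sublocale sl: slice_group f ip A Sg by (rule slice_group)

definition \<kappa> :: "real \<Rightarrow> real \<times> 'v \<Rightarrow> 'm" where "\<kappa> t y = \<pi> (t, y)"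

lemma \<kappa>_iff: "\<kappa> t y' = \<kappa> t y \<longleftrightarrow> (\<exists>\<sigma>\<in>Sg. y' = slice_act ip t \<sigma> y)"
  unfolding \<kappa>_def by (rule same_slice_iff)

lemma \<kappa>_act: "\<sigma> \<in> Sg \<Longrightarrow> \<kappa> t (slice_act ip t \<sigma> y) = \<kappa> t y"
  using \<kappa>_iff by blast

lemma deck_quotient_\<kappa>: "deck_quotient (\<kappa> t)"
  unfolding deck_quotient_def
proof (intro conjI allI impI)
  have vim: "open (Pair t -` W)" if "open W" for W :: "(real \<times> real \<times> 'v) set"
    using open_vimage_Int[OF smooth_on_continuous[OF smooth_Pair_const] open_UNIV that, of t] by simp
  show "\<exists>W. open W \<and> y \<in> W \<and> inj_on (\<kappa> t) W" for y
  proof -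
    obtain W where W: "(t, y) \<in> W" "param_nbhd M \<pi> W" using param_onD(7)[OF param_M, of "(t, y)"] by blast
    have "inj_on (\<kappa> t) (Pair t -` W)"
      using param_nbhdD(2)[OF W(2)] by (auto simp: inj_on_def \<kappa>_def)
    then show ?thesis using vim[OF param_nbhdD(1)[OF W(2)]] W(1) by (intro exI[of _ "Pair t -` W"]) simp
  qed
  show "\<exists>g. smooth_on UNIV g \<and> g x = y \<and> (\<forall>z. \<kappa> t (g z) = \<kappa> t z)" if xy: "\<kappa> t x = \<kappa> t y" for x y
  proof -
    obtain \<sigma> where s: "\<sigma> \<in> Sg" "y = slice_act ip t \<sigma> x" using \<kappa>_iff[of t y x] xy by auto
    then show ?thesis using smooth_slice_act[OF ip] \<kappa>_act by (intro exI[of _ "slice_act ip t \<sigma>"]) simp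
  qed
  show "\<exists>A B. open A \<and> open B \<and> x \<in> A \<and> y \<in> B \<and> \<kappa> t ` A \<inter> \<kappa> t ` B = {}" if ne: "\<kappa> t x \<noteq> \<kappa> t y" for x y
  proof -
    have "\<pi> z \<in> pts M" for z using param_onD(2)[OF param_M] by blast
    then obtain A B where AB: "openin (mtop M) A" "openin (mtop M) B" "\<pi> (t, x) \<in> A" "\<pi> (t, y) \<in> B" "disjnt A B"
      using Hausdorff_M ne unfolding Hausdorff_space_def \<kappa>_def by meson
    have "open (\<pi> -` A)" "open (\<pi> -` B)" using param_onD(3)[OF param_M] AB by auto
    from vim[OF this(1)] vim[OF this(2)] show ?thesis using AB(3-5)
      by (intro exI[of _ "Pair t -` (\<pi> -` A)"] exI[of _ "Pair t -` (\<pi> -` B)"]) (auto simp: \<kappa>_def disjnt_def)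
  qed
qed

definition \<beta> :: "'m \<Rightarrow> real set" where
  "\<beta> z = real_coset D (inverse p * fst (SOME x. \<pi> x = z))"

lemma \<beta>_\<pi>: "\<beta> (\<pi> x) = real_coset D (inverse p * fst x)"
proof -
  have "\<pi> (SOME x'. \<pi> x' = \<pi> x) = \<pi> x" by (rule someI[where P="\<lambda>x'. \<pi> x' = \<pi> x"]) simp
  then obtain g where g: "g \<in> \<Gamma>" "(SOME x'. \<pi> x' = \<pi> x) = act g x" using orbit_iff by blast
  have "inverse p * fst (act g x) = inverse p * fst x + of_int (G_proj g)"
    using f(2) by (simp add: fst_act field_simps)
  then show ?thesis
    unfolding \<beta>_def g(2) using coset_eq_iff[of "inverse p * fst x" "inverse p * fst (act g x)"] g(1) by blast
qed

definition fibre :: "real \<Rightarrow> 'm set" where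
  "fibre t = {z \<in> pts M. \<beta> z = real_coset D (inverse p * t)}"

lemma in_fibre:
  assumes "real_coset D (inverse p * t') = real_coset D (inverse p * t)"
  obtains k where "k \<in> D" "t = t' + of_int k * p" "\<And>y'. \<pi> (t', y') \<in> range (\<kappa> t)"
proof -
  obtain k where k: "k \<in> D" "inverse p * t = inverse p * t' + of_int k" using assms coset_eq_iff by blast
  obtain g where g: "g \<in> \<Gamma>" "k = G_proj g" using k(1) by blast
  have t: "t = t' + of_int k * p" using k(2) f(2) by (simp add: field_simps)
  have "\<pi> (t', y') \<in> range (\<kappa> t)" for y'
  proof -
    have "act g (t', y') = (t, snd (act g (t', y')))" using fst_act[of g "(t', y')"] g(2) t by (simp add: prod_eq_iff)
    moreover have "\<pi> (act g (t', y')) = \<pi> (t', y')" using orbit_iff g(1) by blast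
    ultimately show ?thesis unfolding \<kappa>_def by (metis rangeI)
  qed
  with k(1) t show ?thesis by (rule that)
qed

lemma fibre_eq: "fibre t = range (\<kappa> t)"
proof (intro equalityI subsetI)
  fix z assume z: "z \<in> fibre t"
  then obtain x where x: "z = \<pi> x" using param_onD(2)[OF param_M] unfolding fibre_def by blast
  then have "real_coset D (inverse p * fst x) = real_coset D (inverse p * t)" using z \<beta>_\<pi> by (simp add: fibre_def)
  from in_fibre[OF this] show "z \<in> range (\<kappa> t)" using x by (metis prod.collapse)
next
  fix z assume "z \<in> range (\<kappa> t)"
  then obtain y where "z = \<pi> (t, y)" by (auto simp: \<kappa>_def)
  then show "z \<in> fibre t" using \<beta>_\<pi>[of "(t, y)"] param_onD(2)[OF param_M] by (auto simp: fibre_def)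
qed

text \<open>The other slices that lie over the same fibre as the slice at \<open>t\<close> are at distance at least \<open>p\<close> from it, so
  that the projection of a thin open set meets the fibre only where it comes from the slice at \<open>t\<close> itself.\<close>

lemma openin_fibre: assumes W: "open W" shows "openin (subtopology (mtop M) (range (\<kappa> t))) (\<kappa> t ` W)"
proof -
  let ?A = "{t - p <..< t + p} \<times> W"
  have "openin (mtop M) (\<pi> ` ?A)" by (rule param_onD(4)[OF param_M]) (use W in \<open>auto intro: open_Times\<close>)
  moreover have "\<pi> ` ?A \<inter> range (\<kappa> t) = \<kappa> t ` W"
  proof (intro equalityI subsetI)
    fix z assume z: "z \<in> \<pi> ` ?A \<inter> range (\<kappa> t)"
    then obtain x where "x \<in> ?A" "z = \<pi> x" by blast
    then obtain t' y where y: "\<bar>t' - t\<bar> < p" "y \<in> W" "z = \<pi> (t', y)"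
      using that[of "fst x" "snd x"] by (auto simp: mem_Times_iff abs_less_iff)
    have "z \<in> fibre t" using z fibre_eq by simp
    then have "real_coset D (inverse p * t') = real_coset D (inverse p * t)" using \<beta>_\<pi> y(3) by (simp add: fibre_def)
    then obtain k where k: "t = t' + of_int k * p" using in_fibre by metis
    then have "\<bar>of_int k * p\<bar> < 1 * p" using y(1) by simp
    then have "\<bar>of_int k\<bar> < (1::real)" using f(2) by (simp add: abs_mult)
    then have "k = 0" by linarith
    then show "z \<in> \<kappa> t ` W" using y k by (auto simp: \<kappa>_def)
  next
    fix z assume "z \<in> \<kappa> t ` W"
    then show "z \<in> \<pi> ` ?A \<inter> range (\<kappa> t)" using f(2) by (auto simp: \<kappa>_def)
  qed
  ultimately show ?thesis unfolding openin_subtopology by (intro exI[of _ "\<pi> ` ?A"]) simp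
qed

text \<open>This serves twice: for the orbit space of a slice with an arbitrary realization \<open>N\<close>, and for the fibre
  itself with \<open>h = id\<close>.\<close>

lemma fibre_embedding:
  fixes N :: "('k, real \<times> 'v) mfd"
  assumes N: "param_on UNIV N \<rho>" and eqv: "\<And>y y'. \<rho> y = \<rho> y' \<longleftrightarrow> \<kappa> t y = \<kappa> t y'"
    and h: "\<And>y. h (\<rho> y) = \<kappa> t y"
  shows "smooth_embedding N M h" "h ` pts N = fibre t"
proof -
  have lift: "h (\<rho> y) = \<pi> (t, y)" for y using h by (simp add: \<kappa>_def)
  have im: "h ` pts N = range (\<kappa> t)"
    unfolding param_onD(2)[OF N, symmetric] image_image h ..
  then show "h ` pts N = fibre t" by (simp add: fibre_eq)
  have sm: "smooth_map N M h" by (rule smooth_map_lift[OF N param_M smooth_Pair_const _ lift]) simp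
  have tM: "topspace (subtopology (mtop M) (range (\<kappa> t))) = range (\<kappa> t)"
    using param_onD(2)[OF param_M] by (auto simp: \<kappa>_def)
  have "embedding_map (mtop N) (mtop M) h"
    unfolding embedding_map_def im
  proof (rule bijective_open_imp_homeomorphic_map)
    show "continuous_map (mtop N) (subtopology (mtop M) (range (\<kappa> t))) h"
      using sm im unfolding smooth_map_def continuous_map_in_subtopology by blast
    show "open_map (mtop N) (subtopology (mtop M) (range (\<kappa> t))) h"
      unfolding open_map_def
    proof (intro allI impI)
      fix V assume V: "openin (mtop N) V"
      have "V \<subseteq> range \<rho>" using openin_subset[OF V] param_onD(2)[OF N] by simp
      then have "V = \<rho> ` (\<rho> -` V)" by auto
      then have "h ` V = (\<lambda>y. h (\<rho> y)) ` (\<rho> -` V)" by (metis image_image)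
      then have "h ` V = \<kappa> t ` (\<rho> -` V)" by (simp add: h)
      then show "openin (subtopology (mtop M) (range (\<kappa> t))) (h ` V)"
        using openin_fibre param_onD(3)[OF N V] by simp
    qed
    show "h ` pts N = topspace (subtopology (mtop M) (range (\<kappa> t)))" using im tM by simp
    show "inj_on h (pts N)"
    proof (rule inj_onI)
      fix a b assume "a \<in> pts N" "b \<in> pts N" "h a = h b"
      moreover from this obtain y y' where "a = \<rho> y" "b = \<rho> y'" using param_onD(2)[OF N] by blast
      ultimately show "a = b" using eqv[of y y'] h by simp
    qed
  qed
  moreover have "inj (frechet_derivative (local_rep h c d) (at y))"
    if "c \<in> atlas N" "d \<in> atlas M" "y \<in> local_dom h c d" for c d y
    by (rule immersion_lift[OF N param_M smooth_Pair_const _ lift smooth_on_snd[OF open_UNIV smooth_on_id[OF open_UNIV]] _ that])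
      simp_all
  ultimately show "smooth_embedding N M h" using sm by (simp add: smooth_embedding_def)
qed

text \<open>A realization of the orbit space whose points are the orbits themselves.\<close>

definition slice_quotient :: "real \<Rightarrow> (real \<times> real \<times> 'v) \<Rightarrow> (real \<times> real \<times> 'v) set" where
  "slice_quotient t x = {x' \<in> {t} \<times> UNIV. \<pi> x' = \<pi> x}"

abbreviation "\<Sigma> \<equiv> \<Gamma> \<inter> kernel G integer_group G_proj"

lemma \<Sigma>_eq: "\<Sigma> = Pair 0 ` Sg"
  using \<Gamma>_carrier by (auto simp: kernel_def Sg_def G_proj_def image_iff)

lemma Sg_inv: assumes "\<sigma> \<in> Sg"
  obtains \<sigma>' where "\<sigma>' \<in> Sg" "\<And>t y. slice_act ip t \<sigma>' (slice_act ip t \<sigma> y) = y" "\<And>t y. slice_act ip t \<sigma> (slice_act ip t \<sigma>' y) = y"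
proof -
  have g: "(0, \<sigma>) \<in> \<Gamma>" using assms by (simp add: Sg_def)
  have "G_proj (inv\<^bsub>G\<^esub> (0, \<sigma>)) + G_proj (0, \<sigma>) = 0"
    unfolding G_proj_mult[symmetric] using G.l_inv[OF \<Gamma>_carrier[OF g]] by (simp add: G_grp_def G_proj_def)
  then have "G_proj (inv\<^bsub>G\<^esub> (0, \<sigma>)) = 0" by (simp add: G_proj_def split: prod.splits)
  then obtain \<sigma>' where s: "\<sigma>' \<in> Sg" "inv\<^bsub>G\<^esub> (0, \<sigma>) = (0, \<sigma>')"
    using proj0_Sg[OF subgroup.m_inv_closed[OF \<Gamma>(1) g]] by blast
  show ?thesis
  proof (rule that[OF s(1)])
    fix t y
    show "slice_act ip t \<sigma>' (slice_act ip t \<sigma> y) = y" using act_inv(1)[OF g, of "(t, y)"] by (simp add: s(2) act_slice)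
    show "slice_act ip t \<sigma> (slice_act ip t \<sigma>' y) = y" using act_inv(2)[OF g, of "(t, y)"] by (simp add: s(2) act_slice)
  qed
qed

lemma act_slice_image: "g \<in> \<Sigma> \<Longrightarrow> act g ` pts (slice t) = pts (slice t)"
proof -
  assume "g \<in> \<Sigma>"
  then obtain \<sigma> where s: "\<sigma> \<in> Sg" "g = (0, \<sigma>)" unfolding \<Sigma>_eq by blast
  obtain \<sigma>' where s': "\<And>y. slice_act ip t \<sigma> (slice_act ip t \<sigma>' y) = y" using Sg_inv[OF s(1)] by metis
  show ?thesis
  proof (intro equalityI subsetI)
    fix x :: "real \<times> real \<times> 'v" assume "x \<in> pts (slice t)"
    then have "x = act g (t, slice_act ip t \<sigma>' (snd x))" using s' by (auto simp: s(2) act_slice)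
    then show "x \<in> act g ` pts (slice t)" by (metis UNIV_I image_eqI mem_Sigma_iff pts_slice singletonI)
  qed (auto simp: s(2) act_slice)
qed

lemma diffeomorphism_act: assumes "g \<in> \<Sigma>" shows "diffeomorphism (slice t) (slice t) (act g)"
proof -
  obtain \<sigma> where s: "\<sigma> \<in> Sg" "g = (0, \<sigma>)" using assms unfolding \<Sigma>_eq by blast
  obtain \<sigma>' where s': "\<And>y. slice_act ip t \<sigma>' (slice_act ip t \<sigma> y) = y" "\<And>y. slice_act ip t \<sigma> (slice_act ip t \<sigma>' y) = y"
    using Sg_inv[OF s(1)] by metis
  show ?thesis
  proof (rule diffeomorphism_lift[OF param_slice param_slice])
    show "smooth_on UNIV (slice_act ip t \<sigma>)" "smooth_on UNIV (slice_act ip t \<sigma>')" by (rule smooth_slice_act[OF ip])+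
    show "(t, y) = (t, y')" if "(t, slice_act ip t \<sigma> y) = (t, slice_act ip t \<sigma> y')" for y y'
      using that s'(1) by (metis prod.inject)
  qed (use s'(2) in \<open>simp_all add: s(2) act_slice\<close>)
qed

lemma subgroup_\<Sigma>: "subgroup \<Sigma> G"
proof (rule G.subgroupI)
  show "\<Sigma> \<subseteq> carrier G" using \<Gamma>_carrier by blast
  have "(0, 0, \<lambda>t. 0) \<in> \<Sigma>" unfolding \<Sigma>_eq using sl.one by (rule imageI)
  then show "\<Sigma> \<noteq> {}" by blast
  have ker: "g \<in> \<Sigma> \<longleftrightarrow> g \<in> \<Gamma> \<and> G_proj g = 0" for g by (auto simp: kernel_def intro: \<Gamma>_carrier)
  show "inv\<^bsub>G\<^esub> g \<in> \<Sigma>" if g: "g \<in> \<Sigma>" for g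
  proof -
    have "G_proj (inv\<^bsub>G\<^esub> g) + G_proj g = 0"
      unfolding G_proj_mult[symmetric] using G.l_inv[OF \<Gamma>_carrier] g by (simp add: G_grp_def G_proj_def)
    then show ?thesis using g subgroup.m_inv_closed[OF \<Gamma>(1)] unfolding ker by simp
  qed
  show "g \<otimes>\<^bsub>G\<^esub> h \<in> \<Sigma>" if "g \<in> \<Sigma>" "h \<in> \<Sigma>" for g h
    using that subgroup.m_closed[OF \<Gamma>(1)] unfolding ker by (simp add: G_proj_mult)
qed

lemma free_diffeo_action_slice: "free_diffeo_action (G\<lparr>carrier := \<Sigma>\<rparr>) act (slice t)"
  unfolding free_diffeo_action_def
proof (intro conjI ballI impI)
  let ?H = "G\<lparr>carrier := \<Sigma>\<rparr>" and ?\<phi> = "\<lambda>g. restrict (act g) (pts (slice t))"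
  have Bij: "?\<phi> g \<in> Bij (pts (slice t))" if "g \<in> \<Sigma>" for g
  proof -
    have "bij_betw (act g) (pts (slice t)) (pts (slice t))"
      using diffeomorphism_act[OF that] unfolding diffeomorphism_def by blast
    then have "bij_betw (?\<phi> g) (pts (slice t)) (pts (slice t))"
      by (subst bij_betw_cong[where g="act g"]) simp_all
    then show ?thesis unfolding Bij_def by simp
  qed
  have "group ?H" by (rule subgroup.subgroup_is_group[OF subgroup_\<Sigma> G.group_axioms])
  moreover have "?\<phi> \<in> hom ?H (BijGroup (pts (slice t)))"
  proof (rule homI)
    show "?\<phi> g \<in> carrier (BijGroup (pts (slice t)))" if "g \<in> carrier ?H" for g
      using Bij that by (simp add: BijGroup_def)
    show "?\<phi> (g \<otimes>\<^bsub>?H\<^esub> h) = ?\<phi> g \<otimes>\<^bsub>BijGroup (pts (slice t))\<^esub> ?\<phi> h" if gh: "g \<in> carrier ?H" "h \<in> carrier ?H" for g h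
    proof
      fix x
      have g: "g \<in> \<Sigma>" "h \<in> \<Sigma>" using gh by simp_all
      then have "act (g \<otimes>\<^bsub>G\<^esub> h) x = act g (act h x)" by (intro act_mul) auto
      moreover have "act h x \<in> pts (slice t)" if "x \<in> pts (slice t)" using act_slice_image[OF g(2)] that by blast
      ultimately show "?\<phi> (g \<otimes>\<^bsub>?H\<^esub> h) x = (?\<phi> g \<otimes>\<^bsub>BijGroup (pts (slice t))\<^esub> ?\<phi> h) x"
        using Bij[OF g(1)] Bij[OF g(2)] by (simp add: BijGroup_def compose_def)
    qed
  qed
  ultimately show "group_action ?H (pts (slice t)) ?\<phi>"
    by (intro group_action.intro group_hom.intro group_hom_axioms.intro group_BijGroup)
next
  fix g assume "g \<in> carrier (G\<lparr>carrier := \<Sigma>\<rparr>)"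
  then show "diffeomorphism (slice t) (slice t) (act g)" by (intro diffeomorphism_act) simp
next
  fix g x assume "g \<in> carrier (G\<lparr>carrier := \<Sigma>\<rparr>)" "act g x = x"
  then show "g = \<one>\<^bsub>G\<lparr>carrier := \<Sigma>\<rparr>\<^esub>" using fixed_point_free[of g x] by simp
qed

lemma slice_orbit: assumes "x \<in> pts (slice t)"
  shows "orbit (G\<lparr>carrier := \<Sigma>\<rparr>) act x = {y \<in> pts (slice t). \<pi> y = \<pi> x}"
proof -
  obtain y where x: "x = (t, y)" using assms by auto
  have "orbit (G\<lparr>carrier := \<Sigma>\<rparr>) act x = (\<lambda>\<sigma>. (t, slice_act ip t \<sigma> y)) ` Sg"
    unfolding x by (simp add: orbit_def Setcompr_eq_image \<Sigma>_eq image_image act_slice del: split_paired_Ex)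
  also have "\<dots> = {y \<in> pts (slice t). \<pi> y = \<pi> x}"
  proof (intro equalityI subsetI)
    fix z assume "z \<in> (\<lambda>\<sigma>. (t, slice_act ip t \<sigma> y)) ` Sg"
    then obtain \<sigma> where "\<sigma> \<in> Sg" "z = (t, slice_act ip t \<sigma> y)" by blast
    then show "z \<in> {y \<in> pts (slice t). \<pi> y = \<pi> x}" unfolding x using same_slice_iff by auto
  next
    fix z assume "z \<in> {y \<in> pts (slice t). \<pi> y = \<pi> x}"
    then have z: "z = (t, snd z)" "\<pi> (t, snd z) = \<pi> (t, y)" by (auto simp: x)
    then obtain \<sigma> where "\<sigma> \<in> Sg" "snd z = slice_act ip t \<sigma> y" using same_slice_iff by blast
    then show "z \<in> (\<lambda>\<sigma>. (t, slice_act ip t \<sigma> y)) ` Sg" using z(1) by (metis image_eqI)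
  qed
  finally show ?thesis .
qed

lemma quotient_projection_slice:
  "quotient_projection (G\<lparr>carrier := \<Sigma>\<rparr>) act (slice t) (quot_mfd (\<lambda>y. slice_quotient t (t, y))) (slice_quotient t)"
proof -
  let ?q = "\<lambda>y. slice_quotient t (t, y)"
  have eq: "slice_quotient t x = slice_quotient t x' \<longleftrightarrow> \<pi> x = \<pi> x'" if "x \<in> {t} \<times> UNIV" "x' \<in> {t} \<times> UNIV" for x x'
    using that unfolding slice_quotient_def by fastforce
  have "deck_quotient ?q"
    by (rule deck_quotient_cong[OF deck_quotient_\<kappa>[of t]]) (simp add: eq \<kappa>_def)
  note param = param_quot[OF this] and mfd = manifold_quot[OF this] and deck = this
  show ?thesis
    unfolding quotient_projection_def
  proof (intro conjI ballI)
    show "smooth_manifold (quot_mfd ?q)" by (rule mfd)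
    show "slice_quotient t ` pts (slice t) = pts (quot_mfd ?q)" by (auto simp: image_iff)
    show "{y \<in> pts (slice t). slice_quotient t y = slice_quotient t x} = orbit (G\<lparr>carrier := \<Sigma>\<rparr>) act x"
      if x: "x \<in> pts (slice t)" for x
      unfolding slice_orbit[OF x] by (intro Collect_cong conj_cong refl eq) (use x in simp_all)
    show "local_diffeo (slice t) (quot_mfd ?q) (slice_quotient t)"
      unfolding local_diffeo_def
    proof (intro ballI)
      fix x :: "real \<times> real \<times> 'v" assume "x \<in> pts (slice t)"
      then obtain y where x: "x = (t, y)" by auto
      obtain W where W: "open W" "y \<in> W" "inj_on ?q W" using deck unfolding deck_quotient_def by blast
      let ?U = "Pair t ` W"
      have im: "slice_quotient t ` ?U = ?q ` W" by (simp add: image_image)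
      have oU: "openin (mtop (slice t)) ?U" using W(1) by (simp add: openin_slice)
      have oV: "openin (mtop (quot_mfd ?q)) (?q ` W)" by (rule openin_quot_image[OF deck W(1)])
      have "diffeomorphism (open_submfd (slice t) ?U) (open_submfd (quot_mfd ?q) (?q ` W)) (slice_quotient t)"
        by (rule diffeomorphism_lift[OF param_open_submfd[OF param_slice oU W(1)] param_open_submfd[OF param oV W(1)]
              smooth_on_id[OF W(1)] smooth_on_id[OF W(1)]]) (use W(3) in \<open>auto dest: inj_onD\<close>)
      then show "\<exists>U. x \<in> U \<and> openin (mtop (slice t)) U \<and> openin (mtop (quot_mfd ?q)) (slice_quotient t ` U) \<and>
        diffeomorphism (open_submfd (slice t) U) (open_submfd (quot_mfd ?q) (slice_quotient t ` U)) (slice_quotient t)"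
        using oU oV W(2) x im by (intro exI[of _ ?U]) simp
    qed
  qed
qed

lemma properly_discontinuous_slice: "properly_discontinuous (G\<lparr>carrier := \<Sigma>\<rparr>) act (slice t)"
  unfolding properly_discontinuous_def using free_diffeo_action_slice quotient_projection_slice by blast

lemma slice_quotient_embedding:
  fixes N :: "('k, real \<times> 'v) mfd"
  assumes N: "quotient_projection (G\<lparr>carrier := \<Sigma>\<rparr>) act (slice t) N \<rho>"
  shows "\<exists>\<iota>. smooth_embedding N M \<iota> \<and> (\<forall>x\<in>pts (slice t). \<iota> (\<rho> x) = \<pi> x) \<and> \<iota> ` pts N = fibre t"
proof -
  have par: "param_on UNIV N (\<lambda>y. \<rho> (t, y))" using N by (rule param_of_slice_quotient)
  have same: "{x' \<in> pts (slice t). \<rho> x' = \<rho> x} = {x' \<in> pts (slice t). \<pi> x' = \<pi> x}" if "x \<in> pts (slice t)" for x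
    using N that unfolding slice_orbit[OF that, symmetric] quotient_projection_def by blast
  have eqv: "\<rho> (t, y) = \<rho> (t, y') \<longleftrightarrow> \<kappa> t y = \<kappa> t y'" for y y'
  proof -
    have "(t, y) \<in> {x' \<in> pts (slice t). \<rho> x' = \<rho> (t, y')} \<longleftrightarrow> (t, y) \<in> {x' \<in> pts (slice t). \<pi> x' = \<pi> (t, y')}"
      by (subst same) simp_all
    then show ?thesis by (simp add: \<kappa>_def)
  qed
  define \<iota> where "\<iota> z = \<kappa> t (SOME y. \<rho> (t, y) = z)" for z
  have \<iota>: "\<iota> (\<rho> (t, y)) = \<kappa> t y" for y
    unfolding \<iota>_def eqv[symmetric] by (rule someI[where P="\<lambda>y'. \<rho> (t, y') = \<rho> (t, y)"]) simp
  show ?thesis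
    using fibre_embedding[OF par eqv \<iota>] \<iota> by (intro exI[of _ \<iota>]) (auto simp: \<kappa>_def)
qed

lemma act_affine: assumes "g \<in> \<Sigma>"
  shows "\<exists>L. affine_with_linear_part (pts (slice t)) (act g) L \<and> L (0, 1, 0) = (0, 1, 0)"
proof -
  obtain \<sigma> where s: "\<sigma> \<in> Sg" "g = (0, \<sigma>)" using assms unfolding \<Sigma>_eq by blast
  let ?L = "\<lambda>x::real \<times> real \<times> 'v. (fst x, fst (snd x) - 2 * ip (tderiv (snd \<sigma>) t) (snd (snd x)), snd (snd x))"
  have "linear ?L" by (rule linearI) (simp_all add: bil.add_right bil.scaleR_right algebra_simps)
  moreover have "act g x - act g x' = ?L (x - x')" if "x \<in> pts (slice t)" "x' \<in> pts (slice t)" for x x'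
    using that by (auto simp: s(2) act_slice slice_act_def bil.add_right bil.scaleR_right bil.diff_right algebra_simps)
  moreover have "bij_betw (act g) (pts (slice t)) (pts (slice t))"
    using diffeomorphism_act[OF assms] by (simp add: diffeomorphism_def)
  ultimately show ?thesis
    by (intro exI[of _ ?L]) (simp add: affine_with_linear_part_def bil.zero_right)
qed

end

text \<open>The orbit of \<open>x\<close> under integer translations is closed and discrete, so a point \<open>y\<close> outside it has a
  positive distance \<open>e\<close> from it, and balls of half this radius separate the cosets.\<close>

lemma deck_quotient_real_coset:
  assumes D: "(0::int) \<in> D" "\<And>a b. a \<in> D \<Longrightarrow> b \<in> D \<Longrightarrow> a + b \<in> D" "\<And>a. a \<in> D \<Longrightarrow> - a \<in> D"
  shows "deck_quotient (real_coset D)"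
  unfolding deck_quotient_def
proof (intro conjI allI impI)
  note eq = real_coset_eq_iff[OF D]
  show "\<exists>W. open W \<and> x \<in> W \<and> inj_on (real_coset D) W" for x
  proof (intro exI conjI)
    show "inj_on (real_coset D) {x - 1/2 <..< x + 1/2}"
    proof (rule inj_onI)
      fix a b assume ab: "a \<in> {x - 1/2 <..< x + 1/2}" "b \<in> {x - 1/2 <..< x + 1/2}" "real_coset D a = real_coset D b"
      then obtain k where k: "b = a + of_int k" using eq by blast
      then have "\<bar>of_int k\<bar> < (1::real)" using ab by auto
      then have "k = 0" by linarith
      then show "a = b" using k by simp
    qed
  qed auto
  show "\<exists>g. smooth_on UNIV g \<and> g x = y \<and> (\<forall>z. real_coset D (g z) = real_coset D z)"
    if xy: "real_coset D x = real_coset D y" for x y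
  proof -
    obtain k where k: "k \<in> D" "y = x + of_int k" using xy eq by blast
    have "real_coset D (z + of_int k) = real_coset D z" for z using eq[of z "z + of_int k"] k(1) by metis
    moreover have "smooth_on UNIV (\<lambda>z::real. z + of_int k)"
      by (intro smooth_on_plus smooth_on_id smooth_on_const open_UNIV)
    ultimately show ?thesis using k(2) by (intro exI[of _ "\<lambda>z. z + of_int k"]) simp
  qed
  show "\<exists>A B. open A \<and> open B \<and> x \<in> A \<and> y \<in> B \<and> real_coset D ` A \<inter> real_coset D ` B = {}"
    if ne: "real_coset D x \<noteq> real_coset D y" for x y
  proof -
    let ?S = "(\<lambda>k. x + of_int k) ` {\<lfloor>y - x\<rfloor> - 2 .. \<lfloor>y - x\<rfloor> + 2}"
    obtain d where d: "d > 0" "\<And>z. z \<in> ?S \<Longrightarrow> z \<noteq> y \<Longrightarrow> d \<le> dist y z"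
      using finite_set_avoid[of ?S y] by blast
    define e where "e = min d 1"
    have e: "e > 0" using d(1) by (simp add: e_def)
    have far: "e \<le> \<bar>x + of_int k - y\<bar>" if k: "k \<in> D" for k
    proof (cases "k \<in> {\<lfloor>y - x\<rfloor> - 2 .. \<lfloor>y - x\<rfloor> + 2}")
      case True
      have "x + of_int k \<noteq> y" using ne eq[of x y] k by metis
      then show ?thesis using d(2)[of "x + of_int k"] True by (auto simp: e_def dist_real_def)
    next
      case False
      then have "\<bar>of_int k - (y - x)\<bar> \<ge> 1" by (simp, linarith)
      then show ?thesis by (simp add: e_def algebra_simps)
    qed
    have "real_coset D ` ball x (e/2) \<inter> real_coset D ` ball y (e/2) = {}"
    proof (rule ccontr)
      assume "\<not> ?thesis"
      then obtain a b where ab: "a \<in> ball x (e/2)" "b \<in> ball y (e/2)" "real_coset D a = real_coset D b" by blast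
      then obtain k where k: "k \<in> D" "b = a + of_int k" using eq by blast
      have "\<bar>x - a\<bar> < e/2" "\<bar>y - b\<bar> < e/2" using ab by (auto simp: dist_real_def)
      then show False using far[OF k(1)] k(2) by linarith
    qed
    then show ?thesis using e by (intro exI[of _ "ball x (e/2)"] exI[of _ "ball y (e/2)"]) simp
  qed
qed

lemma param_euclidean: "param_on UNIV (euclidean_mfd :: ('e::euclidean_space, 'e) mfd) id"
proof -
  have "param_nbhd (euclidean_mfd :: ('e, 'e) mfd) id UNIV"
    using smooth_on_id[OF open_UNIV] by (simp add: param_nbhd_def euclidean_mfd_def id_def o_def)
  then show ?thesis unfolding param_on_def by (auto simp: euclidean_mfd_def)
qed

lemma slice_embedding:
  "smooth_embedding (slice t) (euclidean_mfd :: (real \<times> real \<times> 'v::euclidean_space, _) mfd) id"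
proof -
  let ?E = "euclidean_mfd :: (real \<times> real \<times> 'v, _) mfd"
  have "smooth_map (slice t) ?E id"
    by (rule smooth_map_lift[OF param_slice param_euclidean smooth_Pair_const]) simp_all
  moreover have "embedding_map (mtop (slice t)) (mtop ?E) id"
    by (simp add: embedding_map_def slice_def euclidean_mfd_def homeomorphic_map_id)
  moreover have "inj (frechet_derivative (local_rep id c d) (at y))"
    if "c \<in> atlas (slice t)" "d \<in> atlas ?E" "y \<in> local_dom id c d" for c d y
    by (rule immersion_lift[OF param_slice param_euclidean smooth_Pair_const _ _
          smooth_on_snd[OF open_UNIV smooth_on_id[OF open_UNIV]] _ that]) simp_all
  ultimately show ?thesis by (simp add: smooth_embedding_def)
qed

section \<open>The geometry of the fibres and the bundle\<close>

context compact_quotient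
begin

text \<open>The chart changes of a fibre are affine because they are elements of \<open>\<Sigma>\<close>; and they
  fix \<open>(1, 0)\<close>.\<close>

lemma \<kappa>_chart_local:
  assumes U: "open U" "inj_on (\<kappa> t) U" and y: "\<kappa> t y \<in> \<kappa> t ` U"
  obtains T c L where "open T" "y \<in> T" "linear L" "L (1, 0) = (1, 0)"
    "\<And>z. z \<in> T \<Longrightarrow> inv_into U (\<kappa> t) (\<kappa> t z) = c + L z"
proof -
  obtain u where u: "u \<in> U" "\<kappa> t u = \<kappa> t y" using y by force
  then obtain \<sigma> where s: "\<sigma> \<in> Sg" "u = slice_act ip t \<sigma> y" using \<kappa>_iff by blast
  show ?thesis
  proof (rule that[of "slice_act ip t \<sigma> -` U" "\<lambda>z. (fst z - 2 * ip (tderiv (snd \<sigma>) t) (snd z), snd z)" "slice_act ip t \<sigma> 0"])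
    show "open (slice_act ip t \<sigma> -` U)"
      using open_vimage_Int[OF smooth_on_continuous[OF smooth_slice_act[OF ip]] open_UNIV U(1)] by simp
    show "inv_into U (\<kappa> t) (\<kappa> t z) = slice_act ip t \<sigma> 0 + (fst z - 2 * ip (tderiv (snd \<sigma>) t) (snd z), snd z)"
      if "z \<in> slice_act ip t \<sigma> -` U" for z
      unfolding slice_act_affine(2)[OF ip, symmetric]
      by (rule inv_deck[where g="slice_act ip t \<sigma>"]) (use U(2) that \<kappa>_act[OF s(1)] in auto)
  qed (use u(1) s(2) in \<open>simp_all add: slice_act_affine(1)[OF ip] bil.zero_right\<close>)
qed

definition has_affine_rep :: "('n \<Rightarrow> 'k) \<Rightarrow> ('n, real \<times> 'v) chart \<Rightarrow> ('k, real \<times> 'v) chart \<Rightarrow> real \<times> 'v \<Rightarrow> bool" where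
  "has_affine_rep h c d y \<longleftrightarrow> (\<exists>T b L. open T \<and> y \<in> T \<and> linear L \<and> L (1, 0) = (1, 0) \<and> (\<forall>z\<in>T. local_rep h c d z = b + L z))"

text \<open>Consequently the zero Christoffel symbols and the constant field \<open>(1, 0)\<close>, given by the same
  formulas in all charts, define a connection and a vector field.\<close>

lemma affine_rep_related:
  assumes "\<And>c d y. c \<in> atlas N \<Longrightarrow> d \<in> atlas S \<Longrightarrow> y \<in> local_dom h c d \<Longrightarrow> has_affine_rep h c d y"
  shows "connection_related N (\<lambda>c y a b. 0) S (\<lambda>c y a b. 0) h"
    "vfield_related N (\<lambda>c y. (1, 0)) S (\<lambda>c y. (1, 0)) h"
proof -
  have "frechet_derivative (\<lambda>z. frechet_derivative (local_rep h c d) (at z) b) (at y) a = 0 \<and>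
      frechet_derivative (local_rep h c d) (at y) 0 = 0 \<and>
      frechet_derivative (local_rep h c d) (at y) (1, 0) = (1, 0)"
    if cdy: "c \<in> atlas N" "d \<in> atlas S" "y \<in> local_dom h c d" for c d y a b
  proof -
    obtain T b' L where T: "open T" "y \<in> T" "linear L" "L (1, 0) = (1, 0)" "\<And>z. z \<in> T \<Longrightarrow> local_rep h c d z = b' + L z"
      using assms[OF cdy] unfolding has_affine_rep_def by blast
    from affine_representative[OF T(3,1,2,5)] show ?thesis using T(4) linear_0[OF T(3)] by simp
  qed
  then show "connection_related N (\<lambda>c y a b. 0) S (\<lambda>c y a b. 0) h"
    "vfield_related N (\<lambda>c y. (1, 0)) S (\<lambda>c y. (1, 0)) h"
    unfolding connection_related_def vfield_related_def Let_def by simp_all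
qed

lemma affine_rep_slice:
  assumes c: "c \<in> atlas (slice t)" and d: "d \<in> atlas (quot_mfd (\<kappa> t))" and y: "y \<in> local_dom \<pi> c d"
  shows "has_affine_rep \<pi> c d y"
proof -
  obtain U where U: "open U" "inj_on (\<kappa> t) U" "d = (\<kappa> t ` U, inv_into U (\<kappa> t))" using d by (auto simp: quot_mfd_def)
  have c: "c = ({t} \<times> UNIV, snd)" using c by (simp add: slice_def)
  have "\<kappa> t y \<in> \<kappa> t ` U" using y by (auto simp: local_dom_def c U(3) \<kappa>_def)
  then obtain T b L where T: "open T" "y \<in> T" "linear L" "L (1, 0) = (1, 0)"
    "\<And>z. z \<in> T \<Longrightarrow> inv_into U (\<kappa> t) (\<kappa> t z) = b + L z" using \<kappa>_chart_local[OF U(1,2)] by metis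
  have "inv_into ({t} \<times> UNIV) snd z = (t, z)" for z :: "real \<times> 'v" by (rule inv_into_f_eq) (auto simp: inj_on_def)
  then have "local_rep \<pi> c d z = inv_into U (\<kappa> t) (\<kappa> t z)" for z
    by (simp add: local_rep_def c U(3) \<kappa>_def[of t z])
  then show ?thesis using T unfolding has_affine_rep_def by (intro exI[of _ T] exI[of _ b] exI[of _ L]) simp
qed

lemma affine_rep_fibre:
  assumes c: "c \<in> atlas (quot_mfd (\<kappa> t))" and d: "d \<in> atlas (quot_mfd (\<kappa> t))" and y: "y \<in> local_dom id c d"
  shows "has_affine_rep id c d y"
proof -
  obtain U where U: "open U" "inj_on (\<kappa> t) U" "d = (\<kappa> t ` U, inv_into U (\<kappa> t))" using d by (auto simp: quot_mfd_def)
  obtain W where W: "open W" "inj_on (\<kappa> t) W" "c = (\<kappa> t ` W, inv_into W (\<kappa> t))" using c by (auto simp: quot_mfd_def)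
  have "local_dom id c d = W \<inter> \<kappa> t -` (\<kappa> t ` U)"
    using quot_chart_image[OF deck_quotient_\<kappa> W(2)] by (simp add: local_dom_def U(3) W(3))
  then have yW: "y \<in> W" "\<kappa> t y \<in> \<kappa> t ` U" using y by auto
  then obtain T b L where T: "open T" "y \<in> T" "linear L" "L (1, 0) = (1, 0)"
    "\<And>z. z \<in> T \<Longrightarrow> inv_into U (\<kappa> t) (\<kappa> t z) = b + L z" using \<kappa>_chart_local[OF U(1,2)] by metis
  have "local_rep id c d z = inv_into U (\<kappa> t) (\<kappa> t z)" if "z \<in> W" for z
    using inv_quot_chart[OF deck_quotient_\<kappa> W(2) that] by (simp add: local_rep_def U(3) W(3))
  then show ?thesis using T W(1) yW(1) unfolding has_affine_rep_def
    by (intro exI[of _ "T \<inter> W"] exI[of _ b] exI[of _ L]) auto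
qed

lemma fibre_geometry:
  fixes t :: real
  defines "S \<equiv> quot_mfd (\<kappa> t)" and "C \<equiv> \<lambda>c y a b. 0" and "X \<equiv> \<lambda>c y. (1, 0)"
  shows "affine_connection S C" "flat_connection S C" "torsionfree S C" "vector_field S X" "nowhere_zero S X"
    "parallel_vfield S C X" "connection_related (slice t) (\<lambda>c y a b. 0) S C \<pi>" "vfield_related (slice t) (\<lambda>c y. (1, 0)) S X \<pi>"
proof -
  have fib: "connection_related S (\<lambda>c y a b. 0) S (\<lambda>c y a b. 0) id" "vfield_related S (\<lambda>c y. (1, 0)) S (\<lambda>c y. (1, 0)) id"
    unfolding S_def by (rule affine_rep_related, rule affine_rep_fibre, assumption+)+
  have sli: "connection_related (slice t) (\<lambda>c y a b. 0) S (\<lambda>c y a b. 0) \<pi>" "vfield_related (slice t) (\<lambda>c y. (1, 0)) S (\<lambda>c y. (1, 0)) \<pi>"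
    unfolding S_def by (rule affine_rep_related, rule affine_rep_slice, assumption+)+
  have bl: "bilinear (\<lambda>(a :: real \<times> 'v) (b :: real \<times> 'v). 0 :: real \<times> 'v)" by (simp add: bilinear_def linear_zero)
  show "affine_connection S C"
    using fib(1) bl by (simp add: affine_connection_def smooth_on_const C_def)
  show "vector_field S X"
    using fib(2) by (simp add: vector_field_def smooth_on_const X_def)
  show "connection_related (slice t) (\<lambda>c y a b. 0) S C \<pi>" "vfield_related (slice t) (\<lambda>c y. (1, 0)) S X \<pi>"
    using sli by (simp_all add: C_def X_def)
  show "flat_connection S C" by (simp add: flat_connection_def curvature_def C_def frechet_derivative_const)
  show "torsionfree S C" by (simp add: torsionfree_def C_def)
  show "nowhere_zero S X" by (simp add: nowhere_zero_def X_def zero_prod_def)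
  show "parallel_vfield S C X" by (simp add: parallel_vfield_def C_def X_def frechet_derivative_const)
qed

lemma fibre_submanifold:
  "smooth_manifold (quot_mfd (\<kappa> t))" "pts (quot_mfd (\<kappa> t)) = fibre t"
  "smooth_embedding (quot_mfd (\<kappa> t)) M id" "compact_space (mtop (quot_mfd (\<kappa> t)))"
proof -
  note deck = deck_quotient_\<kappa>[of t]
  show "smooth_manifold (quot_mfd (\<kappa> t))" by (rule manifold_quot[OF deck])
  show "pts (quot_mfd (\<kappa> t)) = fibre t" by (simp add: fibre_eq)
  show "smooth_embedding (quot_mfd (\<kappa> t)) M id" by (rule fibre_embedding(1)[OF param_quot[OF deck]]) simp_all
  obtain C where C: "compact C" "\<And>y. \<exists>\<sigma>\<in>Sg. \<exists>y'\<in>C. y = slice_act ip t \<sigma> y'" using slice_cocompact by blast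
  have "\<kappa> t ` C = range (\<kappa> t)"
  proof (intro equalityI subsetI)
    fix z assume "z \<in> range (\<kappa> t)"
    then obtain y where "z = \<kappa> t y" by blast
    then show "z \<in> \<kappa> t ` C" using C(2)[of y] \<kappa>_act by auto
  qed auto
  then show "compact_space (mtop (quot_mfd (\<kappa> t)))" by (rule compact_space_quot[OF C(1)])
qed

text \<open>Over an interval of length \<open>1\<close> in the variable \<open>t / p\<close>, two points of the region \<open>Q\<close> have the same image in
  \<open>M\<close> only if they are related by \<open>\<Sigma>\<close>, since the elements of \<open>\<Gamma>\<close> change \<open>t / p\<close> by integers.  Straightening
  commutes with \<open>\<Sigma>\<close>, so it descends to the required bundle chart, with the fibre over \<open>0\<close> as typical
  fibre.\<close>

lemma smooth_fibre_bundle: "smooth_bundle M (real_quot D) (quot_mfd (\<kappa> 0)) \<beta>"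
proof -
  obtain U where U: "\<And>w. U w \<in> solution_space f A" "\<And>t. linear (\<lambda>w. U w t)" "\<And>w. U w 0 = w" "\<And>t. bij (\<lambda>w. U w t)"
    "\<And>\<sigma> t. \<sigma> \<in> Sg \<Longrightarrow> U (snd \<sigma> 0) t = snd \<sigma> t"
    by (rule sl.solution_family) (rule that)
  interpret fam: slice_family f ip A Sg U
    by (intro slice_family.intro slice_group slice_family_axioms.intro) (fact U)+
  have deckB: "deck_quotient (real_coset D)" by (rule deck_quotient_real_coset[OF D_group])
  note paramB = param_quot[OF deckB] and paramF = param_quot[OF deck_quotient_\<kappa>[of 0]]
  have p: "p \<noteq> 0" using f(2) by simp
  then have pj: "inverse p * (p * j) = j" for j by simp
  have lin: "smooth_on UNIV (\<lambda>x::real \<times> real \<times> 'v. c * fst x)" for c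
    by (rule smooth_on_bounded_linear[OF open_UNIV bounded_linear_mult_right smooth_on_fst[OF open_UNIV smooth_on_id[OF open_UNIV]]])
  show ?thesis
    unfolding smooth_bundle_def real_quot_eq
  proof (intro conjI ballI)
    show "smooth_manifold M" using M(1) by (simp add: quotient_projection_def)
    show "smooth_manifold (quot_mfd (real_coset D))" by (rule manifold_quot[OF deckB])
    show "smooth_manifold (quot_mfd (\<kappa> 0))" by (rule manifold_quot[OF deck_quotient_\<kappa>])
    show "smooth_map M (quot_mfd (real_coset D)) \<beta>"
      by (rule smooth_map_lift[OF param_M paramB lin[of "inverse p"]]) (simp_all add: \<beta>_\<pi>)
    show "\<beta> ` pts M = pts (quot_mfd (real_coset D))"
    proof -
      have "\<beta> ` pts M = real_coset D ` range (\<lambda>x::real \<times> real \<times> 'v. inverse p * fst x)"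
        unfolding param_onD(2)[OF param_M, symmetric] image_image \<beta>_\<pi> ..
      also have "range (\<lambda>x::real \<times> real \<times> 'v. inverse p * fst x) = UNIV"
        by (rule surjI[of _ "\<lambda>r. (p * r, 0)"]) (simp add: p)
      finally show ?thesis by simp
    qed
    fix b assume "b \<in> pts (quot_mfd (real_coset D))"
    then obtain x0 where b: "b = real_coset D x0" by auto
    define J where "J = {x0 - 1/2 <..< x0 + 1/2}"
    define Q where "Q = {x::real \<times> real \<times> 'v. inverse p * fst x \<in> J}"
    define V where "V = {z \<in> pts M. \<beta> z \<in> real_coset D ` J}"
    have oJ: "open J" by (simp add: J_def)
    have oQ: "open Q"
      using open_vimage_Int[OF smooth_on_continuous[OF lin[of "inverse p"]] open_UNIV oJ] by (simp add: Q_def vimage_def)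
    have oU: "openin (mtop (quot_mfd (real_coset D))) (real_coset D ` J)" by (rule openin_quot_image[OF deckB oJ])
    have J_eq: "a = a'" if a: "a \<in> J" "a' \<in> J" "real_coset D a = real_coset D a'" for a a'
    proof -
      obtain k where k: "a' = a + of_int k" using a(3) coset_eq_iff by blast
      then have "\<bar>of_int k\<bar> < (1::real)" using a(1,2) by (auto simp: J_def)
      then have "k = 0" by linarith
      then show ?thesis using k by simp
    qed
    have QV: "\<pi> ` Q = V"
    proof (intro equalityI subsetI)
      fix z assume "z \<in> \<pi> ` Q"
      then show "z \<in> V" using param_onD(2)[OF param_M] by (auto simp: V_def Q_def \<beta>_\<pi>)
    next
      fix z assume z: "z \<in> V"
      then obtain j where j: "j \<in> J" "\<beta> z = real_coset D j" by (auto simp: V_def)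
      have "z \<in> fibre (p * j)" unfolding fibre_def pj using z j(2) by (simp add: V_def)
      then obtain y where "z = \<pi> (p * j, y)" unfolding fibre_eq by (auto simp: \<kappa>_def)
      moreover have "(p * j, y) \<in> Q" unfolding Q_def mem_Collect_eq fst_conv pj by (rule j(1))
      ultimately show "z \<in> \<pi> ` Q" by blast
    qed
    have oV: "openin (mtop M) V" unfolding QV[symmetric] by (rule param_onD(4)[OF param_M oQ]) simp
    define \<eta> where "\<eta> = (\<lambda>x. (inverse p * fst x, fam.straighten (fst x) (snd x)))"
    define \<theta> where "\<theta> = (\<lambda>y. (p * fst y, fam.unstraighten (p * fst y) (snd y)))"
    define \<Phi> where "\<Phi> z = map_prod (real_coset D) (\<kappa> 0) (\<eta> (SOME x. x \<in> Q \<and> \<pi> x = z))" for z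
    have same: "fst x = fst x' \<and> (\<exists>\<sigma>\<in>Sg. snd x' = slice_act ip (fst x) \<sigma> (snd x))"
      if x: "x \<in> Q" "x' \<in> Q" "\<pi> x' = \<pi> x" for x x'
    proof -
      have "real_coset D (inverse p * fst x) = real_coset D (inverse p * fst x')" using \<beta>_\<pi> x(3) by metis
      moreover have "inverse p * fst x \<in> J" "inverse p * fst x' \<in> J" using x by (simp_all only: Q_def mem_Collect_eq)
      ultimately have "inverse p * fst x = inverse p * fst x'" by (intro J_eq)
      then have "fst x = fst x'" using p by simp
      then show ?thesis using same_slice_iff[of "fst x" "snd x'" "snd x"] x(3) by (metis prod.collapse)
    qed
    have lift: "\<Phi> (\<pi> x) = map_prod (real_coset D) (\<kappa> 0) (\<eta> x)" if x: "x \<in> Q" for x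
    proof -
      let ?x' = "SOME x'. x' \<in> Q \<and> \<pi> x' = \<pi> x"
      have x': "?x' \<in> Q \<and> \<pi> ?x' = \<pi> x" by (rule someI[where P="\<lambda>x'. x' \<in> Q \<and> \<pi> x' = \<pi> x"]) (use x in simp)
      obtain \<sigma> where s: "\<sigma> \<in> Sg" "fst x = fst ?x'" "snd ?x' = slice_act ip (fst x) \<sigma> (snd x)"
        using same[OF x conjunct1[OF x'] conjunct2[OF x']] by blast
      then have e: "\<eta> ?x' = (inverse p * fst x, slice_act ip 0 \<sigma> (fam.straighten (fst x) (snd x)))"
        unfolding \<eta>_def s(2)[symmetric] s(3) by (simp only: fam.straighten_equivariant)
      show ?thesis unfolding \<Phi>_def e by (simp add: \<eta>_def \<kappa>_act[OF s(1)])
    qed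
    have "diffeomorphism (open_submfd M V) (prod_mfd (open_submfd (quot_mfd (real_coset D)) (real_coset D ` J)) (quot_mfd (\<kappa> 0))) \<Phi>"
    proof (rule diffeomorphism_lift[OF param_open_submfd[OF param_M oV oQ _ QV]
          param_prod[OF param_open_submfd[OF paramB oU oJ] paramF]])
      show "smooth_on Q \<eta>" unfolding \<eta>_def
        by (rule smooth_on_subset[OF smooth_on_Pair[OF open_UNIV lin fam.smooth_straighten]]) simp
      have "smooth_on UNIV (\<lambda>y::real \<times> real \<times> 'v. (p * fst y, snd y))"
        by (intro smooth_on_Pair lin smooth_on_snd smooth_on_id open_UNIV)
      from smooth_on_compose[OF open_UNIV open_UNIV _ this fam.smooth_unstraighten]
      have "smooth_on UNIV (\<lambda>y::real \<times> real \<times> 'v. fam.unstraighten (p * fst y) (snd y))" by simp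
      from smooth_on_Pair[OF open_UNIV lin this] have "smooth_on UNIV \<theta>" by (simp add: \<theta>_def)
      then show "smooth_on (J \<times> UNIV) \<theta>" by (rule smooth_on_subset) simp
      show "\<eta> ` Q \<subseteq> J \<times> UNIV" by (auto simp: \<eta>_def Q_def)
      show "\<theta> ` (J \<times> UNIV) \<subseteq> Q"
      proof
        fix x assume "x \<in> \<theta> ` (J \<times> UNIV)"
        then obtain y where y: "fst y \<in> J" "x = \<theta> y" by auto
        show "x \<in> Q" unfolding y(2) Q_def \<theta>_def mem_Collect_eq fst_conv pj by (rule y(1))
      qed
      show "\<eta> (\<theta> y) = y" for y
        unfolding \<eta>_def \<theta>_def fst_conv snd_conv pj fam.straighten_unstraighten by simp
      show "\<Phi> (\<pi> x) = map_prod (real_coset D) (\<kappa> 0) (\<eta> x)" if "x \<in> Q" for x by (rule lift[OF that])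
      show "\<pi> x = \<pi> x'" if x: "x \<in> Q" "x' \<in> Q"
        and e: "map_prod (real_coset D) (\<kappa> 0) (\<eta> x) = map_prod (real_coset D) (\<kappa> 0) (\<eta> x')" for x x'
      proof -
        have "inverse p * fst x \<in> J" "inverse p * fst x' \<in> J" using x by (simp_all only: Q_def mem_Collect_eq)
        moreover have "real_coset D (inverse p * fst x) = real_coset D (inverse p * fst x')"
          using e by (simp add: \<eta>_def)
        ultimately have "inverse p * fst x = inverse p * fst x'" by (intro J_eq)
        then have t: "fst x = fst x'" using p by simp
        have "\<kappa> 0 (fam.straighten (fst x) (snd x')) = \<kappa> 0 (fam.straighten (fst x) (snd x))" using e t by (simp add: \<eta>_def)
        then obtain \<sigma> where s: "\<sigma> \<in> Sg"
          "fam.straighten (fst x) (snd x') = slice_act ip 0 \<sigma> (fam.straighten (fst x) (snd x))" using \<kappa>_iff by blast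
        then have "fam.straighten (fst x) (snd x') = fam.straighten (fst x) (slice_act ip (fst x) \<sigma> (snd x))"
          by (simp add: fam.straighten_equivariant)
        then have "snd x' = slice_act ip (fst x) \<sigma> (snd x)" using fam.straighten_unstraighten(2) by metis
        then show ?thesis using same_slice_iff[of "fst x" "snd x'" "snd x"] s(1) t by (metis prod.collapse)
      qed
    qed simp_all
    moreover have "fst (\<Phi> z) = \<beta> z" if "z \<in> pts M" "\<beta> z \<in> real_coset D ` J" for z
    proof -
      have "z \<in> \<pi> ` Q" unfolding QV V_def using that by simp
      then obtain x where "x \<in> Q" "z = \<pi> x" by blast
      then show ?thesis using lift by (simp add: \<beta>_\<pi> \<eta>_def)
    qed
    moreover have "b \<in> real_coset D ` J" by (simp add: b J_def)
    ultimately show "\<exists>U \<Phi>. b \<in> U \<and> openin (mtop (quot_mfd (real_coset D))) U \<and>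
        diffeomorphism (open_submfd M {x \<in> pts M. \<beta> x \<in> U}) (prod_mfd (open_submfd (quot_mfd (real_coset D)) U) (quot_mfd (\<kappa> 0))) \<Phi> \<and>
        (\<forall>x\<in>pts M. \<beta> x \<in> U \<longrightarrow> fst (\<Phi> x) = \<beta> x)"
      using oU unfolding V_def by (intro exI[of _ "real_coset D ` J"] exI[of _ \<Phi>]) simp
  qed
qed

end

theorem mainTheorem2:
  fixes f :: "real \<Rightarrow> real" and p :: real and n :: nat
    and ip :: "'v::euclidean_space \<Rightarrow> 'v \<Rightarrow> real" and A :: "'v \<Rightarrow> 'v"
    and \<Gamma> :: "'v gelt set"
    and M :: "('m, real \<times> real \<times> 'v) mfd" and \<pi> :: "real \<times> real \<times> 'v \<Rightarrow> 'm"
  defines "G \<equiv> G_grp f p ip A" and "act \<equiv> G_act p ip"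
  defines "\<Sigma> \<equiv> \<Gamma> \<inter> kernel G integer_group G_proj"
  assumes f: "smooth_on UNIV f" "\<not> f constant_on UNIV" "p > 0" "\<forall>t. f (t + p) = f t"
    and n: "n \<ge> 4" "DIM('v) = n - 2"
    and ip: "pseudo_euclidean ip"
    and A: "linear A" "A \<noteq> (\<lambda>v. 0)" "trace_op A = 0" "\<forall>v w. ip (A v) w = ip v (A w)"
    and \<Gamma>: "subgroup \<Gamma> G" "properly_discontinuous (G\<lparr>carrier := \<Gamma>\<rparr>) act euclidean_mfd"
    and M: "quotient_projection (G\<lparr>carrier := \<Gamma>\<rparr>) act euclidean_mfd M \<pi>" "compact_space (mtop M)"
  shows "(\<exists>m::int. m > 0 \<and> G_proj ` \<Gamma> = range ((*) m)) \<and>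
    (\<exists>\<beta> (F :: ('m, real \<times> 'v) mfd).
       smooth_bundle M (real_quot (G_proj ` \<Gamma>)) F \<beta> \<and>
       (\<forall>t s v. \<beta> (\<pi> (t, s, v)) = real_coset (G_proj ` \<Gamma>) (inverse p * t)) \<and>
       (\<forall>t. let fibre = {x \<in> pts M. \<beta> x = real_coset (G_proj ` \<Gamma>) (inverse p * t)} in
          smooth_embedding (slice t) (euclidean_mfd :: (real \<times> real \<times> 'v, _) mfd) id \<and>
          (\<forall>g\<in>\<Sigma>. act g ` pts (slice t) = pts (slice t)) \<and>
          properly_discontinuous (G\<lparr>carrier := \<Sigma>\<rparr>) act (slice t) \<and>
          (\<forall>(N :: ('k, real \<times> 'v) mfd) \<rho>.
             quotient_projection (G\<lparr>carrier := \<Sigma>\<rparr>) act (slice t) N \<rho> \<longrightarrow>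
             (\<exists>\<iota>. smooth_embedding N M \<iota> \<and> (\<forall>x\<in>pts (slice t). \<iota> (\<rho> x) = \<pi> x) \<and>
                  \<iota> ` pts N = fibre)) \<and>
          (\<forall>g\<in>\<Sigma>. \<exists>L. affine_with_linear_part (pts (slice t)) (act g) L \<and> L (0, 1, 0) = (0, 1, 0)) \<and>
          (\<exists>S :: ('m, real \<times> 'v) mfd.
             smooth_manifold S \<and> pts S = fibre \<and> smooth_embedding S M id \<and>
             compact_space (mtop S) \<and>
             (\<exists>C X. affine_connection S C \<and> flat_connection S C \<and> torsionfree S C \<and>
                vector_field S X \<and> nowhere_zero S X \<and> parallel_vfield S C X \<and>
                connection_related (slice t) (\<lambda>c y a b. 0) S C \<pi> \<and>
                vfield_related (slice t) (\<lambda>c y. (1, 0)) S X \<pi>))))"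
proof -
  have "free_diffeo_action (G\<lparr>carrier := \<Gamma>\<rparr>) act euclidean_mfd"
    using \<Gamma>(2) by (simp add: properly_discontinuous_def)
  then interpret compact_quotient f p ip A \<Gamma> M \<pi>
    using f ip A \<Gamma> M unfolding G_def act_def by (intro compact_quotient.intro) simp_all
  have fib: "{x \<in> pts M. \<beta> x = real_coset (G_proj ` \<Gamma>) (inverse p * t)} = fibre t" for t
    by (simp add: fibre_def)
  show ?thesis
    unfolding Let_def \<Sigma>_def G_def act_def
  proof (rule conjI[OF D_cyclic], rule exI[of _ \<beta>], rule exI[of _ "quot_mfd (\<kappa> 0)"], intro conjI allI)
    show "smooth_bundle M (real_quot (G_proj ` \<Gamma>)) (quot_mfd (\<kappa> 0)) \<beta>" by (rule smooth_fibre_bundle)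
    show "\<beta> (\<pi> (t, s, v)) = real_coset (G_proj ` \<Gamma>) (inverse p * t)" for t s v by (simp add: \<beta>_\<pi>)
    fix t
    show "smooth_embedding (slice t) (euclidean_mfd :: (real \<times> real \<times> 'v, _) mfd) id" by (rule slice_embedding)
    show "\<forall>g\<in>\<Gamma> \<inter> kernel (G_grp f p ip A) integer_group G_proj. G_act p ip g ` pts (slice t) = pts (slice t)"
      using act_slice_image by blast
    show "properly_discontinuous (G_grp f p ip A\<lparr>carrier := \<Gamma> \<inter> kernel (G_grp f p ip A) integer_group G_proj\<rparr>)
        (G_act p ip) (slice t)" by (rule properly_discontinuous_slice)
    show "quotient_projection (G_grp f p ip A\<lparr>carrier := \<Gamma> \<inter> kernel (G_grp f p ip A) integer_group G_proj\<rparr>)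
          (G_act p ip) (slice t) N \<rho> \<longrightarrow>
        (\<exists>\<iota>. smooth_embedding N M \<iota> \<and> (\<forall>x\<in>pts (slice t). \<iota> (\<rho> x) = \<pi> x) \<and>
          \<iota> ` pts N = {x \<in> pts M. \<beta> x = real_coset (G_proj ` \<Gamma>) (inverse p * t)})"
      for N :: "('k, real \<times> 'v) mfd" and \<rho>
      unfolding fib using slice_quotient_embedding by blast
    show "\<forall>g\<in>\<Gamma> \<inter> kernel (G_grp f p ip A) integer_group G_proj.
        \<exists>L. affine_with_linear_part (pts (slice t)) (G_act p ip g) L \<and> L (0, 1, 0) = (0, 1, 0)"
      using act_affine by blast
    show "\<exists>S :: ('m, real \<times> 'v) mfd.
        smooth_manifold S \<and> pts S = {x \<in> pts M. \<beta> x = real_coset (G_proj ` \<Gamma>) (inverse p * t)} \<and>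
        smooth_embedding S M id \<and> compact_space (mtop S) \<and>
        (\<exists>C X. affine_connection S C \<and> flat_connection S C \<and> torsionfree S C \<and>
          vector_field S X \<and> nowhere_zero S X \<and> parallel_vfield S C X \<and>
          connection_related (slice t) (\<lambda>c y a b. 0) S C \<pi> \<and>
          vfield_related (slice t) (\<lambda>c y. (1, 0)) S X \<pi>)"
      unfolding fib using fibre_submanifold[of t] fibre_geometry[of t] by blast
  qed
qed

end
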